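(* Let $(R,\Delta,\mathfrak a_\bullet)$ be a triple. The centers of sharp $F$-purity for $(R,\Delta,\mathfrak a_\bullet)$ are precisely the prime ideals of $R$ that are uniformly $(\Delta,\mathfrak a_\bullet,F)$-compatible.
   Context: All rings are commutative, noetherian, excellent, of prime characteristic $p>0$ and $F$-finite (finite as modules over themselves via Frobenius). $F^e_*M$ denotes $M$ viewed as an $R$-module via the $e$-iterated Frobenius. $R^\circ$ is the set of elements of $R$ in no minimal prime. A graded system of ideals $\mathfrak a_\bullet=\{\mathfrak a_i\}_{i\ge 0}$ satisfies $\mathfrak a_i\mathfrak a_j\subseteq\mathfrak a_{i+j}$. A triple $(R,\Delta,\mathfrak a_\bullet)$ consists of a reduced ring $R$, an effective $\mathbb R$-(Weil) divisor $\Delta$ on $\operatorname{Spec}R$, and a graded system of ideals of $R$ such that: $R$ is a normal domain if $\Delta\ne0$; $\mathfrak a_0=R$; $\mathfrak a_i\cap R^\circ\neq\emptyset$ for all $i$. $R(D)$ denotes the global sections of $\mathcal O_{\operatorname{Spec}R}(D)$ (and $R(0)=R$). An ideal $I\subseteq R$ is uniformly $(\Delta,\mathfrak a_\bullet,F)$-compatible if for every $e>0$, every $a\in\mathfrak a_{p^e-1}$ and every $R$-linear map $\phi:F^e_*R(\lceil (p^e-1)\Delta\rceil)\to R$ one has $\phi(F^e_*(aI))\subseteq I$ (where $F^e_*(aI)\subseteq F^e_*R\subseteq F^e_*R(\lceil (p^e-1)\Delta\rceil)$). A prime $P\in\operatorname{Spec}R$ is a center of sharp $F$-purity for $(R,\Delta,\mathfrak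 a_\bullet)$ if for every $f\in PR_P$, every $e>0$ and every $a\in\mathfrak a_{p^e-1}$, the $R_P$-linear map $R_P\to F^e_*R_P(\lceil (p^e-1)\Delta|_{\operatorname{Spec}R_P}\rceil)$ sending $1$ to $fa$ does not split. *)

theory Defs
  imports Complex_Main "HOL-Library.Extended_Nat" "HOL-Computational_Algebra.Primes"
    "HOL-Algebra.Algebra"
begin

section \<open>Localization\<close>

definition loc_rel :: "('a, 'b) ring_scheme \<Rightarrow> 'a set \<Rightarrow> (('a \<times> 'a) \<times> ('a \<times> 'a)) set" where
  "loc_rel A S = {((x, s), (y, t)). x \<in> carrier A \<and> s \<in> S \<and> y \<in> carrier A \<and> t \<in> S \<and>
     (\<exists>u\<in>S. u \<otimes>\<^bsub>A\<^esub> (t \<otimes>\<^bsub>A\<^esub> x) = u \<otimes>\<^bsub>A\<^esub> (s \<otimes>\<^bsub>A\<^esub> y))}"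

definition loc_frac :: "('a, 'b) ring_scheme \<Rightarrow> 'a set \<Rightarrow> 'a \<Rightarrow> 'a \<Rightarrow> ('a \<times> 'a) set" where
  "loc_frac A S x s = loc_rel A S `` {(x, s)}"

text \<open>The ring of fractions \<open>S\<^sup>-\<^sup>1 A\<close>, for a multiplicative set \<open>S\<close>; its elements are the
  equivalence classes \<open>loc_frac A S x s\<close>.\<close>

definition localization :: "('a, 'b) ring_scheme \<Rightarrow> 'a set \<Rightarrow> ('a \<times> 'a) set ring" where
  "localization A S = \<lparr>
     carrier = (carrier A \<times> S) // loc_rel A S,
     monoid.mult = (\<lambda>U V. \<Union>(x, s)\<in>U. \<Union>(y, t)\<in>V. loc_frac A S (x \<otimes>\<^bsub>A\<^esub> y) (s \<otimes>\<^bsub>A\<^esub> t)),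
     monoid.one = loc_frac A S \<one>\<^bsub>A\<^esub> \<one>\<^bsub>A\<^esub>,
     ring.zero = loc_frac A S \<zero>\<^bsub>A\<^esub> \<one>\<^bsub>A\<^esub>,
     ring.add = (\<lambda>U V. \<Union>(x, s)\<in>U. \<Union>(y, t)\<in>V.
              loc_frac A S ((t \<otimes>\<^bsub>A\<^esub> x) \<oplus>\<^bsub>A\<^esub> (s \<otimes>\<^bsub>A\<^esub> y)) (s \<otimes>\<^bsub>A\<^esub> t))\<rparr>"

definition local_ring_at :: "('a, 'b) ring_scheme \<Rightarrow> 'a set \<Rightarrow> ('a \<times> 'a) set ring" where
  "local_ring_at A P = localization A (carrier A - P)"

definition to_local :: "('a, 'b) ring_scheme \<Rightarrow> 'a set \<Rightarrow> 'a \<Rightarrow> ('a \<times> 'a) set" where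
  "to_local A P x = loc_frac A (carrier A - P) x \<one>\<^bsub>A\<^esub>"

text \<open>The ideal \<open>P A\<^sub>P\<close>.\<close>

definition local_max_ideal :: "('a, 'b) ring_scheme \<Rightarrow> 'a set \<Rightarrow> ('a \<times> 'a) set set" where
  "local_max_ideal A P = genideal (local_ring_at A P) (to_local A P ` P)"

definition nonzerodivisors :: "('a, 'b) ring_scheme \<Rightarrow> 'a set" where
  "nonzerodivisors A = {s \<in> carrier A. \<forall>x\<in>carrier A. s \<otimes>\<^bsub>A\<^esub> x = \<zero>\<^bsub>A\<^esub> \<longrightarrow> x = \<zero>\<^bsub>A\<^esub>}"

text \<open>The total ring of fractions \<open>K(A)\<close>; it is the field of fractions when \<open>A\<close> is a domain.\<close>

definition total_frac :: "('a, 'b) ring_scheme \<Rightarrow> ('a \<times> 'a) set ring" where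
  "total_frac A = localization A (nonzerodivisors A)"

definition to_frac :: "('a, 'b) ring_scheme \<Rightarrow> 'a \<Rightarrow> ('a \<times> 'a) set" where
  "to_frac A x = loc_frac A (nonzerodivisors A) x \<one>\<^bsub>A\<^esub>"


section \<open>Conditions on rings\<close>

definition has_characteristic :: "('a, 'b) ring_scheme \<Rightarrow> nat \<Rightarrow> bool" where
  "has_characteristic A p \<longleftrightarrow> (\<forall>n::nat. [n] \<cdot>\<^bsub>A\<^esub> \<one>\<^bsub>A\<^esub> = \<zero>\<^bsub>A\<^esub> \<longleftrightarrow> p dvd n)"

definition reduced_ring :: "('a, 'b) ring_scheme \<Rightarrow> bool" where
  "reduced_ring A \<longleftrightarrow> (\<forall>x\<in>carrier A. \<forall>n::nat. x [^]\<^bsub>A\<^esub> n = \<zero>\<^bsub>A\<^esub> \<longrightarrow> x = \<zero>\<^bsub>A\<^esub>)"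

definition minimal_prime :: "('a, 'b) ring_scheme \<Rightarrow> 'a set \<Rightarrow> bool" where
  "minimal_prime A Q \<longleftrightarrow> primeideal Q A \<and> (\<forall>Q'. primeideal Q' A \<and> Q' \<subseteq> Q \<longrightarrow> Q' = Q)"

text \<open>\<open>A\<^sup>\<circ>\<close>: the elements of \<open>A\<close> that lie in no minimal prime.\<close>

definition ring_circ :: "('a, 'b) ring_scheme \<Rightarrow> 'a set" where
  "ring_circ A = {x \<in> carrier A. \<forall>Q. minimal_prime A Q \<longrightarrow> x \<notin> Q}"

text \<open>Polynomials are coefficient lists with the leading coefficient first.\<close>

definition integral_over_base :: "('a, 'b) ring_scheme \<Rightarrow> ('a \<times> 'a) set \<Rightarrow> bool" where
  "integral_over_base A z \<longleftrightarrow>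
     (\<exists>q. q \<noteq> [] \<and> set q \<subseteq> to_frac A ` carrier A \<and> hd q = \<one>\<^bsub>total_frac A\<^esub> \<and>
          ring.eval (total_frac A) q z = \<zero>\<^bsub>total_frac A\<^esub>)"

definition normal_domain :: "('a, 'b) ring_scheme \<Rightarrow> bool" where
  "normal_domain A \<longleftrightarrow> domain A \<and>
     (\<forall>z\<in>carrier (total_frac A). integral_over_base A z \<longrightarrow> z \<in> to_frac A ` carrier A)"


section \<open>Modules and Frobenius pushforward\<close>

definition ring_as_module :: "('a, 'b) ring_scheme \<Rightarrow> ('a, 'a) module" where
  "ring_as_module A = \<lparr>carrier = carrier A, monoid.mult = monoid.mult A,
     monoid.one = monoid.one A, ring.zero = ring.zero A, ring.add = ring.add A,
     module.smult = monoid.mult A\<rparr>"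

definition module_hom ::
  "('a, 'b) ring_scheme \<Rightarrow> ('a, 'c, 'm) module_scheme \<Rightarrow> ('a, 'd, 'n) module_scheme \<Rightarrow> ('c \<Rightarrow> 'd) set"
where
  "module_hom A M N = {\<phi>. \<phi> \<in> carrier M \<rightarrow> carrier N \<and>
     (\<forall>x\<in>carrier M. \<forall>y\<in>carrier M. \<phi> (x \<oplus>\<^bsub>M\<^esub> y) = \<phi> x \<oplus>\<^bsub>N\<^esub> \<phi> y) \<and>
     (\<forall>r\<in>carrier A. \<forall>x\<in>carrier M. \<phi> (r \<odot>\<^bsub>M\<^esub> x) = r \<odot>\<^bsub>N\<^esub> \<phi> x)}"

definition map_splits ::
  "('a, 'b) ring_scheme \<Rightarrow> ('a, 'c, 'm) module_scheme \<Rightarrow> ('a, 'd, 'n) module_scheme \<Rightarrow> ('c \<Rightarrow> 'd) \<Rightarrow> bool"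
where
  "map_splits A M N \<psi> \<longleftrightarrow> (\<exists>\<theta>\<in>module_hom A N M. \<forall>x\<in>carrier M. \<theta> (\<psi> x) = x)"

definition finite_module :: "('a, 'b) ring_scheme \<Rightarrow> ('a, 'c, 'm) module_scheme \<Rightarrow> bool" where
  "finite_module A M \<longleftrightarrow> (\<exists>B. finite B \<and> B \<subseteq> carrier M \<and>
     (\<forall>x\<in>carrier M. \<exists>r\<in>B \<rightarrow> carrier A. x = (\<Oplus>\<^bsub>M\<^esub>b\<in>B. r b \<odot>\<^bsub>M\<^esub> b)))"

text \<open>\<open>F\<^sup>e\<^sub>* M\<close> has the same underlying abelian group as \<open>M\<close>; only the scalar action changes.\<close>

definition frob_push ::
  "('a, 'b) ring_scheme \<Rightarrow> nat \<Rightarrow> nat \<Rightarrow> ('a, 'c, 'm) module_scheme \<Rightarrow> ('a, 'c, 'm) module_scheme"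
where
  "frob_push A p e M = M\<lparr>module.smult := (\<lambda>r x. (r [^]\<^bsub>A\<^esub> (p ^ e)) \<odot>\<^bsub>M\<^esub> x)\<rparr>"

definition F_finite :: "('a, 'b) ring_scheme \<Rightarrow> nat \<Rightarrow> bool" where
  "F_finite A p \<longleftrightarrow> finite_module A (frob_push A p 1 (ring_as_module A))"


section \<open>Weil divisors\<close>

definition prime_height :: "('a, 'b) ring_scheme \<Rightarrow> 'a set \<Rightarrow> enat" where
  "prime_height A Q = Sup {enat n | n. \<exists>c :: nat \<Rightarrow> 'a set.
     (\<forall>i\<le>n. primeideal (c i) A) \<and> (\<forall>i<n. c i \<subset> c (Suc i)) \<and> c n = Q}"

text \<open>Prime divisors of \<open>Spec A\<close>, identified with their generic points.\<close>

definition prime_divisors :: "('a, 'b) ring_scheme \<Rightarrow> 'a set set" where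
  "prime_divisors A = {Q. primeideal Q A \<and> prime_height A Q = 1}"

text \<open>An \<open>\<real>\<close>-divisor is given by its coefficients. The coefficient function is required to vanish
  off the prime divisors, so that the zero divisor is exactly \<open>\<lambda>_. 0\<close>.\<close>

definition effective_divisor :: "('a, 'b) ring_scheme \<Rightarrow> ('a set \<Rightarrow> real) \<Rightarrow> bool" where
  "effective_divisor A D \<longleftrightarrow>
     finite {Q. D Q \<noteq> 0} \<and> {Q. D Q \<noteq> 0} \<subseteq> prime_divisors A \<and> (\<forall>Q. D Q \<ge> 0)"

definition ceil_divisor :: "('q \<Rightarrow> real) \<Rightarrow> 'q \<Rightarrow> int" where
  "ceil_divisor D = (\<lambda>Q. \<lceil>D Q\<rceil>)"

text \<open>The restriction of \<open>D\<close> to \<open>Spec A\<^sub>P\<close>: a prime divisor of \<open>Spec A\<^sub>P\<close> gets the coefficient in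
  \<open>D\<close> of its contraction to \<open>A\<close>.\<close>

definition restrict_divisor ::
  "('a, 'b) ring_scheme \<Rightarrow> 'a set \<Rightarrow> ('a set \<Rightarrow> real) \<Rightarrow> (('a \<times> 'a) set set \<Rightarrow> real)" where
  "restrict_divisor A P D = (\<lambda>Q. if Q \<in> prime_divisors (local_ring_at A P)
     then D {x \<in> carrier A. to_local A P x \<in> Q} else 0)"

fun ideal_power :: "('a, 'b) ring_scheme \<Rightarrow> 'a set \<Rightarrow> nat \<Rightarrow> 'a set" where
  "ideal_power A I 0 = carrier A"
| "ideal_power A I (Suc n) = ideal_prod A I (ideal_power A I n)"

text \<open>The valuation of the discrete valuation ring \<open>A\<^sub>Q\<close> (for \<open>Q\<close> a prime divisor of a noetherian
  normal domain \<open>A\<close>): first on nonzero elements of \<open>A\<close>, as the largest \<open>n\<close> with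
  \<open>x \<in> (Q A\<^sub>Q)\<^sup>n\<close>, then on nonzero fractions, by \<open>v(x/y) = v(x) - v(y)\<close>.\<close>

definition order_along :: "('a, 'b) ring_scheme \<Rightarrow> 'a set \<Rightarrow> 'a \<Rightarrow> nat" where
  "order_along A Q x =
     (GREATEST n. to_local A Q x \<in> ideal_power (local_ring_at A Q) (local_max_ideal A Q) n)"

definition divisor_valuation :: "('a, 'b) ring_scheme \<Rightarrow> 'a set \<Rightarrow> ('a \<times> 'a) set \<Rightarrow> int" where
  "divisor_valuation A Q g = (THE k. \<exists>x\<in>carrier A - {\<zero>\<^bsub>A\<^esub>}. \<exists>y\<in>carrier A - {\<zero>\<^bsub>A\<^esub>}.
     g = loc_frac A (nonzerodivisors A) x y \<and> k = int (order_along A Q x) - int (order_along A Q y))"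

text \<open>\<open>A(D)\<close> as a subset of \<open>K(A)\<close>. The first case covers rings that need not be normal domains;
  for a noetherian normal domain it agrees with the second case.\<close>

definition sections :: "('a, 'b) ring_scheme \<Rightarrow> ('a set \<Rightarrow> int) \<Rightarrow> ('a \<times> 'a) set set" where
  "sections A D = (if D = (\<lambda>_. 0) then to_frac A ` carrier A
     else {g \<in> carrier (total_frac A). g = \<zero>\<^bsub>total_frac A\<^esub> \<or>
             (\<forall>Q\<in>prime_divisors A. divisor_valuation A Q g + D Q \<ge> 0)})"

text \<open>\<open>A(D)\<close> as an \<open>A\<close>-module. The fields \<open>mult\<close> and \<open>one\<close>, which belong to every module record,
  play no role.\<close>

definition sections_module ::
  "('a, 'b) ring_scheme \<Rightarrow> ('a set \<Rightarrow> int) \<Rightarrow> ('a, ('a \<times> 'a) set) module" where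
  "sections_module A D = \<lparr>carrier = sections A D, monoid.mult = monoid.mult (total_frac A),
     monoid.one = monoid.one (total_frac A), ring.zero = ring.zero (total_frac A),
     ring.add = ring.add (total_frac A),
     module.smult = (\<lambda>r g. to_frac A r \<otimes>\<^bsub>total_frac A\<^esub> g)\<rparr>"

text \<open>\<open>F\<^sup>e\<^sub>* A(\<lceil>(p\<^sup>e - 1) D\<rceil>)\<close>.\<close>

definition frob_sections ::
  "('a, 'b) ring_scheme \<Rightarrow> nat \<Rightarrow> nat \<Rightarrow> ('a set \<Rightarrow> real) \<Rightarrow> ('a, ('a \<times> 'a) set) module" where
  "frob_sections A p e D =
     frob_push A p e (sections_module A (ceil_divisor (\<lambda>Q. real (p ^ e - 1) * D Q)))"


section \<open>Triples, compatible ideals and centers of sharp F-purity\<close>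

definition graded_system :: "('a, 'b) ring_scheme \<Rightarrow> (nat \<Rightarrow> 'a set) \<Rightarrow> bool" where
  "graded_system A \<aa> \<longleftrightarrow>
     (\<forall>i. ideal (\<aa> i) A) \<and> (\<forall>i j. ideal_prod A (\<aa> i) (\<aa> j) \<subseteq> \<aa> (i + j))"

text \<open>Excellence is not listed among the conditions on the ring, because every noetherian
  \<open>F\<close>-finite ring is excellent (Kunz, On noetherian rings of characteristic p, Theorem 2.5).\<close>

definition is_triple ::
  "nat \<Rightarrow> ('a, 'b) ring_scheme \<Rightarrow> ('a set \<Rightarrow> real) \<Rightarrow> (nat \<Rightarrow> 'a set) \<Rightarrow> bool" where
  "is_triple p A \<Delta> \<aa> \<longleftrightarrow>
     cring A \<and> noetherian_ring A \<and> Factorial_Ring.prime p \<and> has_characteristic A p \<and> F_finite A p \<and>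
     reduced_ring A \<and> effective_divisor A \<Delta> \<and> graded_system A \<aa> \<and>
     (\<Delta> \<noteq> (\<lambda>_. 0) \<longrightarrow> normal_domain A) \<and>
     \<aa> 0 = carrier A \<and> (\<forall>i. \<aa> i \<inter> ring_circ A \<noteq> {})"

definition uniformly_compatible ::
  "nat \<Rightarrow> ('a, 'b) ring_scheme \<Rightarrow> ('a set \<Rightarrow> real) \<Rightarrow> (nat \<Rightarrow> 'a set) \<Rightarrow> 'a set \<Rightarrow> bool" where
  "uniformly_compatible p A \<Delta> \<aa> I \<longleftrightarrow> ideal I A \<and>
     (\<forall>e>0. \<forall>a\<in>\<aa> (p ^ e - 1). \<forall>\<phi>\<in>module_hom A (frob_sections A p e \<Delta>) (ring_as_module A).
        \<phi> ` to_frac A ` (\<lambda>x. a \<otimes>\<^bsub>A\<^esub> x) ` I \<subseteq> I)"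

text \<open>The \<open>A\<close>-linear map \<open>A \<rightarrow> F\<^sup>e\<^sub>* A(\<lceil>(p\<^sup>e - 1) D\<rceil>)\<close> that sends \<open>1\<close> to \<open>g \<in> A\<close>.\<close>

definition frob_map ::
  "('a, 'b) ring_scheme \<Rightarrow> nat \<Rightarrow> nat \<Rightarrow> ('a set \<Rightarrow> real) \<Rightarrow> 'a \<Rightarrow> 'a \<Rightarrow> ('a \<times> 'a) set" where
  "frob_map A p e D g = (\<lambda>r. r \<odot>\<^bsub>frob_sections A p e D\<^esub> to_frac A g)"

definition center_of_sharp_F_purity ::
  "nat \<Rightarrow> ('a, 'b) ring_scheme \<Rightarrow> ('a set \<Rightarrow> real) \<Rightarrow> (nat \<Rightarrow> 'a set) \<Rightarrow> 'a set \<Rightarrow> bool" where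
  "center_of_sharp_F_purity p A \<Delta> \<aa> P \<longleftrightarrow> primeideal P A \<and>
     (let A\<^sub>P = local_ring_at A P; \<Delta>\<^sub>P = restrict_divisor A P \<Delta> in
      \<forall>f\<in>local_max_ideal A P. \<forall>e>0. \<forall>a\<in>\<aa> (p ^ e - 1).
        \<not> map_splits A\<^sub>P (ring_as_module A\<^sub>P) (frob_sections A\<^sub>P p e \<Delta>\<^sub>P)
            (frob_map A\<^sub>P p e \<Delta>\<^sub>P (f \<otimes>\<^bsub>A\<^sub>P\<^esub> to_local A P a)))"

end

theory Submission
  imports Defs
begin

text \<open>Let \<open>q = p\<^sup>e\<close> and let \<open>N\<close> be the \<open>R\<close>-module \<open>F\<^sup>e\<^sub>* R(\<lceil>(q - 1)\<Delta>\<rceil>)\<close>. The theorem compares maps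
  \<open>N \<rightarrow> R\<close> with maps \<open>N' \<rightarrow> R\<^sub>P\<close>, where \<open>N'\<close> is the analogue of \<open>N\<close> over \<open>R\<^sub>P\<close>. It holds because \<open>N'\<close> is the
  localization of \<open>N\<close> at \<open>P\<close> and \<open>N\<close> is finitely generated over the noetherian ring \<open>R\<close>, so that
  the two kinds of maps agree up to denominators outside \<open>P\<close> (\<open>localize_hom\<close>, \<open>descend_hom\<close>).

  A splitting of \<open>1 \<mapsto> fa\<close> is a map \<open>\<theta>\<close> with \<open>\<theta>(fa) = 1\<close>. If some \<open>\<phi>: N \<rightarrow> R\<close> and \<open>x \<in> P\<close> violate
  compatibility, that is \<open>\<phi>(ax) \<notin> P\<close>, then the localization of \<open>\<phi>\<close> takes a unit value at \<open>ax/1\<close>, and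
  division by this unit gives a splitting for \<open>f = x/1\<close>. Conversely let \<open>\<theta>\<close> be a splitting for
  \<open>f = x/s\<close> with \<open>x \<in> P\<close>. The scalar \<open>s\<close> acts on \<open>N'\<close> as multiplication by \<open>s\<^sup>q\<close>, so
  \<open>\<theta>(a s\<^bsup>q-1\<^esup> x) = s\<close>; a multiple \<open>w\<theta>\<close> with \<open>w \<notin> P\<close> descends to a map \<open>N \<rightarrow> R\<close>. Its value at
  \<open>a (s\<^bsup>q-1\<^esup> x)\<close> has the image \<open>ws\<close> in \<open>R\<^sub>P\<close> and so lies outside \<open>P\<close>, although \<open>s\<^bsup>q-1\<^esup> x \<in> P\<close>.

  Most of the work is the identification of \<open>N'\<close> with the localization of \<open>N\<close>. For \<open>\<Delta> = 0\<close> it is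
  immediate. For \<open>\<Delta> \<noteq> 0\<close> the ring is a normal noetherian domain and \<open>R(D)\<close> is described by the
  orders at the height one primes; those of \<open>R\<^sub>P\<close> come from the height one primes \<open>Q \<subseteq> P\<close> of \<open>R\<close>,
  with the same uniformizers (\<open>valuation_prime_localization\<close>). Two things remain. A fraction whose
  poles are bounded by \<open>D\<close> at the primes inside \<open>P\<close> must become a section of \<open>R(D)\<close> after multiplication
  with an element outside \<open>P\<close> (\<open>clear_poles\<close>). And a fraction without poles must lie in the ring
  (\<open>divides_if_order_le\<close>): the restriction of \<open>\<Delta>\<close> to \<open>R\<^sub>P\<close> can vanish, and then its sections are
  \<open>R\<^sub>P\<close> itself. Both are arguments with associated primes (\<open>associated_prime\<close>); the second one also
  uses that in a normal noetherian domain an associated prime of a principal ideal is locally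
  principal (\<open>prime_colon_uniformizer\<close>).\<close>

section \<open>Rings of fractions\<close>

locale fractions = cring R for R (structure) +
  fixes S :: "'a set"
  assumes S_sub: "S \<subseteq> carrier R"
    and S_one: "\<one> \<in> S"
    and S_mult: "\<lbrakk>s \<in> S; t \<in> S\<rbrakk> \<Longrightarrow> s \<otimes> t \<in> S"
begin

abbreviation frac :: "'a \<Rightarrow> 'a \<Rightarrow> ('a \<times> 'a) set" where
  "frac \<equiv> loc_frac R S"

abbreviation L :: "('a \<times> 'a) set ring" where
  "L \<equiv> localization R S"

lemma S_carr [simp, intro]: "s \<in> S \<Longrightarrow> s \<in> carrier R"
  using S_sub by blast

lemma equiv_loc_rel: "equiv (carrier R \<times> S) (loc_rel R S)"
proof (rule equivI)
  show "loc_rel R S \<subseteq> (carrier R \<times> S) \<times> carrier R \<times> S"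
    by (auto simp: loc_rel_def)
  show "refl_on (carrier R \<times> S) (loc_rel R S)"
    using S_one by (auto simp: refl_on_def loc_rel_def)
  show "sym (loc_rel R S)"
    by (force simp: sym_def loc_rel_def)
  show "trans (loc_rel R S)"
  proof (rule transI)
    fix a b c assume "(a, b) \<in> loc_rel R S" "(b, c) \<in> loc_rel R S"
    then obtain x s y t z r u v where eq: "a = (x, s)" "b = (y, t)" "c = (z, r)"
      and m: "x \<in> carrier R" "s \<in> S" "y \<in> carrier R" "t \<in> S" "z \<in> carrier R" "r \<in> S"
        "u \<in> S" "v \<in> S"
      and u: "u \<otimes> (t \<otimes> x) = u \<otimes> (s \<otimes> y)" and v: "v \<otimes> (r \<otimes> y) = v \<otimes> (t \<otimes> z)"
      by (auto simp: loc_rel_def)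
    note c = m(1,3,5) m(2,4,6,7,8)[THEN S_carr]
    have "(u \<otimes> v \<otimes> t) \<otimes> (r \<otimes> x) = v \<otimes> r \<otimes> (u \<otimes> (t \<otimes> x))"
      using c by (simp add: m_ac)
    also have "\<dots> = u \<otimes> s \<otimes> (v \<otimes> (r \<otimes> y))"
      unfolding u using c by (simp add: m_ac)
    also have "\<dots> = (u \<otimes> v \<otimes> t) \<otimes> (s \<otimes> z)"
      unfolding v using c by (simp add: m_ac)
    finally show "(a, c) \<in> loc_rel R S"
      using m S_mult by (auto simp: loc_rel_def eq)
  qed
qed

lemma frac_eq_iff:
  assumes "x \<in> carrier R" "s \<in> S" "y \<in> carrier R" "t \<in> S"
  shows "frac x s = frac y t \<longleftrightarrow> (\<exists>u\<in>S. u \<otimes> (t \<otimes> x) = u \<otimes> (s \<otimes> y))"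
  using eq_equiv_class_iff[OF equiv_loc_rel, of "(x, s)" "(y, t)"] assms
  by (simp add: loc_frac_def loc_rel_def)

lemma frac_eqI:
  assumes "t \<otimes> x = s \<otimes> y" "x \<in> carrier R" "s \<in> S" "y \<in> carrier R" "t \<in> S"
  shows "frac x s = frac y t"
  using assms S_one by (auto simp: frac_eq_iff)

lemma frac_closed [simp, intro]:
  assumes "x \<in> carrier R" "s \<in> S"
  shows "frac x s \<in> carrier L"
  using assms by (auto simp: localization_def loc_frac_def intro: quotientI)

lemma frac_cases:
  assumes "U \<in> carrier L"
  obtains x s where "x \<in> carrier R" "s \<in> S" "U = frac x s"
  using assms by (auto simp: localization_def loc_frac_def elim!: quotientE)

lemma mem_fracE:
  assumes "z \<in> frac x s"
  obtains x' s' where "z = (x', s')" "x' \<in> carrier R" "s' \<in> S" "frac x s = frac x' s'"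
proof -
  obtain x' s' where z: "z = (x', s')" by (cases z)
  have "((x, s), (x', s')) \<in> loc_rel R S"
    using assms by (simp add: loc_frac_def z)
  moreover from this have "frac x s = frac x' s'"
    unfolding loc_frac_def by (rule equiv_class_eq[OF equiv_loc_rel])
  moreover from calculation(1) have "x' \<in> carrier R" "s' \<in> S"
    by (auto simp: loc_rel_def)
  ultimately show ?thesis
    using that z by blast
qed

lemma mem_frac_self: "x \<in> carrier R \<Longrightarrow> s \<in> S \<Longrightarrow> (x, s) \<in> frac x s"
  using equiv_class_self[OF equiv_loc_rel, of "(x, s)"] by (simp add: loc_frac_def)

text \<open>The operations of \<open>localization\<close> are unions over all representatives of their arguments. Such a
  union collapses to a single term when the terms do not depend on the representatives.\<close>

lemma UN_frac2:
  assumes m: "x \<in> carrier R" "s \<in> S" "y \<in> carrier R" "t \<in> S"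
    and cong: "\<And>x' s' y' t'. \<lbrakk>x' \<in> carrier R; s' \<in> S; y' \<in> carrier R; t' \<in> S;
      frac x s = frac x' s'; frac y t = frac y' t'\<rbrakk> \<Longrightarrow> f x' s' y' t' = f x s y t"
  shows "(\<Union>(x, s)\<in>frac x s. \<Union>(y, t)\<in>frac y t. f x s y t) = f x s y t"
proof -
  have "(\<Union>z\<in>frac x s. \<Union>w\<in>frac y t. f (fst z) (snd z) (fst w) (snd w))
      = (\<Union>z\<in>frac x s. \<Union>w\<in>frac y t. f x s y t)"
    by (intro SUP_cong refl) (metis cong fst_conv mem_fracE snd_conv)
  also have "\<dots> = f x s y t"
    using mem_frac_self[OF m(1,2)] mem_frac_self[OF m(3,4)] by auto
  finally show ?thesis by (simp add: case_prod_unfold)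
qed

lemma mult_frac:
  assumes m: "x \<in> carrier R" "s \<in> S" "y \<in> carrier R" "t \<in> S"
  shows "frac x s \<otimes>\<^bsub>L\<^esub> frac y t = frac (x \<otimes> y) (s \<otimes> t)"
  unfolding localization_def monoid.simps
proof (rule UN_frac2[OF m])
  fix x' s' y' t'
  assume m': "x' \<in> carrier R" "s' \<in> S" "y' \<in> carrier R" "t' \<in> S"
    and "frac x s = frac x' s'" "frac y t = frac y' t'"
  then obtain u v where uv: "u \<in> S" "v \<in> S"
    and u: "u \<otimes> (s' \<otimes> x) = u \<otimes> (s \<otimes> x')" and v: "v \<otimes> (t' \<otimes> y) = v \<otimes> (t \<otimes> y')"
    using m by (auto simp: frac_eq_iff)
  note c = m(1,3) m(2,4)[THEN S_carr] m'(1,3) m'(2,4)[THEN S_carr] uv[THEN S_carr]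
  have "(u \<otimes> v) \<otimes> ((s' \<otimes> t') \<otimes> (x \<otimes> y)) = (u \<otimes> (s' \<otimes> x)) \<otimes> (v \<otimes> (t' \<otimes> y))"
    using c by (simp add: m_ac)
  also have "\<dots> = (u \<otimes> v) \<otimes> ((s \<otimes> t) \<otimes> (x' \<otimes> y'))"
    unfolding u v using c by (simp add: m_ac)
  finally show "frac (x' \<otimes> y') (s' \<otimes> t') = frac (x \<otimes> y) (s \<otimes> t)"
    using m m' uv S_mult by (subst eq_commute, subst frac_eq_iff) auto
qed

lemma add_frac:
  assumes m: "x \<in> carrier R" "s \<in> S" "y \<in> carrier R" "t \<in> S"
  shows "frac x s \<oplus>\<^bsub>L\<^esub> frac y t = frac ((t \<otimes> x) \<oplus> (s \<otimes> y)) (s \<otimes> t)"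
  unfolding localization_def ring.simps
proof (rule UN_frac2[OF m])
  fix x' s' y' t'
  assume m': "x' \<in> carrier R" "s' \<in> S" "y' \<in> carrier R" "t' \<in> S"
    and "frac x s = frac x' s'" "frac y t = frac y' t'"
  then obtain u v where uv: "u \<in> S" "v \<in> S"
    and u: "u \<otimes> (s' \<otimes> x) = u \<otimes> (s \<otimes> x')" and v: "v \<otimes> (t' \<otimes> y) = v \<otimes> (t \<otimes> y')"
    using m by (auto simp: frac_eq_iff)
  note c = m(1,3) m(2,4)[THEN S_carr] m'(1,3) m'(2,4)[THEN S_carr] uv[THEN S_carr]
  have "(u \<otimes> v) \<otimes> ((s' \<otimes> t') \<otimes> ((t \<otimes> x) \<oplus> (s \<otimes> y)))
      = (v \<otimes> t' \<otimes> t) \<otimes> (u \<otimes> (s' \<otimes> x)) \<oplus> (u \<otimes> s' \<otimes> s) \<otimes> (v \<otimes> (t' \<otimes> y))"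
    using c by (simp add: m_ac r_distr)
  also have "\<dots> = (u \<otimes> v) \<otimes> ((s \<otimes> t) \<otimes> ((t' \<otimes> x') \<oplus> (s' \<otimes> y')))"
    unfolding u v using c by (simp add: m_ac r_distr)
  finally show "frac ((t' \<otimes> x') \<oplus> (s' \<otimes> y')) (s' \<otimes> t') = frac ((t \<otimes> x) \<oplus> (s \<otimes> y)) (s \<otimes> t)"
    using m m' uv S_mult by (subst eq_commute, subst frac_eq_iff) auto
qed

lemma one_frac: "\<one>\<^bsub>L\<^esub> = frac \<one> \<one>"
  by (simp add: localization_def)

lemma zero_frac: "\<zero>\<^bsub>L\<^esub> = frac \<zero> \<one>"
  by (simp add: localization_def)

lemma cring_localization: "cring L"
proof (rule cringI)
  show "abelian_group L"
  proof (rule abelian_groupI)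
    fix U V W assume "U \<in> carrier L" "V \<in> carrier L" "W \<in> carrier L"
    then show "U \<oplus>\<^bsub>L\<^esub> V \<oplus>\<^bsub>L\<^esub> W = U \<oplus>\<^bsub>L\<^esub> (V \<oplus>\<^bsub>L\<^esub> W)"
      by (elim frac_cases) (simp add: add_frac S_mult m_ac r_distr a_ac)
  next
    fix U V assume "U \<in> carrier L" "V \<in> carrier L"
    then show "U \<oplus>\<^bsub>L\<^esub> V = V \<oplus>\<^bsub>L\<^esub> U"
      by (elim frac_cases) (simp add: add_frac m_comm a_comm)
  next
    fix U assume "U \<in> carrier L"
    then obtain x s where U: "x \<in> carrier R" "s \<in> S" "U = frac x s" by (rule frac_cases)
    have "frac (\<ominus> x) s \<oplus>\<^bsub>L\<^esub> U = frac \<zero> (s \<otimes> s)"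
      using U by (simp add: add_frac r_minus l_neg)
    also have "\<dots> = \<zero>\<^bsub>L\<^esub>"
      unfolding zero_frac using U S_one by (intro frac_eqI) (auto simp: S_mult)
    finally show "\<exists>V\<in>carrier L. V \<oplus>\<^bsub>L\<^esub> U = \<zero>\<^bsub>L\<^esub>"
      using U by auto
  qed (auto simp: zero_frac S_one S_mult add_frac elim!: frac_cases)
  show "Group.comm_monoid L"
    by (rule comm_monoidI)
      (auto simp: one_frac S_one S_mult mult_frac m_ac elim!: frac_cases)
  fix U V W assume "U \<in> carrier L" "V \<in> carrier L" "W \<in> carrier L"
  then obtain x s y t z r where m: "x \<in> carrier R" "s \<in> S" "U = frac x s"
      "y \<in> carrier R" "t \<in> S" "V = frac y t" "z \<in> carrier R" "r \<in> S" "W = frac z r"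
    by (elim frac_cases) blast
  then show "(U \<oplus>\<^bsub>L\<^esub> V) \<otimes>\<^bsub>L\<^esub> W = U \<otimes>\<^bsub>L\<^esub> W \<oplus>\<^bsub>L\<^esub> V \<otimes>\<^bsub>L\<^esub> W"
    by (simp add: add_frac mult_frac S_mult)
      (intro frac_eqI, auto simp: S_mult m_ac r_distr)
qed

lemma frac_zero_iff:
  assumes "x \<in> carrier R" "s \<in> S"
  shows "frac x s = \<zero>\<^bsub>L\<^esub> \<longleftrightarrow> (\<exists>u\<in>S. u \<otimes> x = \<zero>)"
  using assms by (simp add: zero_frac frac_eq_iff S_one)

lemma frac_add_same:
  assumes "x \<in> carrier R" "y \<in> carrier R" "s \<in> S"
  shows "frac x s \<oplus>\<^bsub>L\<^esub> frac y s = frac (x \<oplus> y) s"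
  using assms
  by (simp add: add_frac S_mult)
    (intro frac_eqI, auto simp: S_mult m_ac r_distr)

lemma frac_self: "s \<in> S \<Longrightarrow> frac s s = \<one>\<^bsub>L\<^esub>"
  unfolding one_frac by (rule frac_eqI) (auto simp: S_one)

lemma base_hom: "(\<lambda>x. frac x \<one>) \<in> ring_hom R L"
  by (rule ring_hom_memI) (auto simp: S_one mult_frac add_frac one_frac)

end

lemma (in cring) nonzerodivisor_cancel:
  assumes "y \<in> nonzerodivisors R" "a \<in> carrier R" "b \<in> carrier R" "y \<otimes> a = y \<otimes> b"
  shows "a = b"
proof -
  have y: "y \<in> carrier R" using assms(1) by (simp add: nonzerodivisors_def)
  have "y \<otimes> (a \<ominus> b) = y \<otimes> a \<ominus> y \<otimes> b"
    using y assms(2,3) by algebra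
  also have "\<dots> = \<zero>"
    using y assms(2-4) by (simp add: a_minus_def r_neg)
  finally have "a \<ominus> b = \<zero>"
    using assms(1-3) by (simp add: nonzerodivisors_def)
  then show ?thesis
    using assms(2,3) by (simp add: r_right_minus_eq)
qed

lemma (in cring) idealI_mult_closed:
  assumes sub: "I \<subseteq> carrier R" and ne: "I \<noteq> {}"
    and add: "\<And>a b. \<lbrakk>a \<in> I; b \<in> I\<rbrakk> \<Longrightarrow> a \<oplus> b \<in> I"
    and mult: "\<And>r a. \<lbrakk>r \<in> carrier R; a \<in> I\<rbrakk> \<Longrightarrow> r \<otimes> a \<in> I"
  shows "ideal I R"
proof (rule idealI)
  show "subgroup I (add_monoid R)"
  proof (rule add.subgroupI)
    show "\<ominus> a \<in> I" if "a \<in> I" for a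
    proof -
      have "a \<in> carrier R" using that sub by blast
      then show ?thesis using mult[OF _ that, of "\<ominus> \<one>"] by (simp add: l_minus)
    qed
  qed (use sub ne add in auto)
  fix a r assume a: "a \<in> I" and r: "r \<in> carrier R"
  show "r \<otimes> a \<in> I" using mult[OF r a] .
  then show "a \<otimes> r \<in> I" using m_comm[of a r] sub a r by (simp add: subset_iff)
qed (rule ring_axioms)

lemma (in cring) fractions_nonzerodivisors: "fractions R (nonzerodivisors R)"
proof unfold_locales
  fix s t assume s: "s \<in> nonzerodivisors R" and t: "t \<in> nonzerodivisors R"
  then have c: "s \<in> carrier R" "t \<in> carrier R" by (simp_all add: nonzerodivisors_def)
  have "x = \<zero>" if x: "x \<in> carrier R" "(s \<otimes> t) \<otimes> x = \<zero>" for x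
  proof -
    have "s \<otimes> (t \<otimes> x) = \<zero>" using x c by (simp add: m_assoc)
    then have "t \<otimes> x = \<zero>" using s c x by (simp add: nonzerodivisors_def)
    then show ?thesis using t x by (simp add: nonzerodivisors_def)
  qed
  then show "s \<otimes> t \<in> nonzerodivisors R" using c by (simp add: nonzerodivisors_def)
qed (auto simp: nonzerodivisors_def)

lemma (in cring) total_frac_cases:
  assumes "g \<in> carrier (total_frac R)"
  obtains x y where "x \<in> carrier R" "y \<in> nonzerodivisors R"
    "g = loc_frac R (nonzerodivisors R) x y"
  using fractions.frac_cases[OF fractions_nonzerodivisors] assms
  unfolding total_frac_def by metis

lemma fractions_prime_complement:
  assumes "primeideal P R"
  shows "fractions R (carrier R - P)"
proof -
  interpret primeideal P R by fact
  have "\<one>\<^bsub>R\<^esub> \<notin> P" using one_imp_carrier I_notcarr by blast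
  then show ?thesis
    by unfold_locales (use I_prime in auto)
qed

lemma (in domain) nonzerodivisors_domain: "nonzerodivisors R = carrier R - {\<zero>}"
  using one_not_zero one_closed unfolding nonzerodivisors_def
  by (auto simp: integral_iff simp del: one_not_zero)

context fractions
begin

lemma frac_split:
  assumes "x \<in> carrier R" "s \<in> S"
  shows "frac x s = frac x \<one> \<otimes>\<^bsub>L\<^esub> frac \<one> s"
  using assms by (simp add: mult_frac S_one)

lemma frac_clear:
  assumes "x \<in> carrier R" "s \<in> S"
  shows "frac s \<one> \<otimes>\<^bsub>L\<^esub> frac x s = frac x \<one>"
  using assms by (simp add: mult_frac S_one) (intro frac_eqI, auto simp: m_ac S_one)

lemma frac_eq_domain:
  assumes "domain R" "\<zero> \<notin> S" "x \<in> carrier R" "s \<in> S" "y \<in> carrier R" "t \<in> S"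
  shows "frac x s = frac y t \<longleftrightarrow> t \<otimes> x = s \<otimes> y"
proof -
  interpret domain R by fact
  have "u \<otimes> (t \<otimes> x) = u \<otimes> (s \<otimes> y) \<longleftrightarrow> t \<otimes> x = s \<otimes> y" if "u \<in> S" for u
    using that assms m_lcancel[of u "t \<otimes> x" "s \<otimes> y"] by auto
  then show ?thesis
    using assms S_one by (auto simp: frac_eq_iff)
qed

lemma domain_localization:
  assumes "domain R" "\<zero> \<notin> S"
  shows "domain L"
proof -
  interpret domain R by fact
  interpret L: cring L by (rule cring_localization)
  show ?thesis
  proof (unfold_locales)
    show "\<one>\<^bsub>L\<^esub> \<noteq> \<zero>\<^bsub>L\<^esub>"
      using assms S_one by (auto simp: one_frac zero_frac frac_eq_domain)
    fix U V assume "U \<otimes>\<^bsub>L\<^esub> V = \<zero>\<^bsub>L\<^esub>" "U \<in> carrier L" "V \<in> carrier L"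
    then obtain x s y t where *: "x \<in> carrier R" "s \<in> S" "U = frac x s"
        "y \<in> carrier R" "t \<in> S" "V = frac y t" "U \<otimes>\<^bsub>L\<^esub> V = \<zero>\<^bsub>L\<^esub>"
      by (elim frac_cases) blast
    then obtain u where "u \<in> S" "u \<otimes> (x \<otimes> y) = \<zero>"
      by (auto simp: mult_frac S_mult frac_zero_iff)
    then have "x = \<zero> \<or> y = \<zero>"
      using * assms by (auto simp: integral_iff)
    then show "U = \<zero>\<^bsub>L\<^esub> \<or> V = \<zero>\<^bsub>L\<^esub>"
      using * S_one by (auto simp: frac_zero_iff)
  qed
qed

subsection \<open>Ideals and prime ideals\<close>

definition ext_ideal :: "'a set \<Rightarrow> ('a \<times> 'a) set set" where
  "ext_ideal I = {frac x s | x s. x \<in> I \<and> s \<in> S}"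

lemma ideal_ext_ideal:
  assumes "ideal I R"
  shows "ideal (ext_ideal I) L"
proof -
  interpret I: ideal I R by fact
  interpret L: cring L by (rule cring_localization)
  show ?thesis
  proof (rule L.idealI_mult_closed)
    show "ext_ideal I \<subseteq> carrier L"
      by (auto simp: ext_ideal_def)
    show "ext_ideal I \<noteq> {}"
      using S_one I.zero_closed unfolding ext_ideal_def by blast
  next
    fix U V assume "U \<in> ext_ideal I" "V \<in> ext_ideal I"
    then obtain x s y t where *: "x \<in> I" "s \<in> S" "U = frac x s" "y \<in> I" "t \<in> S" "V = frac y t"
      unfolding ext_ideal_def by blast
    then have "U \<oplus>\<^bsub>L\<^esub> V = frac ((t \<otimes> x) \<oplus> (s \<otimes> y)) (s \<otimes> t)"
      by (simp add: add_frac)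
    moreover have "(t \<otimes> x) \<oplus> (s \<otimes> y) \<in> I" "s \<otimes> t \<in> S"
      using * by (auto simp: S_mult I.I_l_closed)
    ultimately show "U \<oplus>\<^bsub>L\<^esub> V \<in> ext_ideal I"
      unfolding ext_ideal_def by blast
  next
    fix V U assume "V \<in> carrier L" "U \<in> ext_ideal I"
    then obtain x s where x: "x \<in> I" "s \<in> S" "U = frac x s"
      unfolding ext_ideal_def by blast
    obtain y t where y: "y \<in> carrier R" "t \<in> S" "V = frac y t"
      using \<open>V \<in> carrier L\<close> by (rule frac_cases)
    have "V \<otimes>\<^bsub>L\<^esub> U = frac (y \<otimes> x) (t \<otimes> s)"
      using x y by (simp add: mult_frac)
    moreover have "y \<otimes> x \<in> I" "t \<otimes> s \<in> S"
      using x y by (auto simp: S_mult I.I_l_closed)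
    ultimately show "V \<otimes>\<^bsub>L\<^esub> U \<in> ext_ideal I"
      unfolding ext_ideal_def by blast
  qed
qed

text \<open>Extended ideals consist of fractions with numerator in the ideal. This makes the elements of
  \<open>local_max_ideal\<close> explicit.\<close>

lemma genideal_base_image:
  assumes "ideal I R"
  shows "genideal L ((\<lambda>x. frac x \<one>) ` I) = ext_ideal I"
proof -
  interpret I: ideal I R by fact
  interpret L: cring L by (rule cring_localization)
  interpret G: ideal "genideal L ((\<lambda>x. frac x \<one>) ` I)" L
    by (rule L.genideal_ideal) (auto simp: S_one)
  show ?thesis
  proof
    show "genideal L ((\<lambda>x. frac x \<one>) ` I) \<subseteq> ext_ideal I"
      by (rule L.genideal_minimal[OF ideal_ext_ideal[OF assms]])
        (use S_one in \<open>auto simp: ext_ideal_def\<close>)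
    have "frac x s \<in> genideal L ((\<lambda>x. frac x \<one>) ` I)" if "x \<in> I" "s \<in> S" for x s
    proof -
      have "(\<lambda>x. frac x \<one>) ` I \<subseteq> carrier L" using S_one by auto
      then have "frac x \<one> \<in> genideal L ((\<lambda>x. frac x \<one>) ` I)"
        using L.genideal_self[of "(\<lambda>x. frac x \<one>) ` I"] that S_one by fast
      then show ?thesis
        using that S_one by (subst frac_split) (auto intro: G.I_r_closed)
    qed
    then show "ext_ideal I \<subseteq> genideal L ((\<lambda>x. frac x \<one>) ` I)"
      by (auto simp: ext_ideal_def)
  qed
qed

text \<open>The numerator of a fraction is determined only up to elements of \<open>S\<close>, which a prime disjoint from
  \<open>S\<close> allows to cancel.\<close>

lemma mem_ext_prime:
  assumes "primeideal I R" "I \<inter> S = {}" "x \<in> carrier R" "s \<in> S"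
  shows "frac x s \<in> ext_ideal I \<longleftrightarrow> x \<in> I"
proof
  interpret I: primeideal I R by fact
  assume "frac x s \<in> ext_ideal I"
  then obtain y t where y: "y \<in> I" "t \<in> S" "frac x s = frac y t"
    by (auto simp: ext_ideal_def)
  then obtain u where u: "u \<in> S" "u \<otimes> (t \<otimes> x) = u \<otimes> (s \<otimes> y)"
    using assms by (auto simp: frac_eq_iff)
  then have "u \<otimes> (t \<otimes> x) \<in> I"
    using y assms by (simp add: I.I_l_closed)
  moreover have "u \<notin> I" "t \<notin> I" using assms(2) u y by auto
  ultimately show "x \<in> I"
    using I.I_prime[of u "t \<otimes> x"] I.I_prime[of t x] u y assms by auto
qed (use assms in \<open>auto simp: ext_ideal_def\<close>)

lemma primeideal_ext:
  assumes "primeideal I R" "I \<inter> S = {}"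
  shows "primeideal (ext_ideal I) L"
proof (rule primeidealI)
  interpret I: primeideal I R by fact
  show "ideal (ext_ideal I) L" by (rule ideal_ext_ideal) (rule I.is_ideal)
  show "cring L" by (rule cring_localization)
  show "carrier L \<noteq> ext_ideal I"
    using mem_ext_prime[OF assms, of \<one> \<one>] assms S_one by auto
  fix U V assume UV: "U \<in> carrier L" "V \<in> carrier L" "U \<otimes>\<^bsub>L\<^esub> V \<in> ext_ideal I"
  obtain x s where x: "x \<in> carrier R" "s \<in> S" "U = frac x s"
    using UV(1) by (rule frac_cases)
  obtain y t where y: "y \<in> carrier R" "t \<in> S" "V = frac y t"
    using UV(2) by (rule frac_cases)
  have "x \<otimes> y \<in> I"
    using UV(3) x y mem_ext_prime[OF assms, of "x \<otimes> y" "s \<otimes> t"] by (simp add: mult_frac S_mult)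
  then show "U \<in> ext_ideal I \<or> V \<in> ext_ideal I"
    using x y I.I_prime[of x y] mem_ext_prime[OF assms] by simp
qed

definition contraction :: "('a \<times> 'a) set set \<Rightarrow> 'a set" where
  "contraction Q = {x \<in> carrier R. frac x \<one> \<in> Q}"

lemma mem_ideal_iff:
  assumes "ideal Q L" "x \<in> carrier R" "s \<in> S"
  shows "frac x s \<in> Q \<longleftrightarrow> x \<in> contraction Q"
proof -
  interpret Q: ideal Q L by fact
  show ?thesis
    using assms Q.I_l_closed[of "frac x s" "frac s \<one>"] Q.I_r_closed[of "frac x \<one>" "frac \<one> s"]
    by (auto simp: contraction_def frac_clear frac_split[symmetric] S_one)
qed

lemma contraction_disjoint:
  assumes "primeideal Q L"
  shows "contraction Q \<inter> S = {}"
proof -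
  interpret Q: primeideal Q L by fact
  have "s \<notin> contraction Q" if "s \<in> S" for s
    using mem_ideal_iff[OF Q.is_ideal, of s s] that frac_self[OF that] Q.one_imp_carrier Q.I_notcarr
    by auto
  then show ?thesis by auto
qed

lemma primeideal_contraction:
  assumes "primeideal Q L"
  shows "primeideal (contraction Q) R"
proof (rule primeidealI)
  interpret Q: primeideal Q L by fact
  have jhom: "ring_hom_ring R L (\<lambda>x. frac x \<one>)"
    by (rule ring_hom_ringI2[OF ring_axioms Q.ring_axioms base_hom])
  show "ideal (contraction Q) R"
    unfolding contraction_def by (rule ring_hom_ring.ideal_vimage[OF jhom Q.is_ideal])
  show "cring R" ..
  show "carrier R \<noteq> contraction Q"
    using contraction_disjoint[OF assms] S_one by auto
  fix a b assume "a \<in> carrier R" "b \<in> carrier R" "a \<otimes> b \<in> contraction Q"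
  then show "a \<in> contraction Q \<or> b \<in> contraction Q"
    using Q.I_prime[of "frac a \<one>" "frac b \<one>"] S_one
    by (auto simp: contraction_def mult_frac)
qed

lemma ext_contraction:
  assumes "ideal Q L"
  shows "ext_ideal (contraction Q) = Q"
proof -
  interpret Q: ideal Q L by fact
  show ?thesis
  proof
    show "ext_ideal (contraction Q) \<subseteq> Q"
      using mem_ideal_iff[OF assms] by (auto simp: ext_ideal_def contraction_def)
    show "Q \<subseteq> ext_ideal (contraction Q)"
    proof
      fix U assume "U \<in> Q"
      moreover from this obtain x s where "x \<in> carrier R" "s \<in> S" "U = frac x s"
        using Q.Icarr frac_cases by metis
      ultimately show "U \<in> ext_ideal (contraction Q)"
        using mem_ideal_iff[OF assms] unfolding ext_ideal_def by blast
    qed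
  qed
qed

lemma contraction_ext:
  assumes "primeideal I R" "I \<inter> S = {}"
  shows "contraction (ext_ideal I) = I"
proof -
  interpret I: primeideal I R by fact
  show ?thesis
    using mem_ext_prime[OF assms _ S_one] by (auto simp: contraction_def)
qed

subsection \<open>The induced map of total rings of fractions\<close>

lemma nonzerodivisor_base:
  assumes "y \<in> nonzerodivisors R"
  shows "frac y \<one> \<in> nonzerodivisors L"
proof -
  have y: "y \<in> carrier R" using assms by (simp add: nonzerodivisors_def)
  have "x = \<zero>\<^bsub>L\<^esub>" if x: "x \<in> carrier L" "frac y \<one> \<otimes>\<^bsub>L\<^esub> x = \<zero>\<^bsub>L\<^esub>" for x
  proof -
    obtain a s where a: "a \<in> carrier R" "s \<in> S" "x = frac a s"
      using x(1) by (rule frac_cases)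
    then obtain u where u: "u \<in> S" "u \<otimes> (y \<otimes> a) = \<zero>"
      using x(2) y S_one by (auto simp: mult_frac frac_zero_iff)
    then have "y \<otimes> (u \<otimes> a) = \<zero>" using y a by (simp add: m_ac)
    then have "u \<otimes> a = \<zero>" using assms a u by (simp add: nonzerodivisors_def)
    then show ?thesis using a u by (auto simp: frac_zero_iff)
  qed
  then show ?thesis using y S_one by (auto simp: nonzerodivisors_def)
qed

text \<open>The map \<open>K(R) \<rightarrow> K(S\<^sup>-\<^sup>1 R)\<close>, \<open>x/y \<mapsto> (x/1)/(y/1)\<close>. As in \<open>localization\<close>, the union over all
  representatives stands for their common value.\<close>

definition total_frac_map :: "('a \<times> 'a) set \<Rightarrow> (('a \<times> 'a) set \<times> ('a \<times> 'a) set) set" where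
  "total_frac_map g = (\<Union>(x, y)\<in>g. loc_frac L (nonzerodivisors L) (frac x \<one>) (frac y \<one>))"

lemma total_frac_map_frac:
  assumes x: "x \<in> carrier R" and y: "y \<in> nonzerodivisors R"
  shows "total_frac_map (loc_frac R (nonzerodivisors R) x y)
    = loc_frac L (nonzerodivisors L) (frac x \<one>) (frac y \<one>)"
proof -
  interpret K: fractions R "nonzerodivisors R" by (rule fractions_nonzerodivisors)
  interpret L: cring L by (rule cring_localization)
  interpret M: fractions L "nonzerodivisors L" by (rule L.fractions_nonzerodivisors)
  have "M.frac (frac (fst z) \<one>) (frac (snd z) \<one>) = M.frac (frac x \<one>) (frac y \<one>)"
    if "z \<in> K.frac x y" for z
    using that
  proof (rule K.mem_fracE)
    fix x' y' assume *: "z = (x', y')" "x' \<in> carrier R" "y' \<in> nonzerodivisors R"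
      "K.frac x y = K.frac x' y'"
    then obtain u where u: "u \<in> nonzerodivisors R" "u \<otimes> (y' \<otimes> x) = u \<otimes> (y \<otimes> x')"
      using x y by (auto simp: K.frac_eq_iff)
    then have "y' \<otimes> x = y \<otimes> x'"
      using nonzerodivisor_cancel[OF u(1)] x y * by auto
    then show ?thesis
      using * x y S_one nonzerodivisor_base
      by (intro M.frac_eqI) (auto simp: mult_frac)
  qed
  then have "total_frac_map (K.frac x y) = (\<Union>z\<in>K.frac x y. M.frac (frac x \<one>) (frac y \<one>))"
    by (simp add: total_frac_map_def case_prod_unfold)
  then show ?thesis using K.mem_frac_self[OF x y] by auto
qed

lemma total_frac_map_hom: "total_frac_map \<in> ring_hom (total_frac R) (total_frac L)"
proof -
  interpret K: fractions R "nonzerodivisors R" by (rule fractions_nonzerodivisors)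
  interpret L: cring L by (rule cring_localization)
  interpret M: fractions L "nonzerodivisors L" by (rule L.fractions_nonzerodivisors)
  note [simp] = total_frac_map_frac nonzerodivisor_base S_one
  show ?thesis
    unfolding total_frac_def
  proof (rule ring_hom_memI)
    fix U V assume "U \<in> carrier K.L" "V \<in> carrier K.L"
    then obtain x s y t where U: "x \<in> carrier R" "s \<in> nonzerodivisors R" "U = K.frac x s"
      and V: "y \<in> carrier R" "t \<in> nonzerodivisors R" "V = K.frac y t"
      by (metis K.frac_cases)
    note * = U V
    have st: "M.frac (frac (x \<otimes> y) \<one>) (frac (s \<otimes> t) \<one>) =
      M.frac (frac x \<one> \<otimes>\<^bsub>L\<^esub> frac y \<one>) (frac s \<one> \<otimes>\<^bsub>L\<^esub> frac t \<one>)"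
      using * by (simp add: mult_frac)
    show "total_frac_map U \<in> carrier M.L" using * by auto
    show "total_frac_map (U \<otimes>\<^bsub>K.L\<^esub> V) = total_frac_map U \<otimes>\<^bsub>M.L\<^esub> total_frac_map V"
      using * by (simp add: K.mult_frac M.mult_frac K.S_mult st)
    show "total_frac_map (U \<oplus>\<^bsub>K.L\<^esub> V) = total_frac_map U \<oplus>\<^bsub>M.L\<^esub> total_frac_map V"
      using * by (simp add: K.add_frac M.add_frac K.S_mult mult_frac frac_add_same)
  next
    show "total_frac_map \<one>\<^bsub>K.L\<^esub> = \<one>\<^bsub>M.L\<^esub>"
      by (simp add: K.one_frac M.one_frac K.S_one one_frac)
  qed
qed

lemma total_frac_map_to_frac:
  assumes "x \<in> carrier R"
  shows "total_frac_map (to_frac R x) = to_frac L (frac x \<one>)"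
proof -
  interpret K: fractions R "nonzerodivisors R" by (rule fractions_nonzerodivisors)
  show ?thesis
    using assms by (simp add: to_frac_def total_frac_map_frac K.S_one one_frac)
qed

text \<open>Nonzerodivisors of \<open>S\<^sup>-\<^sup>1 R\<close> cancel, so the only identifications made by \<open>total_frac_map\<close> are those
  made by \<open>R \<rightarrow> S\<^sup>-\<^sup>1 R\<close>.\<close>

lemma total_frac_map_eqD:
  assumes g: "g \<in> carrier (total_frac R)" "g' \<in> carrier (total_frac R)"
    and eq: "total_frac_map g = total_frac_map g'"
  obtains s where "s \<in> S" "to_frac R s \<otimes>\<^bsub>total_frac R\<^esub> g = to_frac R s \<otimes>\<^bsub>total_frac R\<^esub> g'"
proof -
  interpret K: fractions R "nonzerodivisors R" by (rule fractions_nonzerodivisors)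
  interpret L: cring L by (rule cring_localization)
  interpret M: fractions L "nonzerodivisors L" by (rule L.fractions_nonzerodivisors)
  obtain x y where x: "x \<in> carrier R" "y \<in> nonzerodivisors R" "g = K.frac x y"
    using g(1) by (rule total_frac_cases)
  obtain x' y' where "x' \<in> carrier R" "y' \<in> nonzerodivisors R" "g' = K.frac x' y'"
    using g(2) by (rule total_frac_cases)
  note * = x this
  then obtain w where w: "w \<in> nonzerodivisors L"
      "w \<otimes>\<^bsub>L\<^esub> (frac y' \<one> \<otimes>\<^bsub>L\<^esub> frac x \<one>) = w \<otimes>\<^bsub>L\<^esub> (frac y \<one> \<otimes>\<^bsub>L\<^esub> frac x' \<one>)"
    using eq by (auto simp: total_frac_map_frac M.frac_eq_iff S_one nonzerodivisor_base)
  then have "frac (y' \<otimes> x) \<one> = frac (y \<otimes> x') \<one>"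
    using L.nonzerodivisor_cancel[OF w(1)] * S_one by (simp add: mult_frac)
  then obtain s where s: "s \<in> S" "s \<otimes> (y' \<otimes> x) = s \<otimes> (y \<otimes> x')"
    using * by (auto simp: frac_eq_iff S_one)
  have "K.frac (s \<otimes> x) y = K.frac (s \<otimes> x') y'"
    using * s by (intro K.frac_eqI) (auto simp: m_ac)
  then show ?thesis
    using that[of s] s * by (simp add: to_frac_def total_frac_def K.mult_frac K.S_one)
qed

end

section \<open>Frobenius pushforward and finite generation\<close>

lemma (in cring) binomial_theorem:
  assumes a: "a \<in> carrier R" and b: "b \<in> carrier R"
  shows "(a \<oplus> b) [^] (n::nat) = (\<Oplus>k\<in>{..n}. [(n choose k)] \<cdot> (a [^] k \<otimes> b [^] (n - k)))"
proof (induction n)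
  case 0
  show ?case using a b by simp
next
  case (Suc n)
  define f where "f m k = [(m choose k)] \<cdot> (a [^] k \<otimes> b [^] (n - k))" for m k :: nat
  define g where "g m k = [(m choose k)] \<cdot> (a [^] k \<otimes> b [^] (Suc n - k))" for m k :: nat
  have f: "f m k \<in> carrier R" and g: "g m k \<in> carrier R" for m k
    using a b by (auto simp: f_def g_def)
  have fa: "f n k \<otimes> a = [(n choose k)] \<cdot> (a [^] Suc k \<otimes> b [^] (n - k))" for k
    using a b by (simp add: f_def add_pow_ldistr add_pow_rdistr m_ac)
  have fb: "f n k \<otimes> b = g n k" if "k \<le> n" for k
    using a b that by (simp add: f_def g_def add_pow_ldistr add_pow_rdistr m_ac Suc_diff_le)
  have gS: "g (Suc n) (Suc k) = f n k \<otimes> a \<oplus> g n (Suc k)" for k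
    using a b by (simp add: fa g_def add.nat_pow_mult [symmetric] del: nat_pow_Suc)
  have "(a \<oplus> b) [^] Suc n = (\<Oplus>k\<in>{..n}. f n k) \<otimes> (a \<oplus> b)"
    using Suc.IH by (simp add: f_def)
  also have "\<dots> = (\<Oplus>k\<in>{..n}. f n k \<otimes> a) \<oplus> (\<Oplus>k\<in>{..n}. f n k \<otimes> b)"
    using a b f by (simp add: r_distr finsum_ldistr Pi_def)
  also have "(\<Oplus>k\<in>{..n}. f n k \<otimes> b) = (\<Oplus>k\<in>{..n}. g n k)"
    using g by (intro finsum_cong') (auto simp: fb)
  also have "\<dots> = (\<Oplus>k\<in>{..Suc n}. g n k)"
    using g a b by (subst finsum_Suc) (auto simp: Pi_def g_def binomial_eq_0)
  also have "\<dots> = (\<Oplus>k\<in>{..n}. g n (Suc k)) \<oplus> g n 0"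
    using g by (subst finsum_Suc2) auto
  also have "(\<Oplus>k\<in>{..n}. f n k \<otimes> a) \<oplus> ((\<Oplus>k\<in>{..n}. g n (Suc k)) \<oplus> g n 0)
      = (\<Oplus>k\<in>{..n}. g (Suc n) (Suc k)) \<oplus> g (Suc n) 0"
    using a b f g by (simp add: gS finsum_addf Pi_def a_assoc) (simp add: g_def)
  also have "\<dots> = (\<Oplus>k\<in>{..Suc n}. g (Suc n) k)"
    using g by (subst finsum_Suc2) auto
  finally show ?case by (simp add: g_def)
qed

text \<open>All binomial coefficients except the outer two are divisible by \<open>p\<close>.\<close>

lemma (in cring) frobenius_add:
  assumes p: "Factorial_Ring.prime (p::nat)" and char: "[p] \<cdot> \<one> = \<zero>"
    and a: "a \<in> carrier R" and b: "b \<in> carrier R"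
  shows "(a \<oplus> b) [^] p = a [^] p \<oplus> b [^] p"
proof -
  obtain m where m: "p = Suc (Suc m)"
    using prime_ge_2_nat[OF p] by (metis Suc_le_D numeral_2_eq_2 Suc_le_mono)
  define f where "f k = [(p choose k)] \<cdot> (a [^] k \<otimes> b [^] (p - k))" for k
  have f: "f k \<in> carrier R" for k using a b by (auto simp: f_def)
  have mid: "f (Suc k) = \<zero>" if "k \<le> m" for k
  proof -
    have "p dvd (p choose Suc k)"
      using that m by (intro dvd_choose_prime[OF _ _ _ p]) auto
    then obtain c where c: "p choose Suc k = p * c" by (auto elim: dvdE)
    have "f (Suc k) = [c] \<cdot> ([p] \<cdot> (\<one> \<otimes> (a [^] Suc k \<otimes> b [^] (p - Suc k))))"
      using a b by (simp add: f_def c add.nat_pow_pow mult.commute del: nat_pow_Suc)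
    also have "\<dots> = \<zero>"
      using a b char by (simp add: add_pow_ldistr[symmetric] del: nat_pow_Suc l_one)
    finally show ?thesis .
  qed
  have "(a \<oplus> b) [^] p = (\<Oplus>k\<in>{..Suc (Suc m)}. f k)"
    using binomial_theorem[OF a b, of p] by (simp add: f_def m)
  also have "\<dots> = (\<Oplus>k\<in>{..Suc m}. f (Suc k)) \<oplus> f 0"
    using f by (subst finsum_Suc2) auto
  also have "(\<Oplus>k\<in>{..Suc m}. f (Suc k)) = f p \<oplus> (\<Oplus>k\<in>{..m}. f (Suc k))"
    using f by (subst finsum_Suc) (auto simp: m)
  also have "(\<Oplus>k\<in>{..m}. f (Suc k)) = (\<Oplus>k\<in>{..m}. \<zero>)"
    by (intro finsum_cong') (auto simp: mid)
  finally show ?thesis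
    using a b f by (simp add: f_def)
qed

lemma (in cring) frobenius_add_iter:
  assumes p: "Factorial_Ring.prime (p::nat)" and char: "[p] \<cdot> \<one> = \<zero>"
    and a: "a \<in> carrier R" and b: "b \<in> carrier R"
  shows "(a \<oplus> b) [^] (p ^ e) = a [^] (p ^ e) \<oplus> b [^] (p ^ e)"
proof (induction e)
  case (Suc e)
  have "(a \<oplus> b) [^] (p ^ Suc e) = ((a \<oplus> b) [^] (p ^ e)) [^] p"
    using a b by (simp add: nat_pow_pow mult.commute)
  also have "\<dots> = a [^] (p ^ Suc e) \<oplus> b [^] (p ^ Suc e)"
    using a b by (simp add: Suc.IH frobenius_add[OF p char] nat_pow_pow mult.commute)
  finally show ?case .
qed (use a b in simp)

lemma frob_push_simps [simp]:
  "carrier (frob_push A p e M) = carrier M"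
  "ring.zero (frob_push A p e M) = ring.zero M"
  "ring.add (frob_push A p e M) = ring.add M"
  "r \<odot>\<^bsub>frob_push A p e M\<^esub> x = (r [^]\<^bsub>A\<^esub> (p ^ e)) \<odot>\<^bsub>M\<^esub> x"
  by (simp_all add: frob_push_def)

lemma ring_as_module_simps [simp]:
  "carrier (ring_as_module A) = carrier A"
  "ring.zero (ring_as_module A) = ring.zero A"
  "ring.add (ring_as_module A) = ring.add A"
  "r \<odot>\<^bsub>ring_as_module A\<^esub> x = r \<otimes>\<^bsub>A\<^esub> x"
  by (simp_all add: ring_as_module_def)

text \<open>The distributive law \<open>(r + s) x = r x + s x\<close> for the new action is the additivity of the iterated
  Frobenius.\<close>

lemma module_frob_push:
  assumes M: "module A M" and p: "Factorial_Ring.prime (p::nat)" and char: "[p] \<cdot>\<^bsub>A\<^esub> \<one>\<^bsub>A\<^esub> = \<zero>\<^bsub>A\<^esub>"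
  shows "module A (frob_push A p e M)"
proof -
  interpret module A M by fact
  show ?thesis
  proof (rule moduleI)
    show "cring A" by (rule R.is_cring)
    show "abelian_group (frob_push A p e M)"
      by (rule abelian_groupI) (auto simp: M.a_ac intro: M.a_inv_closed M.l_neg)
  qed (auto simp: R.frobenius_add_iter[OF p char] smult_l_distr smult_r_distr R.nat_pow_distrib
      smult_assoc1)
qed

lemma (in cring) module_ring_as_module: "module R (ring_as_module R)"
proof (rule moduleI)
  show "cring R" ..
  show "abelian_group (ring_as_module R)"
    by (rule abelian_groupI) (auto simp: a_ac intro: a_inv_closed l_neg)
qed (auto simp: l_distr r_distr m_assoc)

lemma module_homD:
  assumes "\<phi> \<in> module_hom A M N"
  shows "n \<in> carrier M \<Longrightarrow> \<phi> n \<in> carrier N"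
    and "\<lbrakk>n \<in> carrier M; m \<in> carrier M\<rbrakk> \<Longrightarrow> \<phi> (n \<oplus>\<^bsub>M\<^esub> m) = \<phi> n \<oplus>\<^bsub>N\<^esub> \<phi> m"
    and "\<lbrakk>r \<in> carrier A; n \<in> carrier M\<rbrakk> \<Longrightarrow> \<phi> (r \<odot>\<^bsub>M\<^esub> n) = r \<odot>\<^bsub>N\<^esub> \<phi> n"
  using assms by (auto simp: module_hom_def)

text \<open>Generation in the form of an induction principle: a subset that contains \<open>B\<close> and is closed under
  the module operations is everything. In this form no linear combinations have to be manipulated.\<close>

definition generates ::
  "('a, 'b) ring_scheme \<Rightarrow> ('a, 'c, 'm) module_scheme \<Rightarrow> 'c set \<Rightarrow> bool" where
  "generates A M B \<longleftrightarrow> B \<subseteq> carrier M \<and>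
     (\<forall>T. B \<subseteq> T \<and> \<zero>\<^bsub>M\<^esub> \<in> T \<and> (\<forall>x\<in>T. \<forall>y\<in>T. x \<oplus>\<^bsub>M\<^esub> y \<in> T) \<and>
        (\<forall>r\<in>carrier A. \<forall>x\<in>T. r \<odot>\<^bsub>M\<^esub> x \<in> T) \<longrightarrow> carrier M \<subseteq> T)"

definition finitely_generated :: "('a, 'b) ring_scheme \<Rightarrow> ('a, 'c, 'm) module_scheme \<Rightarrow> bool" where
  "finitely_generated A M \<longleftrightarrow> (\<exists>B. finite B \<and> generates A M B)"

lemma generatesI:
  assumes "B \<subseteq> carrier M"
    and "\<And>T. \<lbrakk>B \<subseteq> T; \<zero>\<^bsub>M\<^esub> \<in> T; \<And>x y. \<lbrakk>x \<in> T; y \<in> T\<rbrakk> \<Longrightarrow> x \<oplus>\<^bsub>M\<^esub> y \<in> T;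
      \<And>r x. \<lbrakk>r \<in> carrier A; x \<in> T\<rbrakk> \<Longrightarrow> r \<odot>\<^bsub>M\<^esub> x \<in> T\<rbrakk> \<Longrightarrow> carrier M \<subseteq> T"
  shows "generates A M B"
  unfolding generates_def
proof (intro conjI allI impI)
  fix T
  assume "B \<subseteq> T \<and> \<zero>\<^bsub>M\<^esub> \<in> T \<and> (\<forall>x\<in>T. \<forall>y\<in>T. x \<oplus>\<^bsub>M\<^esub> y \<in> T) \<and>
    (\<forall>r\<in>carrier A. \<forall>x\<in>T. r \<odot>\<^bsub>M\<^esub> x \<in> T)"
  then show "carrier M \<subseteq> T" by (intro assms(2)) simp_all
qed (rule assms(1))

lemma generatesD:
  assumes "generates A M B" "B \<subseteq> T" "\<zero>\<^bsub>M\<^esub> \<in> T"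
    "\<And>x y. x \<in> T \<Longrightarrow> y \<in> T \<Longrightarrow> x \<oplus>\<^bsub>M\<^esub> y \<in> T"
    "\<And>r x. r \<in> carrier A \<Longrightarrow> x \<in> T \<Longrightarrow> r \<odot>\<^bsub>M\<^esub> x \<in> T"
  shows "carrier M \<subseteq> T"
  using spec[OF conjunct2[OF assms(1)[unfolded generates_def]], of T] assms(2-5) by simp

lemma finite_module_imp_finitely_generated:
  assumes M: "module A M" and "finite_module A M"
  shows "finitely_generated A M"
proof -
  interpret module A M by fact
  obtain B where B: "finite B" "B \<subseteq> carrier M"
    and rep: "\<And>x. x \<in> carrier M \<Longrightarrow> \<exists>r\<in>B \<rightarrow> carrier A. x = (\<Oplus>\<^bsub>M\<^esub>b\<in>B. r b \<odot>\<^bsub>M\<^esub> b)"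
    using assms(2) by (auto simp: finite_module_def)
  have "carrier M \<subseteq> T"
    if X: "B \<subseteq> T" "\<zero>\<^bsub>M\<^esub> \<in> T" "\<And>x y. x \<in> T \<Longrightarrow> y \<in> T \<Longrightarrow> x \<oplus>\<^bsub>M\<^esub> y \<in> T"
      "\<And>r x. r \<in> carrier A \<Longrightarrow> x \<in> T \<Longrightarrow> r \<odot>\<^bsub>M\<^esub> x \<in> T" for T
  proof
    fix x assume "x \<in> carrier M"
    then obtain r where r: "r \<in> B \<rightarrow> carrier A" "x = (\<Oplus>\<^bsub>M\<^esub>b\<in>B. r b \<odot>\<^bsub>M\<^esub> b)"
      using rep by blast
    have "(\<Oplus>\<^bsub>M\<^esub>b\<in>F. r b \<odot>\<^bsub>M\<^esub> b) \<in> T" if "F \<subseteq> B" for F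
      using finite_subset[OF that B(1)] that
    proof (induction F)
      case (insert b F)
      have "r b \<odot>\<^bsub>M\<^esub> b \<in> T"
        using X(4)[of "r b" b] X(1) r insert.prems by auto
      moreover have "(\<Oplus>\<^bsub>M\<^esub>b\<in>F. r b \<odot>\<^bsub>M\<^esub> b) \<in> T"
        using insert by auto
      ultimately show ?case
        using insert r B X(3) by (subst M.finsum_insert) (auto simp: Pi_def subset_iff)
    qed (use X in simp)
    then show "x \<in> T" using r by simp
  qed
  then have "generates A M B" by (rule generatesI[OF B(2)])
  then show ?thesis using B(1) by (auto simp: finitely_generated_def)
qed

text \<open>Induction on \<open>e\<close>: if \<open>C\<close> generates \<open>F\<^sub>* A\<close> and \<open>B\<close> generates \<open>F\<^sup>e\<^sub>* M\<close>, then the elements \<open>c\<close> times \<open>b\<close>,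
  the product being taken in \<open>F\<^sup>e\<^sub>* M\<close>, generate \<open>F\<^bsup>e+1\<^esup>\<^sub>* M\<close>. For a fixed \<open>b\<close> the coefficients \<open>r\<close> with \<open>r b\<close> in
  a given submodule form a submodule of \<open>F\<^sub>* A\<close>, which contains \<open>C\<close>.\<close>

lemma finitely_generated_frob_push:
  assumes M: "module A M" and p: "Factorial_Ring.prime (p::nat)" and char: "[p] \<cdot>\<^bsub>A\<^esub> \<one>\<^bsub>A\<^esub> = \<zero>\<^bsub>A\<^esub>"
    and F: "F_finite A p" and fg: "finitely_generated A M"
  shows "finitely_generated A (frob_push A p e M)"
proof (induction e)
  interpret module A M by fact
  case 0
  show ?case using fg by (simp add: finitely_generated_def generates_def)
next
  case (Suc e)
  interpret M: module A M by fact
  interpret N: module A "frob_push A p e M" by (rule module_frob_push[OF M p char])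
  have "finitely_generated A (frob_push A p 1 (ring_as_module A))"
    by (rule finite_module_imp_finitely_generated[OF module_frob_push[OF M.R.module_ring_as_module p char]])
      (use F in \<open>simp add: F_finite_def\<close>)
  then obtain C where C: "finite C" "generates A (frob_push A p 1 (ring_as_module A)) C"
    by (auto simp: finitely_generated_def)
  obtain B where B: "finite B" "generates A (frob_push A p e M) B"
    using Suc by (auto simp: finitely_generated_def)
  define star where "star = module.smult (frob_push A p e M)"
  have CA: "C \<subseteq> carrier A" and BM: "B \<subseteq> carrier M"
    using B C by (auto simp: generates_def)
  have Suc_smult: "r \<odot>\<^bsub>frob_push A p (Suc e) M\<^esub> x = star (r [^]\<^bsub>A\<^esub> p) x" if "r \<in> carrier A" for r x
    using that by (simp add: star_def M.R.nat_pow_pow)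
  have "generates A (frob_push A p (Suc e) M) ((\<lambda>(c, b). star c b) ` (C \<times> B))"
    unfolding generates_def
  proof (intro conjI allI impI)
    show "(\<lambda>(c, b). star c b) ` (C \<times> B) \<subseteq> carrier (frob_push A p (Suc e) M)"
      using CA BM by (auto simp: star_def)
    fix T
    assume T: "(\<lambda>(c, b). star c b) ` (C \<times> B) \<subseteq> T \<and> \<zero>\<^bsub>frob_push A p (Suc e) M\<^esub> \<in> T \<and>
      (\<forall>x\<in>T. \<forall>y\<in>T. x \<oplus>\<^bsub>frob_push A p (Suc e) M\<^esub> y \<in> T) \<and>
      (\<forall>r\<in>carrier A. \<forall>x\<in>T. r \<odot>\<^bsub>frob_push A p (Suc e) M\<^esub> x \<in> T)"
    have T_smult: "star (r [^]\<^bsub>A\<^esub> p) x \<in> T" if "r \<in> carrier A" "x \<in> T" for r x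
      using T that Suc_smult[of r x] by metis
    have CB: "star r b \<in> T" if "b \<in> B" "r \<in> carrier A" for r b
    proof -
      have "carrier (frob_push A p 1 (ring_as_module A)) \<subseteq> {r \<in> carrier A. star r b \<in> T}"
      proof (rule generatesD[OF C(2)])
        show "C \<subseteq> {r \<in> carrier A. star r b \<in> T}" using T CA that by auto
        show "\<zero>\<^bsub>frob_push A p 1 (ring_as_module A)\<^esub> \<in> {r \<in> carrier A. star r b \<in> T}"
          using T that BM N.smult_l_null[of b] by (auto simp: star_def simp del: frob_push_simps(4))
        fix x y assume "x \<in> {r \<in> carrier A. star r b \<in> T}" "y \<in> {r \<in> carrier A. star r b \<in> T}"
        then show "x \<oplus>\<^bsub>frob_push A p 1 (ring_as_module A)\<^esub> y \<in> {r \<in> carrier A. star r b \<in> T}"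
          using T that BM N.smult_l_distr[of x y b]
          by (auto simp: star_def simp del: frob_push_simps(4))
      next
        fix r x assume "r \<in> carrier A" "x \<in> {r \<in> carrier A. star r b \<in> T}"
        moreover have "r \<odot>\<^bsub>frob_push A p 1 (ring_as_module A)\<^esub> x = r [^]\<^bsub>A\<^esub> p \<otimes>\<^bsub>A\<^esub> x"
          by simp
        ultimately show "r \<odot>\<^bsub>frob_push A p 1 (ring_as_module A)\<^esub> x \<in> {r \<in> carrier A. star r b \<in> T}"
          using T_smult[of r "star x b"] that BM N.smult_assoc1[of "r [^]\<^bsub>A\<^esub> p" x b]
          by (auto simp: star_def simp del: frob_push_simps(4))
      qed
      then show ?thesis using that by auto
    qed
    have "carrier (frob_push A p e M) \<subseteq> {m \<in> carrier M. \<forall>r\<in>carrier A. star r m \<in> T}"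
    proof (rule generatesD[OF B(2)])
      show "B \<subseteq> {m \<in> carrier M. \<forall>r\<in>carrier A. star r m \<in> T}" using CB BM by auto
      show "\<zero>\<^bsub>frob_push A p e M\<^esub> \<in> {m \<in> carrier M. \<forall>r\<in>carrier A. star r m \<in> T}"
        using T N.smult_r_null by (auto simp: star_def simp del: frob_push_simps(4))
      fix x y assume "x \<in> {m \<in> carrier M. \<forall>r\<in>carrier A. star r m \<in> T}"
        "y \<in> {m \<in> carrier M. \<forall>r\<in>carrier A. star r m \<in> T}"
      then show "x \<oplus>\<^bsub>frob_push A p e M\<^esub> y \<in> {m \<in> carrier M. \<forall>r\<in>carrier A. star r m \<in> T}"
        using T N.smult_r_distr[of _ x y] by (auto simp: star_def simp del: frob_push_simps(4))
    next
      fix r x assume "r \<in> carrier A" "x \<in> {m \<in> carrier M. \<forall>r\<in>carrier A. star r m \<in> T}"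
      then show "r \<odot>\<^bsub>frob_push A p e M\<^esub> x \<in> {m \<in> carrier M. \<forall>r\<in>carrier A. star r m \<in> T}"
        using N.smult_assoc1[of _ r x, symmetric] N.smult_closed[of r x]
        by (auto simp: star_def simp del: frob_push_simps(4))
    qed
    then have "star \<one>\<^bsub>A\<^esub> m \<in> T" if "m \<in> carrier M" for m using that by auto
    then show "carrier (frob_push A p (Suc e) M) \<subseteq> T"
      using N.smult_one by (auto simp: star_def simp del: frob_push_simps(4))
  qed
  then show ?case
    unfolding finitely_generated_def using B(1) C(1) by (meson finite_SigmaI finite_imageI)
qed

section \<open>Linear maps and localization\<close>

text \<open>The kernel of \<open>R \<rightarrow> S\<^sup>-\<^sup>1 R\<close> is finitely generated, and each of its elements is killed by an element
  of \<open>S\<close>; the product over the generators kills the whole kernel.\<close>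

lemma (in fractions) common_annihilator:
  assumes "noetherian_ring R"
  obtains u where "u \<in> S" "\<And>x v. \<lbrakk>x \<in> carrier R; v \<in> S; v \<otimes> x = \<zero>\<rbrakk> \<Longrightarrow> u \<otimes> x = \<zero>"
proof -
  interpret noetherian_ring R by fact
  define K where "K = {x \<in> carrier R. \<exists>v\<in>S. v \<otimes> x = \<zero>}"
  have ann: "ideal {x \<in> carrier R. u \<otimes> x = \<zero>} R" if "u \<in> S" for u
  proof (rule idealI_mult_closed)
    have "u \<otimes> \<zero> = \<zero>" using that by simp
    then show "{x \<in> carrier R. u \<otimes> x = \<zero>} \<noteq> {}" using zero_closed by blast
    fix r a assume r: "r \<in> carrier R" and a: "a \<in> {x \<in> carrier R. u \<otimes> x = \<zero>}"
    then have "u \<otimes> (r \<otimes> a) = r \<otimes> (u \<otimes> a)" using that by (intro m_lcomm) auto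
    then show "r \<otimes> a \<in> {x \<in> carrier R. u \<otimes> x = \<zero>}" using r a by auto
  qed (use that in \<open>auto simp: r_distr\<close>)
  have "ideal K R"
  proof (rule idealI_mult_closed)
    show "K \<subseteq> carrier R" by (auto simp: K_def)
    have "\<one> \<otimes> \<zero> = \<zero>" by simp
    then show "K \<noteq> {}" using S_one zero_closed unfolding K_def by blast
  next
    fix a b assume "a \<in> K" "b \<in> K"
    then obtain v w where *: "a \<in> carrier R" "b \<in> carrier R" "v \<in> S" "w \<in> S" "v \<otimes> a = \<zero>" "w \<otimes> b = \<zero>"
      by (auto simp: K_def)
    have "(v \<otimes> w) \<otimes> (a \<oplus> b) = w \<otimes> (v \<otimes> a) \<oplus> v \<otimes> (w \<otimes> b)"
      using *(1-4) by (simp add: r_distr m_ac)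
    also have "\<dots> = \<zero>" using * by simp
    finally show "a \<oplus> b \<in> K" using * S_mult by (auto simp: K_def)
  next
    fix r a assume r: "r \<in> carrier R" and "a \<in> K"
    then obtain v where *: "a \<in> carrier R" "v \<in> S" "v \<otimes> a = \<zero>" by (auto simp: K_def)
    then have "v \<otimes> (r \<otimes> a) = r \<otimes> (v \<otimes> a)" using r by (intro m_lcomm) auto
    then have "v \<otimes> (r \<otimes> a) = \<zero>" using *(3) r by simp
    then show "r \<otimes> a \<in> K" using *(1,2) r unfolding K_def by blast
  qed
  then obtain A where A: "A \<subseteq> carrier R" "finite A" "K = Idl A"
    using finetely_gen by blast
  have "\<exists>u\<in>S. \<forall>x\<in>F. u \<otimes> x = \<zero>" if "finite F" "F \<subseteq> K" for F
    using that
  proof (induction F)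
    case (insert x F)
    then obtain u v where *: "u \<in> S" "\<forall>x\<in>F. u \<otimes> x = \<zero>" "v \<in> S" "v \<otimes> x = \<zero>" "x \<in> carrier R" "F \<subseteq> carrier R"
      by (auto simp: K_def)
    have "(u \<otimes> v) \<otimes> y = \<zero>" if "y \<in> insert x F" for y
    proof (cases "y = x")
      case True then show ?thesis using * by (simp add: m_assoc)
    next
      case False
      then have "y \<in> F" "y \<in> carrier R" using that * by auto
      then have "(u \<otimes> v) \<otimes> y = v \<otimes> (u \<otimes> y)"
        using S_carr[OF *(1)] S_carr[OF *(3)] by (simp add: m_ac)
      then show ?thesis using * \<open>y \<in> F\<close> by simp
    qed
    then show ?case using * S_mult by blast
  qed (use S_one in auto)
  then obtain u where u: "u \<in> S" "\<forall>x\<in>A. u \<otimes> x = \<zero>"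
    using A genideal_self by metis
  then have "K \<subseteq> {x \<in> carrier R. u \<otimes> x = \<zero>}"
    unfolding A(3) using A(1) by (intro genideal_minimal ann) auto
  then show ?thesis using that[OF u(1)] unfolding K_def by blast
qed

text \<open>The map \<open>h\<close> exhibits \<open>N'\<close> as the localization \<open>S\<^sup>-\<^sup>1 N\<close>: \<open>h_surj\<close> says that elements of \<open>N'\<close> are
  fractions \<open>n/s\<close>, and \<open>h_inj\<close> that two elements are identified only if they agree up to \<open>S\<close>.\<close>

locale localized_module = fractions R S + N: module R N + N': module "localization R S" N'
  for R :: "('a, 'r) ring_scheme" (structure) and S and N :: "('a, 'c, 'm) module_scheme"
    and N' :: "(('a \<times> 'a) set, 'd, 'n) module_scheme" +
  fixes h :: "'c \<Rightarrow> 'd"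
  assumes h_closed [simp, intro]: "n \<in> carrier N \<Longrightarrow> h n \<in> carrier N'"
    and h_add: "\<lbrakk>n \<in> carrier N; m \<in> carrier N\<rbrakk> \<Longrightarrow> h (n \<oplus>\<^bsub>N\<^esub> m) = h n \<oplus>\<^bsub>N'\<^esub> h m"
    and h_smult: "\<lbrakk>r \<in> carrier R; n \<in> carrier N\<rbrakk> \<Longrightarrow> h (r \<odot>\<^bsub>N\<^esub> n) = frac r \<one> \<odot>\<^bsub>N'\<^esub> h n"
    and h_surj: "n' \<in> carrier N' \<Longrightarrow> \<exists>s\<in>S. \<exists>n\<in>carrier N. frac s \<one> \<odot>\<^bsub>N'\<^esub> n' = h n"
    and h_inj: "\<lbrakk>n \<in> carrier N; m \<in> carrier N; h n = h m\<rbrakk> \<Longrightarrow> \<exists>s\<in>S. s \<odot>\<^bsub>N\<^esub> n = s \<odot>\<^bsub>N\<^esub> m"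
begin

text \<open>The localized map is \<open>\<theta>(n/s) = \<phi>(n)/s\<close>; that it does not depend on the fraction is \<open>h_inj\<close>.\<close>

lemma localize_hom:
  assumes \<phi>: "\<phi> \<in> module_hom R N (ring_as_module R)"
  shows "\<exists>\<theta>\<in>module_hom L N' (ring_as_module L). \<forall>n\<in>carrier N. \<theta> (h n) = frac (\<phi> n) \<one>"
proof -
  note \<phi>_hom = module_homD[OF \<phi>, unfolded ring_as_module_simps]
  note \<phi>c = \<phi>_hom(1) and \<phi>a = \<phi>_hom(2) and \<phi>s = \<phi>_hom(3)
  have base [simp, intro]: "frac x \<one> \<in> carrier L" if "x \<in> carrier R" for x
    using that S_one by auto
  have base_mult: "frac (x \<otimes> y) \<one> = frac x \<one> \<otimes>\<^bsub>L\<^esub> frac y \<one>" if "x \<in> carrier R" "y \<in> carrier R" for x y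
    using that S_one by (simp add: mult_frac)
  define rep where "rep n' s n \<longleftrightarrow> s \<in> S \<and> n \<in> carrier N \<and> frac s \<one> \<odot>\<^bsub>N'\<^esub> n' = h n" for n' s n
  define \<theta> where "\<theta> n' = (SOME z. \<exists>s n. rep n' s n \<and> z = frac (\<phi> n) s)" for n'
  have uniq: "frac (\<phi> n) s = frac (\<phi> m) t"
    if n': "n' \<in> carrier N'" and 1: "rep n' s n" and 2: "rep n' t m" for n' s n t m
  proof -
    have m: "s \<in> S" "t \<in> S" "n \<in> carrier N" "m \<in> carrier N" using 1 2 by (auto simp: rep_def)
    have "h (t \<odot>\<^bsub>N\<^esub> n) = frac t \<one> \<odot>\<^bsub>N'\<^esub> (frac s \<one> \<odot>\<^bsub>N'\<^esub> n')"
      using 1 m by (simp add: h_smult rep_def)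
    also have "\<dots> = frac s \<one> \<odot>\<^bsub>N'\<^esub> (frac t \<one> \<odot>\<^bsub>N'\<^esub> n')"
      using n' m by (simp add: N'.smult_assoc1[symmetric] base_mult[symmetric] m_comm)
    also have "\<dots> = h (s \<odot>\<^bsub>N\<^esub> m)"
      using 2 m by (simp add: h_smult rep_def)
    finally obtain u where u: "u \<in> S" "u \<odot>\<^bsub>N\<^esub> (t \<odot>\<^bsub>N\<^esub> n) = u \<odot>\<^bsub>N\<^esub> (s \<odot>\<^bsub>N\<^esub> m)"
      using h_inj[of "t \<odot>\<^bsub>N\<^esub> n" "s \<odot>\<^bsub>N\<^esub> m"] m by auto
    then have "u \<otimes> (t \<otimes> \<phi> n) = u \<otimes> (s \<otimes> \<phi> m)"
      using m \<phi>s[of u "t \<odot>\<^bsub>N\<^esub> n"] \<phi>s[of u "s \<odot>\<^bsub>N\<^esub> m"] by (simp add: \<phi>s)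
    then show ?thesis using u m \<phi>c by (auto simp: frac_eq_iff)
  qed
  have \<theta>_eq: "\<theta> n' = frac (\<phi> n) s" if n': "n' \<in> carrier N'" and r: "rep n' s n" for n' s n
  proof -
    have "\<exists>s n. rep n' s n \<and> \<theta> n' = frac (\<phi> n) s"
      unfolding \<theta>_def using r by (intro someI_ex[where P = "\<lambda>z. \<exists>s n. rep n' s n \<and> z = frac (\<phi> n) s"]) blast
    then show ?thesis using uniq[OF n' r] by auto
  qed
  have rep_ex: "\<exists>s n. rep n' s n" if "n' \<in> carrier N'" for n'
    using h_surj[OF that] by (auto simp: rep_def)
  have "\<theta> \<in> module_hom L N' (ring_as_module L)"
    unfolding module_hom_def
  proof (intro CollectI conjI ballI)
    show "\<theta> \<in> carrier N' \<rightarrow> carrier (ring_as_module L)"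
    proof
      fix n' assume n': "n' \<in> carrier N'"
      then obtain s n where r: "rep n' s n" using rep_ex by blast
      then show "\<theta> n' \<in> carrier (ring_as_module L)"
        using \<theta>_eq[OF n' r] \<phi>c by (auto simp: rep_def)
    qed
  next
    fix x y assume x: "x \<in> carrier N'" and y: "y \<in> carrier N'"
    then obtain s n t m where r: "rep x s n" "rep y t m" using rep_ex by blast
    then have m: "s \<in> S" "t \<in> S" "n \<in> carrier N" "m \<in> carrier N"
      and rx: "h n = frac s \<one> \<odot>\<^bsub>N'\<^esub> x" and ry: "h m = frac t \<one> \<odot>\<^bsub>N'\<^esub> y"
      by (auto simp: rep_def)
    have "frac (s \<otimes> t) \<one> \<odot>\<^bsub>N'\<^esub> (x \<oplus>\<^bsub>N'\<^esub> y)
        = frac (t \<otimes> s) \<one> \<odot>\<^bsub>N'\<^esub> x \<oplus>\<^bsub>N'\<^esub> frac (s \<otimes> t) \<one> \<odot>\<^bsub>N'\<^esub> y"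
      using m x y by (simp add: N'.smult_r_distr m_comm)
    also have "\<dots> = frac t \<one> \<odot>\<^bsub>N'\<^esub> h n \<oplus>\<^bsub>N'\<^esub> frac s \<one> \<odot>\<^bsub>N'\<^esub> h m"
      using m x y by (simp add: rx ry base_mult N'.smult_assoc1)
    also have "\<dots> = h (t \<odot>\<^bsub>N\<^esub> n \<oplus>\<^bsub>N\<^esub> s \<odot>\<^bsub>N\<^esub> m)"
      using m by (simp add: h_add h_smult)
    finally have r': "rep (x \<oplus>\<^bsub>N'\<^esub> y) (s \<otimes> t) (t \<odot>\<^bsub>N\<^esub> n \<oplus>\<^bsub>N\<^esub> s \<odot>\<^bsub>N\<^esub> m)"
      using m by (simp add: rep_def S_mult)
    show "\<theta> (x \<oplus>\<^bsub>N'\<^esub> y) = \<theta> x \<oplus>\<^bsub>ring_as_module L\<^esub> \<theta> y"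
      using \<theta>_eq[OF _ r'] \<theta>_eq[OF x r(1)] \<theta>_eq[OF y r(2)] x y m \<phi>c
      by (simp add: \<phi>a \<phi>s add_frac)
  next
    fix r x assume r: "r \<in> carrier L" and x: "x \<in> carrier N'"
    obtain a t where a: "a \<in> carrier R" "t \<in> S" "r = frac a t" using r by (rule frac_cases)
    obtain s n where rep: "rep x s n" using rep_ex x by blast
    then have m: "s \<in> S" "n \<in> carrier N" and rx: "h n = frac s \<one> \<odot>\<^bsub>N'\<^esub> x"
      by (auto simp: rep_def)
    have "frac (t \<otimes> s) \<one> \<odot>\<^bsub>N'\<^esub> (r \<odot>\<^bsub>N'\<^esub> x) = (frac (t \<otimes> s) \<one> \<otimes>\<^bsub>L\<^esub> r) \<odot>\<^bsub>N'\<^esub> x"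
      using m x r a by (simp add: N'.smult_assoc1)
    also have "frac (t \<otimes> s) \<one> \<otimes>\<^bsub>L\<^esub> r = frac (a \<otimes> s) \<one>"
      using a m S_one S_mult by (simp add: mult_frac) (intro frac_eqI, auto simp: m_ac)
    also have "\<dots> \<odot>\<^bsub>N'\<^esub> x = frac a \<one> \<odot>\<^bsub>N'\<^esub> (frac s \<one> \<odot>\<^bsub>N'\<^esub> x)"
      using a m x by (simp add: base_mult N'.smult_assoc1)
    also have "\<dots> = h (a \<odot>\<^bsub>N\<^esub> n)"
      using a m by (simp add: h_smult rx)
    finally have r': "rep (r \<odot>\<^bsub>N'\<^esub> x) (t \<otimes> s) (a \<odot>\<^bsub>N\<^esub> n)"
      using m a by (simp add: rep_def S_mult)
    show "\<theta> (r \<odot>\<^bsub>N'\<^esub> x) = r \<odot>\<^bsub>ring_as_module L\<^esub> \<theta> x"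
      using \<theta>_eq[OF _ r'] \<theta>_eq[OF x rep] x r a m \<phi>c by (simp add: \<phi>s mult_frac)
  qed
  moreover have "\<theta> (h n) = frac (\<phi> n) \<one>" if n: "n \<in> carrier N" for n
  proof -
    have "frac \<one> \<one> \<odot>\<^bsub>N'\<^esub> h n = h n"
      using n by (simp add: one_frac[symmetric])
    then show ?thesis
      using n S_one by (intro \<theta>_eq) (auto simp: rep_def)
  qed
  ultimately show ?thesis by blast
qed

text \<open>A product of denominators of the values at finitely many generators works for all elements,
  because the elements for which a given \<open>t\<close> works form a submodule.\<close>

lemma common_denominator:
  assumes \<theta>: "\<theta> \<in> module_hom L N' (ring_as_module L)" and fg: "finitely_generated R N"
  obtains t where "t \<in> S"
    "\<And>n. n \<in> carrier N \<Longrightarrow> \<exists>c\<in>carrier R. frac c \<one> = frac t \<one> \<otimes>\<^bsub>L\<^esub> \<theta> (h n)"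
proof -
  note \<theta>_hom = module_homD[OF \<theta>, unfolded ring_as_module_simps]
  note \<theta>c = \<theta>_hom(1) and \<theta>a = \<theta>_hom(2) and \<theta>s = \<theta>_hom(3)
  have base [simp, intro]: "frac x \<one> \<in> carrier L" if "x \<in> carrier R" for x
    using that S_one by auto
  define good where "good t = {n \<in> carrier N. \<exists>c\<in>carrier R. frac c \<one> = frac t \<one> \<otimes>\<^bsub>L\<^esub> \<theta> (h n)}" for t
  obtain B where B: "finite B" "generates R N B" using fg by (auto simp: finitely_generated_def)
  have scale: "n \<in> good (t \<otimes> s)" if "n \<in> good t" "t \<in> S" "s \<in> S" for n t s
  proof -
    note hyps = that
    obtain c where c: "c \<in> carrier R" "frac c \<one> = frac t \<one> \<otimes>\<^bsub>L\<^esub> \<theta> (h n)" "n \<in> carrier N"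
      using hyps by (auto simp: good_def)
    have "frac (s \<otimes> c) \<one> = frac s \<one> \<otimes>\<^bsub>L\<^esub> (frac t \<one> \<otimes>\<^bsub>L\<^esub> \<theta> (h n))"
      using c that S_one by (simp add: mult_frac flip: c(2))
    also have "\<dots> = (frac s \<one> \<otimes>\<^bsub>L\<^esub> frac t \<one>) \<otimes>\<^bsub>L\<^esub> \<theta> (h n)"
      using c that \<theta>c by (simp add: N'.R.m_assoc)
    also have "frac s \<one> \<otimes>\<^bsub>L\<^esub> frac t \<one> = frac (t \<otimes> s) \<one>"
      using that S_one by (simp add: mult_frac m_comm)
    finally show ?thesis using c that by (auto simp: good_def)
  qed
  have "\<exists>t\<in>S. F \<subseteq> good t" if "finite F" "F \<subseteq> carrier N" for F
    using that
  proof (induction F)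
    case (insert n F)
    then obtain t where t: "t \<in> S" "F \<subseteq> good t" by auto
    obtain c s where c: "c \<in> carrier R" "s \<in> S" "\<theta> (h n) = frac c s"
      using \<theta>c[of "h n"] insert.prems by (auto elim: frac_cases)
    then have "n \<in> good s"
      using insert.prems c by (auto simp: good_def frac_clear)
    then have "n \<in> good (t \<otimes> s)"
      using scale[of n s t] t c by (simp add: m_comm)
    then have "insert n F \<subseteq> good (t \<otimes> s)"
      using scale[of _ t s] t c by auto
    then show ?case using t c S_mult by blast
  qed (use S_one in auto)
  moreover have "B \<subseteq> carrier N"
    using conjunct1[OF B(2)[unfolded generates_def]] .
  ultimately obtain t where t: "t \<in> S" "B \<subseteq> good t"
    using B(1) by blast
  have "carrier N \<subseteq> good t"
  proof (rule generatesD[OF B(2) t(2)])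
    have "\<theta> (h \<zero>\<^bsub>N\<^esub>) = \<zero>\<^bsub>L\<^esub>"
    proof -
      have "h \<zero>\<^bsub>N\<^esub> = \<zero>\<^bsub>N'\<^esub>"
        using h_smult[of \<zero> "\<zero>\<^bsub>N\<^esub>"] by (simp add: zero_frac[symmetric])
      then have "\<theta> (h \<zero>\<^bsub>N\<^esub>) = \<theta> (\<zero>\<^bsub>L\<^esub> \<odot>\<^bsub>N'\<^esub> \<zero>\<^bsub>N'\<^esub>)" by simp
      also have "\<dots> = \<zero>\<^bsub>L\<^esub> \<otimes>\<^bsub>L\<^esub> \<theta> \<zero>\<^bsub>N'\<^esub>" by (rule \<theta>s) simp_all
      also have "\<dots> = \<zero>\<^bsub>L\<^esub>" by (rule N'.R.l_null) (simp add: \<theta>c)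
      finally show ?thesis .
    qed
    then show "\<zero>\<^bsub>N\<^esub> \<in> good t"
      using t by (auto simp: good_def zero_frac[symmetric] intro!: bexI[of _ \<zero>])
  next
    fix x y assume "x \<in> good t" "y \<in> good t"
    then obtain c d where *: "c \<in> carrier R" "d \<in> carrier R" "x \<in> carrier N" "y \<in> carrier N"
      "frac c \<one> = frac t \<one> \<otimes>\<^bsub>L\<^esub> \<theta> (h x)" "frac d \<one> = frac t \<one> \<otimes>\<^bsub>L\<^esub> \<theta> (h y)"
      by (auto simp: good_def)
    have "frac (c \<oplus> d) \<one> = frac t \<one> \<otimes>\<^bsub>L\<^esub> \<theta> (h (x \<oplus>\<^bsub>N\<^esub> y))"
      using * t \<theta>c S_one by (simp add: h_add \<theta>a N'.R.r_distr frac_add_same[symmetric])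
    then show "x \<oplus>\<^bsub>N\<^esub> y \<in> good t" using * by (auto simp: good_def)
  next
    fix r x assume "r \<in> carrier R" "x \<in> good t"
    then obtain c where *: "c \<in> carrier R" "x \<in> carrier N" "frac c \<one> = frac t \<one> \<otimes>\<^bsub>L\<^esub> \<theta> (h x)"
      by (auto simp: good_def)
    have "frac (r \<otimes> c) \<one> = frac r \<one> \<otimes>\<^bsub>L\<^esub> frac c \<one>"
      using *(1) \<open>r \<in> carrier R\<close> S_one by (simp add: mult_frac)
    also have "\<dots> = frac t \<one> \<otimes>\<^bsub>L\<^esub> \<theta> (h (r \<odot>\<^bsub>N\<^esub> x))"
      using * \<open>r \<in> carrier R\<close> t \<theta>c by (simp add: h_smult \<theta>s N'.R.m_lcomm)
    finally show "r \<odot>\<^bsub>N\<^esub> x \<in> good t" using * \<open>r \<in> carrier R\<close> by (auto simp: good_def)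
  qed
  then show ?thesis using that[OF t(1)] by (auto simp: good_def)
qed

text \<open>With the common denominator \<open>t\<close>, the values \<open>t \<theta>(n)\<close> lift to \<open>R\<close>, but only up to the kernel of
  \<open>R \<rightarrow> S\<^sup>-\<^sup>1 R\<close>, so the lifts need not be additive. Multiplication with the common annihilator \<open>u\<close> of
  this kernel makes them unique, hence linear; \<open>w = ut\<close>.\<close>

lemma descend_hom:
  assumes noeth: "noetherian_ring R" and fg: "finitely_generated R N"
    and \<theta>: "\<theta> \<in> module_hom L N' (ring_as_module L)"
  shows "\<exists>\<phi>\<in>module_hom R N (ring_as_module R). \<exists>w\<in>S.
    \<forall>n\<in>carrier N. frac (\<phi> n) \<one> = frac w \<one> \<otimes>\<^bsub>L\<^esub> \<theta> (h n)"
proof -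
  obtain u where u: "u \<in> S" "\<And>x v. \<lbrakk>x \<in> carrier R; v \<in> S; v \<otimes> x = \<zero>\<rbrakk> \<Longrightarrow> u \<otimes> x = \<zero>"
    using common_annihilator[OF noeth] by blast
  obtain t where t: "t \<in> S"
    "\<And>n. n \<in> carrier N \<Longrightarrow> \<exists>c\<in>carrier R. frac c \<one> = frac t \<one> \<otimes>\<^bsub>L\<^esub> \<theta> (h n)"
    using common_denominator[OF \<theta> fg] by blast
  note \<theta>_hom = module_homD[OF \<theta>, unfolded ring_as_module_simps]
  note \<theta>c = \<theta>_hom(1) and \<theta>a = \<theta>_hom(2) and \<theta>s = \<theta>_hom(3)
  have base [simp, intro]: "frac x \<one> \<in> carrier L" if "x \<in> carrier R" for x
    using that S_one by auto
  define c where "c n = (SOME c. c \<in> carrier R \<and> frac c \<one> = frac t \<one> \<otimes>\<^bsub>L\<^esub> \<theta> (h n))" for n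
  have c: "c n \<in> carrier R" "frac (c n) \<one> = frac t \<one> \<otimes>\<^bsub>L\<^esub> \<theta> (h n)" if "n \<in> carrier N" for n
    using someI_ex[of "\<lambda>c. c \<in> carrier R \<and> frac c \<one> = frac t \<one> \<otimes>\<^bsub>L\<^esub> \<theta> (h n)"] t(2)[OF that]
    by (auto simp: c_def)
  have u_eq: "u \<otimes> a = u \<otimes> b" if ab: "a \<in> carrier R" "b \<in> carrier R" "frac a \<one> = frac b \<one>" for a b
  proof -
    obtain v where v: "v \<in> S" "v \<otimes> a = v \<otimes> b"
      using ab S_one by (auto simp: frac_eq_iff)
    have "v \<otimes> (a \<ominus> b) = \<zero>"
      using v ab by (simp add: a_minus_def r_distr r_minus r_neg)
    then have "u \<otimes> (a \<ominus> b) = \<zero>" using u(2)[of "a \<ominus> b" v] ab v by simp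
    then have "u \<otimes> a \<ominus> u \<otimes> b = \<zero>" using u(1) ab by (simp add: a_minus_def r_distr r_minus)
    then show ?thesis using u(1) ab by (simp add: r_right_minus_eq)
  qed
  define \<phi> where "\<phi> n = u \<otimes> c n" for n
  have "\<phi> \<in> module_hom R N (ring_as_module R)"
    unfolding module_hom_def
  proof (intro CollectI conjI ballI)
    show "\<phi> \<in> carrier N \<rightarrow> carrier (ring_as_module R)"
      using c u(1) by (auto simp: \<phi>_def)
  next
    fix x y assume x: "x \<in> carrier N" and y: "y \<in> carrier N"
    have "frac (c (x \<oplus>\<^bsub>N\<^esub> y)) \<one> = frac (c x \<oplus> c y) \<one>"
      using x y t(1) \<theta>c c S_one by (simp add: h_add \<theta>a N'.R.r_distr frac_add_same[symmetric])
    then show "\<phi> (x \<oplus>\<^bsub>N\<^esub> y) = \<phi> x \<oplus>\<^bsub>ring_as_module R\<^esub> \<phi> y"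
      using u_eq[of "c (x \<oplus>\<^bsub>N\<^esub> y)" "c x \<oplus> c y"] c x y u(1) by (simp add: \<phi>_def r_distr)
  next
    fix r x assume r: "r \<in> carrier R" and x: "x \<in> carrier N"
    have "frac (r \<otimes> c x) \<one> = frac r \<one> \<otimes>\<^bsub>L\<^esub> frac (c x) \<one>"
      using r x c(1) S_one by (simp add: mult_frac)
    also have "\<dots> = frac (c (r \<odot>\<^bsub>N\<^esub> x)) \<one>"
      using r x t(1) \<theta>c by (simp add: c h_smult \<theta>s N'.R.m_lcomm)
    finally show "\<phi> (r \<odot>\<^bsub>N\<^esub> x) = r \<odot>\<^bsub>ring_as_module R\<^esub> \<phi> x"
      using u_eq[of "r \<otimes> c x" "c (r \<odot>\<^bsub>N\<^esub> x)"] c r x u(1) by (simp add: \<phi>_def m_lcomm)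
  qed
  moreover have "frac (\<phi> n) \<one> = frac (u \<otimes> t) \<one> \<otimes>\<^bsub>L\<^esub> \<theta> (h n)" if n: "n \<in> carrier N" for n
  proof -
    have "frac (\<phi> n) \<one> = frac u \<one> \<otimes>\<^bsub>L\<^esub> (frac t \<one> \<otimes>\<^bsub>L\<^esub> \<theta> (h n))"
      using n c u(1) S_one by (simp add: \<phi>_def mult_frac flip: c(2))
    also have "\<dots> = (frac u \<one> \<otimes>\<^bsub>L\<^esub> frac t \<one>) \<otimes>\<^bsub>L\<^esub> \<theta> (h n)"
      using n u(1) t(1) \<theta>c by (simp add: N'.R.m_assoc)
    also have "frac u \<one> \<otimes>\<^bsub>L\<^esub> frac t \<one> = frac (u \<otimes> t) \<one>"
      using u(1) t(1) S_one by (simp add: mult_frac)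
    finally show ?thesis .
  qed
  ultimately show ?thesis using u(1) t(1) S_mult by blast
qed

end

section \<open>Primes of height one and associated primes\<close>

text \<open>In a domain this is height one in the sense of chains, see \<open>mem_prime_divisors_iff\<close>.\<close>

definition height_one :: "('a, 'b) ring_scheme \<Rightarrow> 'a set \<Rightarrow> bool" where
  "height_one R Q \<longleftrightarrow> primeideal Q R \<and> Q \<noteq> {\<zero>\<^bsub>R\<^esub>} \<and>
     (\<forall>Q'. primeideal Q' R \<and> Q' \<subseteq> Q \<longrightarrow> Q' = {\<zero>\<^bsub>R\<^esub>} \<or> Q' = Q)"

lemma primeideal_zero_mem: "primeideal Q R \<Longrightarrow> \<zero>\<^bsub>R\<^esub> \<in> Q"
  by (simp add: primeideal_def ideal_def additive_subgroup.zero_closed)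

lemma (in domain) mem_prime_divisors_iff: "Q \<in> prime_divisors R \<longleftrightarrow> height_one R Q"
proof
  define H where "H = {enat n | n. \<exists>c :: nat \<Rightarrow> 'a set.
     (\<forall>i\<le>n. primeideal (c i) R) \<and> (\<forall>i<n. c i \<subset> c (Suc i)) \<and> c n = Q}"
  have H: "prime_height R Q = Sup H" by (simp add: prime_height_def H_def)
  have zero: "primeideal {\<zero>} R" by (rule zeroprimeideal)
  {
    assume "Q \<in> prime_divisors R"
    then have Q: "primeideal Q R" and ht: "Sup H = 1" by (auto simp: prime_divisors_def H)
    have "Q \<noteq> {\<zero>}"
    proof
      assume Q0: "Q = {\<zero>}"
      have "h \<le> 0" if "h \<in> H" for h
      proof -
        obtain n c where c: "h = enat n" "\<forall>i\<le>n. primeideal (c i) R" "\<forall>i<n. c i \<subset> c (Suc i)" "c n = Q"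
          using \<open>h \<in> H\<close> by (auto simp: H_def)
        have "n = 0"
        proof (rule ccontr)
          assume "n \<noteq> 0"
          then obtain m where m: "n = Suc m" by (cases n) auto
          then have "c m \<subset> {\<zero>}" "primeideal (c m) R" using c Q0 by auto
          then show False using primeideal_zero_mem[of "c m" R] by auto
        qed
        then show ?thesis using c by (simp add: zero_enat_def)
      qed
      then have "Sup H \<le> 0" by (rule Sup_least)
      then show False using ht by simp
    qed
    moreover have "Q' = {\<zero>} \<or> Q' = Q" if Q': "primeideal Q' R" "Q' \<subseteq> Q" for Q'
    proof (rule ccontr)
      assume "\<not> (Q' = {\<zero>} \<or> Q' = Q)"
      then have ne: "{\<zero>} \<subset> Q'" "Q' \<subset> Q" using Q' primeideal_zero_mem[OF Q'(1)] by auto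
      define c where "c i = (if i = 0 then {\<zero>} else if i = 1 then Q' else Q)" for i :: nat
      have "(\<forall>i\<le>2. primeideal (c i) R) \<and> (\<forall>i<2. c i \<subset> c (Suc i)) \<and> c 2 = Q"
        using ne Q Q' zero by (auto simp: c_def less_2_cases_iff)
      then have "enat 2 \<in> H" unfolding H_def by blast
      then have "enat 2 \<le> 1" using Sup_upper[of "enat 2" H] ht by simp
      then show False by (simp add: one_enat_def)
    qed
    ultimately show "height_one R Q" using Q by (auto simp: height_one_def)
  }
  {
    assume h1: "height_one R Q"
    then have Q: "primeideal Q R" "Q \<noteq> {\<zero>}"
      and min: "\<And>Q'. \<lbrakk>primeideal Q' R; Q' \<subseteq> Q\<rbrakk> \<Longrightarrow> Q' = {\<zero>} \<or> Q' = Q"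
      by (auto simp: height_one_def)
    have "h \<le> 1" if "h \<in> H" for h
    proof -
      obtain n c where c: "h = enat n" "\<forall>i\<le>n. primeideal (c i) R" "\<forall>i<n. c i \<subset> c (Suc i)" "c n = Q"
        using \<open>h \<in> H\<close> by (auto simp: H_def)
      have "n \<le> 1"
      proof (rule ccontr)
        assume "\<not> n \<le> 1"
        then obtain m where m: "n = Suc (Suc m)" by (metis Suc_le_D not_less_eq_eq One_nat_def)
        then have "c m \<subset> c (Suc m)" "c (Suc m) \<subset> Q" "primeideal (c m) R" "primeideal (c (Suc m)) R"
          using c by auto
        then show False using min[of "c (Suc m)"] primeideal_zero_mem[of "c m" R] by auto
      qed
      then show ?thesis using c by (simp add: one_enat_def)
    qed
    then have "Sup H \<le> 1" by (rule Sup_least)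
    moreover have "1 \<le> Sup H"
    proof -
      define c where "c i = (if i = 0 then {\<zero>} else Q)" for i :: nat
      have "(\<forall>i\<le>1. primeideal (c i) R) \<and> (\<forall>i<1. c i \<subset> c (Suc i)) \<and> c 1 = Q"
        using Q zero primeideal_zero_mem[OF Q(1)] by (auto simp: c_def)
      then have "enat 1 \<in> H" unfolding H_def by blast
      then show ?thesis using Sup_upper[of "enat 1" H] by (simp add: one_enat_def)
    qed
    ultimately show "Q \<in> prime_divisors R" using Q by (simp add: prime_divisors_def H)
  }
qed

lemma (in noetherian_ring) maximal_ideal_in_family:
  assumes "C \<noteq> {}" "\<And>I. I \<in> C \<Longrightarrow> ideal I R"
  obtains M where "M \<in> C" "\<And>I. \<lbrakk>I \<in> C; M \<subseteq> I\<rbrakk> \<Longrightarrow> I = M"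
proof -
  have "\<exists>M\<in>C. \<forall>I\<in>C. M \<subseteq> I \<longrightarrow> I = M"
  proof (rule subset_Zorn_nonempty[OF assms(1)])
    fix \<C> assume C: "\<C> \<noteq> {}" "subset.chain C \<C>"
    then have "subset.chain {I. ideal I R} \<C>"
      using assms(2) by (auto simp: subset_chain_def)
    then have "\<Union>\<C> \<in> \<C>" by (rule ideal_chain_is_trivial[OF C(1)])
    then show "\<Union>\<C> \<in> C" using C by (auto simp: subset_chain_def)
  qed
  then show ?thesis using that by blast
qed

lemma (in cring) ideal_colon:
  assumes "ideal J R" and z: "z \<in> carrier R"
  shows "ideal {r \<in> carrier R. r \<otimes> z \<in> J} R"
proof -
  interpret J: ideal J R by fact
  show ?thesis
  proof (rule idealI_mult_closed)
    show "{r \<in> carrier R. r \<otimes> z \<in> J} \<noteq> {}" using z by (auto intro!: exI[of _ \<zero>])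
    fix x a assume x: "x \<in> carrier R" and a: "a \<in> {r \<in> carrier R. r \<otimes> z \<in> J}"
    then have "x \<otimes> (a \<otimes> z) \<in> J" by (auto intro: J.I_l_closed)
    then show "x \<otimes> a \<in> {r \<in> carrier R. r \<otimes> z \<in> J}"
      using a x z by (auto simp: m_assoc)
  qed (use z in \<open>auto simp: l_distr\<close>)
qed

text \<open>Among the ideals \<open>(J : z)\<close> that avoid \<open>S\<close>, a maximal one is prime: let \<open>ab\<close> belong to \<open>(J : z)\<close>. Both
  \<open>(J : az)\<close> and \<open>(J : sz)\<close> for \<open>s \<in> S\<close> contain \<open>(J : z)\<close>, and the second one avoids \<open>S\<close>. If \<open>(J : az)\<close>
  avoids \<open>S\<close>, it is equal to \<open>(J : z)\<close> and contains \<open>b\<close>. Otherwise it contains some \<open>s \<in> S\<close>, and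
  then \<open>(J : sz) = (J : z)\<close> contains \<open>a\<close>. For \<open>S = {1}\<close> this is the existence of associated primes.\<close>

lemma (in fractions) associated_prime:
  assumes "noetherian_ring R" "ideal J R" "J \<inter> S = {}"
  obtains z where "z \<in> carrier R" "primeideal {r \<in> carrier R. r \<otimes> z \<in> J} R"
    "{r \<in> carrier R. r \<otimes> z \<in> J} \<inter> S = {}"
proof -
  interpret N: noetherian_ring R by fact
  interpret J: ideal J R by fact
  define col where "col z = {r \<in> carrier R. r \<otimes> z \<in> J}" for z
  define C where "C = {col z | z. z \<in> carrier R \<and> col z \<inter> S = {}}"
  have "col \<one> = J" using J.a_subset by (auto simp: col_def)
  then have "C \<noteq> {}" using assms(3) unfolding C_def by auto
  moreover have "ideal I R" if "I \<in> C" for I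
    using that ideal_colon[OF assms(2)] by (auto simp: C_def col_def)
  ultimately obtain M where M: "M \<in> C" "\<And>I. \<lbrakk>I \<in> C; M \<subseteq> I\<rbrakk> \<Longrightarrow> I = M"
    using N.maximal_ideal_in_family by metis
  then obtain z where z: "z \<in> carrier R" "M = col z" "col z \<inter> S = {}" by (auto simp: C_def)
  interpret M: ideal M R unfolding z(2) col_def by (rule ideal_colon[OF assms(2) z(1)])
  have "primeideal M R"
  proof (rule primeidealI[OF M.is_ideal is_cring])
    have memM: "r \<in> M \<longleftrightarrow> r \<in> carrier R \<and> r \<otimes> z \<in> J" for r
      unfolding z(2) col_def by simp
    have memcol: "r \<in> col c \<longleftrightarrow> r \<in> carrier R \<and> r \<otimes> c \<in> J" for r c
      unfolding col_def by simp
    show "carrier R \<noteq> M" using z(2,3) S_one by auto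
    fix a b assume a: "a \<in> carrier R" and b: "b \<in> carrier R" and ab: "a \<otimes> b \<in> M"
    have sub: "M \<subseteq> col (c \<otimes> z)" if c: "c \<in> carrier R" for c
    proof
      fix r assume "r \<in> M"
      then have r: "r \<in> carrier R" "r \<otimes> z \<in> J" by (simp_all add: memM)
      then have "c \<otimes> (r \<otimes> z) \<in> J" using J.I_l_closed[OF r(2) c] by simp
      moreover have "c \<otimes> (r \<otimes> z) = r \<otimes> (c \<otimes> z)" using r(1) c z(1) by (rule_tac m_lcomm)
      ultimately show "r \<in> col (c \<otimes> z)" using r c by (simp add: memcol)
    qed
    show "a \<in> M \<or> b \<in> M"
    proof (cases "col (a \<otimes> z) \<inter> S = {}")
      case True
      then have "col (a \<otimes> z) = M"
        using M(2)[of "col (a \<otimes> z)"] sub[OF a] a z(1) True m_closed[OF a z(1)] unfolding C_def by blast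
      moreover have "b \<in> col (a \<otimes> z)"
        using ab a b z(1) m_comm[of a b] by (simp add: memcol memM m_assoc)
      ultimately show ?thesis by simp
    next
      case False
      then obtain s where "s \<in> col (a \<otimes> z)" "s \<in> S" by blast
      then have s: "s \<in> S" "s \<otimes> (a \<otimes> z) \<in> J" by (simp_all add: memcol)
      have "col (s \<otimes> z) \<inter> S = {}"
      proof (rule ccontr)
        assume "col (s \<otimes> z) \<inter> S \<noteq> {}"
        then obtain r where "r \<in> col (s \<otimes> z)" "r \<in> S" by blast
        then have r: "r \<in> S" "r \<otimes> (s \<otimes> z) \<in> J" by (simp_all add: memcol)
        then have "r \<otimes> s \<in> col z" using s(1) z(1) by (simp add: memcol m_assoc)
        then show False using z(3) S_mult[OF r(1) s(1)] by blast
      qed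
      then have "col (s \<otimes> z) = M"
        using M(2)[of "col (s \<otimes> z)"] sub[OF S_carr[OF s(1)]] m_closed[OF S_carr[OF s(1)] z(1)]
        unfolding C_def by blast
      moreover have "a \<in> col (s \<otimes> z)"
        using s a z(1) m_lcomm[of s a z] by (simp add: memcol)
      ultimately show ?thesis by simp
    qed
  qed
  then have "primeideal {r \<in> carrier R. r \<otimes> z \<in> J} R" unfolding z(2) col_def .
  then show ?thesis using that[OF z(1)] z(3) unfolding col_def by blast
qed

section \<open>Primes with a valuation\<close>

text \<open>Says that \<open>\<pi>\<close> generates the maximal ideal of \<open>R\<^sub>Q\<close>, in terms of elements of \<open>R\<close>.\<close>

definition uniformizer :: "('a, 'b) ring_scheme \<Rightarrow> 'a set \<Rightarrow> 'a \<Rightarrow> bool" where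
  "uniformizer R Q \<pi> \<longleftrightarrow> \<pi> \<in> Q \<and> \<pi> \<noteq> \<zero>\<^bsub>R\<^esub> \<and>
     (\<forall>q\<in>Q. \<exists>w\<in>carrier R - Q. \<exists>b\<in>carrier R. w \<otimes>\<^bsub>R\<^esub> q = \<pi> \<otimes>\<^bsub>R\<^esub> b)"

text \<open>Says that \<open>x\<close> is a unit times \<open>\<pi>\<^sup>n\<close> in \<open>R\<^sub>Q\<close>, in terms of elements of \<open>R\<close>.\<close>

definition has_order :: "('a, 'b) ring_scheme \<Rightarrow> 'a set \<Rightarrow> 'a \<Rightarrow> 'a \<Rightarrow> nat \<Rightarrow> bool" where
  "has_order R Q \<pi> x n \<longleftrightarrow>
     (\<exists>s\<in>carrier R - Q. \<exists>t\<in>carrier R - Q. s \<otimes>\<^bsub>R\<^esub> x = t \<otimes>\<^bsub>R\<^esub> \<pi> [^]\<^bsub>R\<^esub> n)"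

lemma mem_cgenideal_iff: "x \<in> cgenideal R a \<longleftrightarrow> (\<exists>r\<in>carrier R. x = r \<otimes>\<^bsub>R\<^esub> a)"
  by (auto simp: cgenideal_def)

lemma (in cring) ideal_prod_principal:
  assumes a: "a \<in> carrier R" and b: "b \<in> carrier R"
  shows "ideal_prod R (PIdl a) (PIdl b) = PIdl (a \<otimes> b)"
proof
  have I: "ideal (PIdl (a \<otimes> b)) R" by (rule cgenideal_ideal) (use a b in simp)
  show "ideal_prod R (PIdl a) (PIdl b) \<subseteq> PIdl (a \<otimes> b)"
  proof
    fix x assume "x \<in> ideal_prod R (PIdl a) (PIdl b)"
    then show "x \<in> PIdl (a \<otimes> b)"
    proof (induction rule: ideal_prod.induct)
      case (prod i j)
      then obtain r s where rs: "r \<in> carrier R" "s \<in> carrier R" "i = r \<otimes> a" "j = s \<otimes> b"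
        unfolding mem_cgenideal_iff by blast
      then have "i \<otimes> j = (r \<otimes> s) \<otimes> (a \<otimes> b)" using a b by (simp add: m_ac)
      then show ?case unfolding mem_cgenideal_iff using m_closed[OF rs(1,2)] by blast
    next
      case (sum s1 s2)
      then show ?case
        using additive_subgroup.a_closed[OF ideal.axioms(1)[OF I]] by blast
    qed
  qed
  show "PIdl (a \<otimes> b) \<subseteq> ideal_prod R (PIdl a) (PIdl b)"
  proof
    fix x assume "x \<in> PIdl (a \<otimes> b)"
    then obtain r where r: "r \<in> carrier R" "x = r \<otimes> (a \<otimes> b)" unfolding mem_cgenideal_iff by blast
    have "r \<otimes> a \<in> PIdl a" using r unfolding mem_cgenideal_iff by blast
    then have "(r \<otimes> a) \<otimes> b \<in> ideal_prod R (PIdl a) (PIdl b)"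
      using cgenideal_self[OF b] by (rule ideal_prod.prod)
    then show "x \<in> ideal_prod R (PIdl a) (PIdl b)" using r a b by (simp add: m_assoc)
  qed
qed

lemma (in cring) ideal_power_principal:
  assumes a: "a \<in> carrier R"
  shows "ideal_power R (PIdl a) n = PIdl (a [^] n)"
proof (induction n)
  case 0
  have "x \<in> PIdl \<one>" if "x \<in> carrier R" for x
    using that r_one[OF that] unfolding mem_cgenideal_iff by metis
  moreover have "PIdl \<one> \<subseteq> carrier R" by (auto simp: mem_cgenideal_iff)
  ultimately show ?case using a by auto
next
  case (Suc n)
  then show ?case using a by (simp add: ideal_prod_principal m_comm)
qed

text \<open>The local ring at \<open>Q\<close> is a discrete valuation ring. Because everything is expressed by elements of
  \<open>R\<close>, the property passes to other localizations of \<open>R\<close> without a comparison of iterated rings of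
  fractions.\<close>

locale valuation_prime = domain R + primeideal Q R for R (structure) and Q +
  fixes \<pi>
  assumes uniformizer: "uniformizer R Q \<pi>"
    and order_exists: "\<lbrakk>x \<in> carrier R; x \<noteq> \<zero>\<rbrakk> \<Longrightarrow> \<exists>n. has_order R Q \<pi> x n"
begin

abbreviation ord :: "'a \<Rightarrow> nat" where
  "ord \<equiv> order_along R Q"

lemma \<pi>_mem: "\<pi> \<in> Q" and \<pi>_nonzero: "\<pi> \<noteq> \<zero>" and \<pi>_carr [simp]: "\<pi> \<in> carrier R"
  using uniformizer Icarr by (auto simp: uniformizer_def)

lemma compl_mult: "\<lbrakk>s \<in> carrier R - Q; t \<in> carrier R - Q\<rbrakk> \<Longrightarrow> s \<otimes> t \<in> carrier R - Q"
  using I_prime by auto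

lemma one_compl: "\<one> \<in> carrier R - Q"
  using one_imp_carrier I_notcarr by auto

lemma \<pi>_pow_nonzero: "\<pi> [^] (n::nat) \<noteq> \<zero>"
  using \<pi>_nonzero by (induction n) (auto simp: integral_iff)

lemma \<pi>_pow_mem: "0 < n \<Longrightarrow> \<pi> [^] (n::nat) \<in> Q"
  using \<pi>_mem by (cases n) (auto intro: I_l_closed)

lemma local_max_ideal_principal:
  "local_max_ideal R Q = PIdl\<^bsub>local_ring_at R Q\<^esub> (to_local R Q \<pi>)"
proof -
  interpret F: fractions R "carrier R - Q" by (rule fractions_prime_complement) (rule primeideal)
  interpret L: cring F.L by (rule F.cring_localization)
  have eq: "local_max_ideal R Q = F.ext_ideal Q"
    using F.genideal_base_image[OF is_ideal]
    by (simp add: local_max_ideal_def local_ring_at_def to_local_def[abs_def])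
  have 1: "F.frac \<pi> \<one> \<in> carrier F.L" using F.S_one by auto
  have "F.ext_ideal Q \<subseteq> PIdl\<^bsub>F.L\<^esub> (F.frac \<pi> \<one>)"
  proof
    fix U assume "U \<in> F.ext_ideal Q"
    then obtain q s where q: "q \<in> Q" "s \<in> carrier R - Q" "U = F.frac q s"
      by (auto simp: F.ext_ideal_def)
    then obtain w b where w: "w \<in> carrier R - Q" "b \<in> carrier R" "w \<otimes> q = \<pi> \<otimes> b"
      using uniformizer unfolding uniformizer_def by blast
    have "U = F.frac b (w \<otimes> s) \<otimes>\<^bsub>F.L\<^esub> F.frac \<pi> \<one>"
    proof -
      have "F.frac q s = F.frac (b \<otimes> \<pi>) (w \<otimes> s \<otimes> \<one>)"
      proof (rule F.frac_eqI)
        have c: "w \<in> carrier R" "s \<in> carrier R" "q \<in> carrier R" using w q Icarr by auto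
        have "(w \<otimes> s \<otimes> \<one>) \<otimes> q = s \<otimes> (w \<otimes> q)" using c by (simp add: m_ac)
        then show "(w \<otimes> s \<otimes> \<one>) \<otimes> q = s \<otimes> (b \<otimes> \<pi>)" using c w by (simp add: m_comm)
      qed (use q w Icarr F.S_mult[of w s] F.S_one in auto)
      then show ?thesis using q w F.S_mult F.S_one by (simp add: F.mult_frac)
    qed
    then show "U \<in> PIdl\<^bsub>F.L\<^esub> (F.frac \<pi> \<one>)"
      unfolding mem_cgenideal_iff
      by (rule bexI[where x = "F.frac b (w \<otimes> s)"])
        (use w(2) F.S_mult[OF w(1) q(2)] in \<open>rule F.frac_closed\<close>)
  qed
  moreover have "PIdl\<^bsub>F.L\<^esub> (F.frac \<pi> \<one>) \<subseteq> F.ext_ideal Q"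
    using F.ideal_ext_ideal[OF is_ideal] \<pi>_mem F.S_one
    by (intro L.cgenideal_minimal) (auto simp: F.ext_ideal_def)
  ultimately show ?thesis
    unfolding eq by (simp add: local_ring_at_def to_local_def)
qed

text \<open>The \<open>m\<close>-th power of the maximal ideal is generated by \<open>\<pi>\<^sup>m\<close>. If \<open>x\<close> has order \<open>n\<close> and were a multiple
  of \<open>\<pi>\<^sup>m\<close> with \<open>m > n\<close>, cancellation of \<open>\<pi>\<^sup>n\<close> would put a product of elements outside \<open>Q\<close> into \<open>Q\<close>.\<close>

lemma local_power_mem_iff:
  assumes x: "x \<in> carrier R" "x \<noteq> \<zero>" and n: "has_order R Q \<pi> x n"
  shows "to_local R Q x \<in> ideal_power (local_ring_at R Q) (local_max_ideal R Q) m \<longleftrightarrow> m \<le> n"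
proof -
  interpret F: fractions R "carrier R - Q" by (rule fractions_prime_complement) (rule primeideal)
  interpret L: cring F.L by (rule F.cring_localization)
  have Q0: "\<zero> \<notin> carrier R - Q" by simp
  obtain s t where s: "s \<in> carrier R - Q" "t \<in> carrier R - Q" and st: "s \<otimes> x = t \<otimes> \<pi> [^] n"
    using n by (auto simp: has_order_def)
  have sc: "s \<in> carrier R" "t \<in> carrier R" using s by auto
  have pow: "F.frac \<pi> \<one> [^]\<^bsub>F.L\<^esub> m = F.frac (\<pi> [^] m) \<one>"
    by (induction m) (use F.S_one in \<open>simp_all add: F.one_frac F.mult_frac\<close>)
  have \<pi>L: "F.frac \<pi> \<one> \<in> carrier F.L" using F.S_one by auto
  have "to_local R Q x \<in> ideal_power (local_ring_at R Q) (local_max_ideal R Q) m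
      \<longleftrightarrow> F.frac x \<one> \<in> PIdl\<^bsub>F.L\<^esub> (F.frac (\<pi> [^] m) \<one>)"
    unfolding local_max_ideal_principal local_ring_at_def to_local_def
      L.ideal_power_principal[OF \<pi>L] pow ..
  also have "\<dots> \<longleftrightarrow> m \<le> n"
  proof
    assume "F.frac x \<one> \<in> PIdl\<^bsub>F.L\<^esub> (F.frac (\<pi> [^] m) \<one>)"
    then obtain U where U: "U \<in> carrier F.L" "F.frac x \<one> = U \<otimes>\<^bsub>F.L\<^esub> F.frac (\<pi> [^] m) \<one>"
      unfolding mem_cgenideal_iff by blast
    obtain a u where a: "a \<in> carrier R" "u \<in> carrier R - Q" "U = F.frac a u"
      using U(1) by (rule F.frac_cases)
    have "F.frac x \<one> = F.frac (a \<otimes> \<pi> [^] m) u"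
      using U(2) a F.S_one by (simp add: F.mult_frac)
    then have ux: "u \<otimes> x = a \<otimes> \<pi> [^] m"
      using F.frac_eq_domain[OF domain_axioms Q0] x a F.S_one by auto
    show "m \<le> n"
    proof (rule ccontr)
      assume "\<not> m \<le> n"
      then obtain k where k: "m = n + k" "0 < k" by (metis less_imp_add_positive not_le)
      have uc: "u \<in> carrier R" using a by auto
      have "\<pi> [^] n \<otimes> (u \<otimes> t) = u \<otimes> (t \<otimes> \<pi> [^] n)" using uc sc by (simp add: m_ac)
      also have "\<dots> = s \<otimes> (u \<otimes> x)" using uc sc x by (simp add: st[symmetric] m_ac)
      also have "\<dots> = \<pi> [^] n \<otimes> (s \<otimes> a \<otimes> \<pi> [^] k)"
        using uc sc a unfolding ux k by (simp add: nat_pow_mult[symmetric] m_ac)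
      finally have "u \<otimes> t = s \<otimes> a \<otimes> \<pi> [^] k"
        using \<pi>_pow_nonzero[of n] uc sc a m_lcancel[of "\<pi> [^] n" "u \<otimes> t" "s \<otimes> a \<otimes> \<pi> [^] k"] by auto
      then have "u \<otimes> t \<in> Q" using \<pi>_pow_mem[OF k(2)] sc a by (simp add: I_l_closed)
      then show False using compl_mult[OF a(2) s(2)] by simp
    qed
  next
    assume "m \<le> n"
    then obtain k where k: "n = k + m" using le_iff_add add.commute by metis
    have "F.frac x \<one> = F.frac (t \<otimes> \<pi> [^] k \<otimes> \<pi> [^] m) s"
    proof (rule F.frac_eqI)
      show "s \<otimes> x = \<one> \<otimes> (t \<otimes> \<pi> [^] k \<otimes> \<pi> [^] m)"
        unfolding st k using sc by (simp add: nat_pow_mult[symmetric] m_assoc)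
    qed (use s x sc F.S_one in auto)
    also have "\<dots> = F.frac (t \<otimes> \<pi> [^] k) s \<otimes>\<^bsub>F.L\<^esub> F.frac (\<pi> [^] m) \<one>"
      using s sc F.S_one by (simp add: F.mult_frac)
    finally show "F.frac x \<one> \<in> PIdl\<^bsub>F.L\<^esub> (F.frac (\<pi> [^] m) \<one>)"
      unfolding mem_cgenideal_iff
      by (rule bexI[where x = "F.frac (t \<otimes> \<pi> [^] k) s"]) (use s sc in auto)
  qed
  finally show ?thesis .
qed

lemma order_eq:
  assumes "x \<in> carrier R" "x \<noteq> \<zero>" "has_order R Q \<pi> x n"
  shows "ord x = n"
  unfolding order_along_def using local_power_mem_iff[OF assms] by (intro Greatest_equality) auto

lemma order_unit_mult:
  assumes "x \<in> carrier R" "x \<noteq> \<zero>"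
  obtains s t where "s \<in> carrier R - Q" "t \<in> carrier R - Q" "s \<otimes> x = t \<otimes> \<pi> [^] ord x"
proof -
  obtain n where n: "has_order R Q \<pi> x n" using order_exists[OF assms] by blast
  then show ?thesis using that order_eq[OF assms n] unfolding has_order_def by blast
qed

lemma ord_mult:
  assumes x: "x \<in> carrier R" "x \<noteq> \<zero>" and y: "y \<in> carrier R" "y \<noteq> \<zero>"
  shows "ord (x \<otimes> y) = ord x + ord y"
proof (rule order_eq)
  obtain s t where s: "s \<in> carrier R - Q" "t \<in> carrier R - Q" "s \<otimes> x = t \<otimes> \<pi> [^] ord x"
    using order_unit_mult[OF x] .
  obtain u v where u: "u \<in> carrier R - Q" "v \<in> carrier R - Q" "u \<otimes> y = v \<otimes> \<pi> [^] ord y"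
    using order_unit_mult[OF y] .
  have c: "s \<in> carrier R" "t \<in> carrier R" "u \<in> carrier R" "v \<in> carrier R" using s u by auto
  have "(s \<otimes> u) \<otimes> (x \<otimes> y) = (s \<otimes> x) \<otimes> (u \<otimes> y)"
    using c x(1) y(1) by (simp add: m_ac)
  also have "\<dots> = (t \<otimes> v) \<otimes> (\<pi> [^] (ord x + ord y))"
    unfolding s(3) u(3) using c by (simp add: nat_pow_mult[symmetric] m_ac)
  finally show "has_order R Q \<pi> (x \<otimes> y) (ord x + ord y)"
    unfolding has_order_def using compl_mult s u by blast
qed (use x y in \<open>auto simp: integral_iff\<close>)

lemma ord_pos_iff:
  assumes x: "x \<in> carrier R" "x \<noteq> \<zero>"
  shows "0 < ord x \<longleftrightarrow> x \<in> Q"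
proof -
  obtain s t where s: "s \<in> carrier R - Q" "t \<in> carrier R - Q" "s \<otimes> x = t \<otimes> \<pi> [^] ord x"
    using order_unit_mult[OF x] .
  show ?thesis
  proof
    assume "0 < ord x"
    then have "s \<otimes> x \<in> Q" using s \<pi>_pow_mem[of "ord x"] by (auto intro: I_l_closed)
    then show "x \<in> Q" using I_prime[of s x] s x by auto
  next
    assume "x \<in> Q"
    then have "t \<otimes> \<pi> [^] ord x \<in> Q" using s by (metis DiffE I_l_closed)
    then show "0 < ord x" using s by (cases "ord x") auto
  qed
qed

text \<open>After multiplication with units of \<open>R\<^sub>Q\<close>, the power \<open>\<pi>\<^sup>n\<close> is a common factor of both summands; the
  cofactor \<open>c\<close> of the sum has an order of its own.\<close>

lemma ord_add:
  assumes x: "x \<in> carrier R" "x \<noteq> \<zero>" and y: "y \<in> carrier R" "y \<noteq> \<zero>" and xy: "x \<oplus> y \<noteq> \<zero>"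
    and n: "n \<le> ord x" "n \<le> ord y"
  shows "n \<le> ord (x \<oplus> y)"
proof -
  obtain s t where s: "s \<in> carrier R - Q" "t \<in> carrier R - Q" "s \<otimes> x = t \<otimes> \<pi> [^] ord x"
    using order_unit_mult[OF x] .
  obtain u v where u: "u \<in> carrier R - Q" "v \<in> carrier R - Q" "u \<otimes> y = v \<otimes> \<pi> [^] ord y"
    using order_unit_mult[OF y] .
  obtain k l where k: "ord x = n + k" "ord y = n + l" using n by (auto simp: le_iff_add)
  have sc: "s \<in> carrier R" "t \<in> carrier R" "u \<in> carrier R" "v \<in> carrier R" using s u by auto
  define c where "c = u \<otimes> t \<otimes> \<pi> [^] k \<oplus> s \<otimes> v \<otimes> \<pi> [^] l"
  have cc: "c \<in> carrier R" using sc by (simp add: c_def)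
  have "(s \<otimes> u) \<otimes> (x \<oplus> y) = u \<otimes> (s \<otimes> x) \<oplus> s \<otimes> (u \<otimes> y)"
    using sc x(1) y(1) by (simp add: m_ac r_distr)
  also have "\<dots> = c \<otimes> \<pi> [^] n"
    unfolding s(3) u(3) k c_def using sc by (simp add: nat_pow_mult[symmetric] m_ac l_distr r_distr)
  finally have eq: "(s \<otimes> u) \<otimes> (x \<oplus> y) = c \<otimes> \<pi> [^] n" .
  have su: "s \<otimes> u \<in> carrier R - Q" using compl_mult s u by blast
  have "c \<noteq> \<zero>"
  proof
    assume "c = \<zero>"
    then have "(s \<otimes> u) \<otimes> (x \<oplus> y) = \<zero>" using eq by simp
    then show False using su xy x y sc by (auto simp: integral_iff)
  qed
  then obtain a b where a: "a \<in> carrier R - Q" "b \<in> carrier R - Q" "a \<otimes> c = b \<otimes> \<pi> [^] ord c"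
    using order_unit_mult[OF cc] by blast
  have ac: "a \<in> carrier R" "b \<in> carrier R" using a by auto
  have "(a \<otimes> (s \<otimes> u)) \<otimes> (x \<oplus> y) = (a \<otimes> c) \<otimes> \<pi> [^] n"
    using eq ac sc cc x(1) y(1) by (simp add: m_assoc)
  also have "\<dots> = b \<otimes> \<pi> [^] (ord c + n)"
    unfolding a(3) using ac by (simp add: nat_pow_mult[symmetric] m_assoc)
  finally have "has_order R Q \<pi> (x \<oplus> y) (ord c + n)"
    unfolding has_order_def using compl_mult[OF a(1) su] a(2) by blast
  then have "ord (x \<oplus> y) = ord c + n" using x y xy by (intro order_eq) auto
  then show ?thesis by simp
qed

lemma divisor_valuation_eq:
  assumes x: "x \<in> carrier R" "x \<noteq> \<zero>" and y: "y \<in> carrier R" "y \<noteq> \<zero>"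
  shows "divisor_valuation R Q (loc_frac R (nonzerodivisors R) x y) = int (ord x) - int (ord y)"
proof -
  interpret K: fractions R "nonzerodivisors R" by (rule fractions_nonzerodivisors)
  have "k = int (ord x) - int (ord y)"
    if hyp: "\<exists>x'\<in>carrier R - {\<zero>}. \<exists>y'\<in>carrier R - {\<zero>}. K.frac x y = K.frac x' y'
      \<and> k = int (ord x') - int (ord y')" for k
  proof -
    obtain x' y' where *: "x' \<in> carrier R" "x' \<noteq> \<zero>" "y' \<in> carrier R" "y' \<noteq> \<zero>"
      "K.frac x y = K.frac x' y'" "k = int (ord x') - int (ord y')"
      using hyp by auto
    then have "y' \<otimes> x = y \<otimes> x'"
      using x y K.frac_eq_domain[OF domain_axioms, of x y x' y'] by (simp add: nonzerodivisors_domain)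
    then have "ord y' + ord x = ord y + ord x'"
      using * x y ord_mult[of y' x] ord_mult[of y x'] by simp
    then show ?thesis using *(6) by simp
  qed
  then show ?thesis
    unfolding divisor_valuation_def using x y by (intro the_equality) blast+
qed

end

section \<open>Height one primes of normal noetherian domains\<close>

context noetherian_domain
begin

text \<open>If \<open>y\<close> has no order then \<open>y \<in> Q\<close>, and up to a unit of \<open>R\<^sub>Q\<close> it is \<open>\<pi>\<close> times some \<open>b\<close>, which has no order
  either. The ideal \<open>bR\<^sub>Q \<inter> R\<close> is strictly larger than \<open>yR\<^sub>Q \<inter> R\<close> since \<open>\<pi>\<close> is not a unit, which is
  impossible if \<open>y\<close> was chosen with \<open>yR\<^sub>Q \<inter> R\<close> maximal.\<close>

lemma uniformizer_order_exists:
  assumes Q: "primeideal Q R" and u: "uniformizer R Q \<pi>"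
    and x: "x \<in> carrier R" "x \<noteq> \<zero>"
  shows "\<exists>n. has_order R Q \<pi> x n"
proof (rule ccontr)
  interpret Q: primeideal Q R by fact
  have one: "\<one> \<in> carrier R - Q" using Q.one_imp_carrier Q.I_notcarr by auto
  have mult: "s \<otimes> t \<in> carrier R - Q" if "s \<in> carrier R - Q" "t \<in> carrier R - Q" for s t
    using that Q.I_prime by auto
  have \<pi>: "\<pi> \<in> carrier R" "\<pi> \<in> Q" using u Q.Icarr by (auto simp: uniformizer_def)
  \<comment> \<open>The ideal \<open>yR\<^sub>Q \<inter> R\<close>.\<close>
  define I where "I y = {r \<in> carrier R. \<exists>s\<in>carrier R - Q. \<exists>a\<in>carrier R. s \<otimes> r = a \<otimes> y}" for y
  have I_ideal: "ideal (I y) R" if y: "y \<in> carrier R" for y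
  proof (rule idealI_mult_closed)
    show "I y \<subseteq> carrier R" by (auto simp: I_def)
    have "\<one> \<otimes> \<zero> = \<zero> \<otimes> y" using y by simp
    then show "I y \<noteq> {}" using one unfolding I_def by blast
  next
    fix r r' assume "r \<in> I y" "r' \<in> I y"
    then obtain s a s' a' where r: "r \<in> carrier R" "s \<in> carrier R - Q" "a \<in> carrier R" "s \<otimes> r = a \<otimes> y"
      and r': "r' \<in> carrier R" "s' \<in> carrier R - Q" "a' \<in> carrier R" "s' \<otimes> r' = a' \<otimes> y"
      unfolding I_def by blast
    have sc: "s \<in> carrier R" "s' \<in> carrier R" using r r' by auto
    have "(s \<otimes> s') \<otimes> (r \<oplus> r') = s' \<otimes> (s \<otimes> r) \<oplus> s \<otimes> (s' \<otimes> r')"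
      using sc r(1) r'(1) by (simp add: m_ac r_distr)
    also have "\<dots> = (s' \<otimes> a \<oplus> s \<otimes> a') \<otimes> y"
      unfolding r(4) r'(4) using sc r(3) r'(3) y by (simp add: m_ac l_distr r_distr)
    finally have "(s \<otimes> s') \<otimes> (r \<oplus> r') = (s' \<otimes> a \<oplus> s \<otimes> a') \<otimes> y" .
    moreover have "s' \<otimes> a \<oplus> s \<otimes> a' \<in> carrier R" using sc r r' by simp
    ultimately show "r \<oplus> r' \<in> I y"
      using mult[OF r(2) r'(2)] a_closed[OF r(1) r'(1)] unfolding I_def by blast
  next
    fix b r assume b: "b \<in> carrier R" and "r \<in> I y"
    then obtain s a where r: "r \<in> carrier R" "s \<in> carrier R - Q" "a \<in> carrier R" "s \<otimes> r = a \<otimes> y"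
      unfolding I_def by blast
    have sc: "s \<in> carrier R" using r by auto
    have "s \<otimes> (b \<otimes> r) = b \<otimes> (s \<otimes> r)" using sc r(1) b by (rule_tac m_lcomm)
    also have "\<dots> = (b \<otimes> a) \<otimes> y" unfolding r(4) using r(3) y b by (simp add: m_assoc)
    finally show "b \<otimes> r \<in> I y"
      using m_closed[OF b r(1)] m_closed[OF b r(3)] r(2) unfolding I_def by blast
  qed
  have I_self: "y \<in> I y" if "y \<in> carrier R" for y
  proof -
    have "\<one> \<otimes> y = \<one> \<otimes> y" ..
    then show ?thesis using that one unfolding I_def by blast
  qed
  define C where "C = {I y | y. y \<in> carrier R \<and> y \<noteq> \<zero> \<and> (\<nexists>n. has_order R Q \<pi> y n)}"
  assume "\<nexists>n. has_order R Q \<pi> x n"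
  then have "C \<noteq> {}" using x unfolding C_def by blast
  moreover have "ideal J R" if "J \<in> C" for J using that I_ideal unfolding C_def by blast
  ultimately obtain M where M: "M \<in> C" "\<And>J. \<lbrakk>J \<in> C; M \<subseteq> J\<rbrakk> \<Longrightarrow> J = M"
    using maximal_ideal_in_family by metis
  then obtain y where y: "y \<in> carrier R" "y \<noteq> \<zero>" "\<nexists>n. has_order R Q \<pi> y n" "M = I y"
    unfolding C_def by blast
  have "y \<in> Q"
  proof (rule ccontr)
    assume "y \<notin> Q"
    then have "\<one> \<otimes> y = y \<otimes> \<pi> [^] (0::nat)" "y \<in> carrier R - Q" using y by auto
    then have "has_order R Q \<pi> y 0" unfolding has_order_def using one by blast
    then show False using y(3) by blast
  qed
  then obtain w b where w: "w \<in> carrier R - Q" "b \<in> carrier R" "w \<otimes> y = \<pi> \<otimes> b"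
    using u unfolding uniformizer_def by blast
  have wc: "w \<in> carrier R" "w \<noteq> \<zero>" using w Q.zero_closed by auto
  have b0: "b \<noteq> \<zero>"
  proof
    assume "b = \<zero>"
    then have "w \<otimes> y = \<zero>" using w(3) \<pi> by simp
    then show False using wc y by (simp add: integral_iff)
  qed
  have "\<not> has_order R Q \<pi> b n" for n
  proof
    assume "has_order R Q \<pi> b n"
    then obtain s t where s: "s \<in> carrier R - Q" "t \<in> carrier R - Q" "s \<otimes> b = t \<otimes> \<pi> [^] n"
      unfolding has_order_def by blast
    have sc: "s \<in> carrier R" "t \<in> carrier R" using s by auto
    have "(s \<otimes> w) \<otimes> y = s \<otimes> (\<pi> \<otimes> b)" using sc wc y(1) by (simp add: m_assoc flip: w(3))
    also have "\<dots> = \<pi> \<otimes> (s \<otimes> b)" using sc \<pi> w(2) by (simp add: m_lcomm)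
    also have "\<dots> = t \<otimes> \<pi> [^] Suc n" unfolding s(3) using sc \<pi> by (simp add: m_ac)
    finally have "has_order R Q \<pi> y (Suc n)"
      unfolding has_order_def using mult[OF s(1) w(1)] s(2) by blast
    then show False using y(3) by blast
  qed
  then have "I b \<in> C" unfolding C_def using w(2) b0 by blast
  moreover have "I y \<subseteq> I b"
  proof
    fix r assume "r \<in> I y"
    then obtain s a where r: "r \<in> carrier R" "s \<in> carrier R - Q" "a \<in> carrier R" "s \<otimes> r = a \<otimes> y"
      unfolding I_def by blast
    have sc: "s \<in> carrier R" using r by auto
    have "(w \<otimes> s) \<otimes> r = w \<otimes> (a \<otimes> y)" using wc sc r(1) by (simp add: m_assoc flip: r(4))
    also have "\<dots> = a \<otimes> (w \<otimes> y)" using wc r(3) y(1) by (simp add: m_lcomm)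
    also have "\<dots> = (a \<otimes> \<pi>) \<otimes> b" unfolding w(3) using r(3) \<pi> w(2) by (simp add: m_assoc)
    finally show "r \<in> I b"
      using r(1) mult[OF w(1) r(2)] m_closed[OF r(3) \<pi>(1)] unfolding I_def by blast
  qed
  ultimately have "I b = I y" using M(2)[of "I b"] y(4) by blast
  then have "b \<in> I y" using I_self[OF w(2)] by blast
  then obtain s a where r: "s \<in> carrier R - Q" "a \<in> carrier R" "s \<otimes> b = a \<otimes> y"
    unfolding I_def by blast
  have sc: "s \<in> carrier R" using r by auto
  have "y \<otimes> (s \<otimes> w) = s \<otimes> (\<pi> \<otimes> b)" using sc wc y(1) by (simp add: m_ac flip: w(3))
  also have "\<dots> = \<pi> \<otimes> (s \<otimes> b)" using sc \<pi> w(2) by (simp add: m_lcomm)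
  also have "\<dots> = y \<otimes> (\<pi> \<otimes> a)" unfolding r(3) using r(2) \<pi> y(1) by (simp add: m_ac)
  finally have "s \<otimes> w = \<pi> \<otimes> a"
    using m_lcancel[OF y(2) y(1), of "s \<otimes> w" "\<pi> \<otimes> a"] sc wc \<pi> r(2) by simp
  then have "s \<otimes> w \<in> Q" using Q.I_r_closed[OF \<pi>(2) r(2)] by simp
  then show False using mult[OF r(1) w(1)] by blast
qed

lemma valuation_primeI:
  assumes "primeideal Q R" "uniformizer R Q \<pi>"
  shows "valuation_prime R Q \<pi>"
proof -
  interpret Q: primeideal Q R by fact
  show ?thesis
    by unfold_locales (use assms uniformizer_order_exists in auto)
qed

end

text \<open>A nonzero prime inside \<open>Q\<close> contains a power of \<open>\<pi>\<close>, hence \<open>\<pi>\<close>, hence all of \<open>Q\<close>.\<close>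

lemma (in valuation_prime) height_one: "height_one R Q"
  unfolding height_one_def
proof (intro conjI allI impI)
  show "primeideal Q R" by (rule primeideal)
  show "Q \<noteq> {\<zero>}" using \<pi>_mem \<pi>_nonzero by auto
  fix Q' assume "primeideal Q' R \<and> Q' \<subseteq> Q"
  then interpret Q': primeideal Q' R by simp
  have sub: "Q' \<subseteq> Q" by (rule conjunct2) fact
  show "Q' = {\<zero>} \<or> Q' = Q"
  proof (rule disjCI)
    assume "Q' \<noteq> Q"
    show "Q' = {\<zero>}"
    proof (rule ccontr)
      assume "Q' \<noteq> {\<zero>}"
      then obtain x where x: "x \<in> Q'" "x \<noteq> \<zero>" using Q'.zero_closed by blast
      have xc: "x \<in> carrier R" using x Q'.Icarr by blast
      obtain s t where s: "s \<in> carrier R - Q" "t \<in> carrier R - Q" "s \<otimes> x = t \<otimes> \<pi> [^] ord x"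
        using order_unit_mult[OF xc x(2)] .
      have "t \<otimes> \<pi> [^] ord x \<in> Q'" using s x Q'.I_l_closed by (metis DiffE)
      then have pow: "\<pi> [^] ord x \<in> Q'" using Q'.I_prime[of t "\<pi> [^] ord x"] s sub by auto
      have pi: "\<pi> \<in> Q'" if "\<pi> [^] n \<in> Q'" for n :: nat
        using that
      proof (induction n)
        case 0 then show ?case using Q'.one_imp_carrier Q'.I_notcarr by simp
      next
        case (Suc n) then show ?case using Q'.I_prime[of "\<pi> [^] n" \<pi>] by auto
      qed
      have "q \<in> Q'" if q: "q \<in> Q" for q
      proof -
        obtain w b where w: "w \<in> carrier R - Q" "b \<in> carrier R" "w \<otimes> q = \<pi> \<otimes> b"
          using uniformizer q unfolding uniformizer_def by blast
        then have "w \<otimes> q \<in> Q'" using Q'.I_r_closed[OF pi[OF pow] w(2)] by simp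
        then show ?thesis using Q'.I_prime[of w q] w q sub Icarr by auto
      qed
      then show False using sub \<open>Q' \<noteq> Q\<close> by blast
    qed
  qed
qed

text \<open>Let \<open>z = x/y\<close>. The hypotheses say \<open>zQ \<subseteq> Q\<close>, so \<open>z\<^sup>n y \<in> Q \<subseteq> R\<close> for all \<open>n\<close>. The elements of \<open>R\<close> that are \<open>y\<close>
  times a polynomial in \<open>z\<close> of degree less than \<open>n\<close> form an ideal; these ideals increase with \<open>n\<close> and
  become stationary, say at \<open>N\<close>. Then \<open>z\<^sup>N y\<close> is \<open>y\<close> times a polynomial of degree less than \<open>N\<close>, and
  cancellation of \<open>y\<close> leaves an integral equation.\<close>

lemma (in noetherian_domain) stable_fraction_integral:
  assumes y: "y \<in> Q" "y \<noteq> \<zero>" and Q: "Q \<subseteq> carrier R" and x: "x \<in> carrier R"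
    and stable: "\<And>q. q \<in> Q \<Longrightarrow> \<exists>w\<in>Q. q \<otimes> x = y \<otimes> w"
  shows "integral_over_base R (loc_frac R (nonzerodivisors R) x y)"
proof -
  interpret K: fractions R "nonzerodivisors R" by (rule fractions_nonzerodivisors)
  have cR: "y \<in> carrier R" using y Q by auto
  have zd: "\<zero> \<notin> nonzerodivisors R" by (simp add: nonzerodivisors_domain)
  have ynz: "y \<in> nonzerodivisors R" using y cR by (simp add: nonzerodivisors_domain)
  interpret KD: domain K.L by (rule K.domain_localization[OF domain_axioms zd])
  define j where "j = to_frac R"
  have j_frac: "j r = K.frac r \<one>" for r by (simp add: j_def to_frac_def)
  have j_hom: "j \<in> ring_hom R K.L" using K.base_hom by (simp add: j_frac[abs_def])
  note jc = ring_hom_closed[OF j_hom] and ja = ring_hom_add[OF j_hom] and jm = ring_hom_mult[OF j_hom]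
    and j1 = ring_hom_one[OF j_hom] and j0 = ring_hom_zero[OF j_hom ring_axioms KD.ring_axioms]
  define z where "z = K.frac x y"
  have zc: "z \<in> carrier K.L" using x ynz by (simp add: z_def)
  \<comment> \<open>The value at \<open>z\<close> of the polynomial with coefficient list \<open>cs\<close>, leading coefficient first.\<close>
  define ev where "ev cs = KD.eval (map j cs) z" for cs
  have ev_Nil: "ev [] = \<zero>\<^bsub>K.L\<^esub>" by (simp add: ev_def)
  have ev_Cons: "ev (c # cs) = j c \<otimes>\<^bsub>K.L\<^esub> z [^]\<^bsub>K.L\<^esub> length cs \<oplus>\<^bsub>K.L\<^esub> ev cs" for c cs
    by (simp add: ev_def)
  have ev_closed: "ev cs \<in> carrier K.L" if "set cs \<subseteq> carrier R" for cs
    using that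
  proof (induction cs)
    case (Cons c cs)
    then show ?case using zc jc[of c] by (simp add: ev_Cons)
  qed (simp add: ev_Nil)
  have ev_add: "ev (map2 (\<oplus>) cs ds) = ev cs \<oplus>\<^bsub>K.L\<^esub> ev ds"
    if "length cs = length ds" "set cs \<subseteq> carrier R" "set ds \<subseteq> carrier R" for cs ds
    using that
  proof (induction cs ds rule: list_induct2)
    case (Cons c cs d ds)
    then show ?case
      using zc jc[of c] jc[of d] ev_closed[of cs] ev_closed[of ds]
      by (simp add: ev_Cons ja KD.l_distr KD.a_ac)
  qed (simp add: ev_Nil)
  have ev_mult: "ev (map ((\<otimes>) a) cs) = j a \<otimes>\<^bsub>K.L\<^esub> ev cs" if "a \<in> carrier R" "set cs \<subseteq> carrier R" for a cs
    using that
  proof (induction cs)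
    case (Cons c cs)
    then show ?case
      using zc jc[of a] jc[of c] ev_closed[of cs] by (simp add: ev_Cons jm KD.r_distr KD.m_assoc)
  qed (simp add: ev_Nil jc)
  have ev_zero: "ev (replicate n \<zero>) = \<zero>\<^bsub>K.L\<^esub>" for n
    by (induction n) (use zc in \<open>simp_all add: ev_Nil ev_Cons j0\<close>)
  define T where "T n = {r \<in> carrier R. \<exists>cs. length cs = n \<and> set cs \<subseteq> carrier R \<and> j r = ev cs \<otimes>\<^bsub>K.L\<^esub> j y}" for n
  have T_mult: "a \<otimes> r \<in> T n" if a: "a \<in> carrier R" and r: "r \<in> T n" for a r n
  proof -
    obtain cs where cs: "r \<in> carrier R" "length cs = n" "set cs \<subseteq> carrier R" "j r = ev cs \<otimes>\<^bsub>K.L\<^esub> j y"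
      using r unfolding T_def by blast
    have "j (a \<otimes> r) = ev (map ((\<otimes>) a) cs) \<otimes>\<^bsub>K.L\<^esub> j y"
      using a cs ev_closed[OF cs(3)] jc[OF a] jc[OF cR] by (simp add: jm ev_mult KD.m_assoc)
    moreover have "length (map ((\<otimes>) a) cs) = n" "set (map ((\<otimes>) a) cs) \<subseteq> carrier R" "a \<otimes> r \<in> carrier R"
      using a cs by auto
    ultimately show ?thesis unfolding T_def by blast
  qed
  have T_ideal: "ideal (T n) R" for n
  proof (rule idealI_mult_closed)
      show "T n \<subseteq> carrier R" by (auto simp: T_def)
      have "j \<zero> = ev (replicate n \<zero>) \<otimes>\<^bsub>K.L\<^esub> j y" using jc[OF cR] by (simp add: ev_zero j0)
      moreover have "length (replicate n \<zero>) = n" "set (replicate n \<zero>) \<subseteq> carrier R" by auto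
      ultimately show "T n \<noteq> {}" unfolding T_def by blast
    next
      fix r r' assume "r \<in> T n" "r' \<in> T n"
      then obtain cs ds where cs: "r \<in> carrier R" "length cs = n" "set cs \<subseteq> carrier R" "j r = ev cs \<otimes>\<^bsub>K.L\<^esub> j y"
        and ds: "r' \<in> carrier R" "length ds = n" "set ds \<subseteq> carrier R" "j r' = ev ds \<otimes>\<^bsub>K.L\<^esub> j y"
        unfolding T_def by blast
      have "j (r \<oplus> r') = ev (map2 (\<oplus>) cs ds) \<otimes>\<^bsub>K.L\<^esub> j y"
        using cs ds ev_closed[OF cs(3)] ev_closed[OF ds(3)] jc[OF cR] by (simp add: ja ev_add KD.l_distr)
      moreover have "length (map2 (\<oplus>) cs ds) = n" "r \<oplus> r' \<in> carrier R"
        using cs ds by auto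
      moreover have "set (map2 (\<oplus>) cs ds) \<subseteq> carrier R"
      proof
        fix e assume "e \<in> set (map2 (\<oplus>) cs ds)"
        then obtain a b where ab: "(a, b) \<in> set (zip cs ds)" "e = a \<oplus> b" by auto
        then show "e \<in> carrier R"
          using set_zip_leftD[OF ab(1)] set_zip_rightD[OF ab(1)] cs(3) ds(3) by auto
      qed
      ultimately show "r \<oplus> r' \<in> T n" unfolding T_def by blast
  qed (rule T_mult)
  have T_mono: "T n \<subseteq> T (Suc n)" for n
  proof
    fix r assume "r \<in> T n"
    then obtain cs where cs: "r \<in> carrier R" "length cs = n" "set cs \<subseteq> carrier R" "j r = ev cs \<otimes>\<^bsub>K.L\<^esub> j y"
      unfolding T_def by blast
    have "j r = ev (\<zero> # cs) \<otimes>\<^bsub>K.L\<^esub> j y" using cs zc ev_closed[OF cs(3)] by (simp add: ev_Cons j0)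
    moreover have "length (\<zero> # cs) = Suc n" "set (\<zero> # cs) \<subseteq> carrier R" using cs by auto
    ultimately show "r \<in> T (Suc n)" using cs(1) unfolding T_def by blast
  qed
  have pow: "\<exists>a\<in>Q. j a = z [^]\<^bsub>K.L\<^esub> n \<otimes>\<^bsub>K.L\<^esub> j y" for n :: nat
  proof (induction n)
    case 0
    then show ?case using y(1) jc[OF cR] by (intro bexI[of _ y]) simp_all
  next
    case (Suc n)
    then obtain a where a: "a \<in> Q" "j a = z [^]\<^bsub>K.L\<^esub> n \<otimes>\<^bsub>K.L\<^esub> j y" by blast
    then obtain w where w: "w \<in> Q" "a \<otimes> x = y \<otimes> w" using stable by blast
    have c: "a \<in> carrier R" "w \<in> carrier R" using a w Q by auto
    have "z [^]\<^bsub>K.L\<^esub> Suc n \<otimes>\<^bsub>K.L\<^esub> j y = z \<otimes>\<^bsub>K.L\<^esub> j a"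
      unfolding a(2) using zc jc[OF cR] by (simp add: KD.m_ac)
    also have "\<dots> = K.frac (x \<otimes> a) y"
      using x ynz c K.S_one by (simp add: z_def j_frac K.mult_frac)
    also have "\<dots> = j w"
      unfolding j_frac
    proof (rule K.frac_eqI)
      show "\<one> \<otimes> (x \<otimes> a) = y \<otimes> w" using w(2) x c cR by (simp add: m_comm[of x a])
    qed (use x c ynz K.S_one in auto)
    finally show ?case using w(1) by metis
  qed
  have "range T \<noteq> {}" by simp
  moreover have "ideal I R" if "I \<in> range T" for I using that T_ideal by blast
  ultimately obtain M where M: "M \<in> range T" "\<And>I. \<lbrakk>I \<in> range T; M \<subseteq> I\<rbrakk> \<Longrightarrow> I = M"
    using maximal_ideal_in_family by metis
  then obtain N where N: "M = T N" by blast
  have stop: "T (Suc N) = T N" using M(2)[of "T (Suc N)"] T_mono[of N] unfolding N by blast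
  obtain a where a: "a \<in> Q" "j a = z [^]\<^bsub>K.L\<^esub> N \<otimes>\<^bsub>K.L\<^esub> j y" using pow by blast
  have "j a = ev (\<one> # replicate N \<zero>) \<otimes>\<^bsub>K.L\<^esub> j y"
    using a zc by (simp add: ev_Cons ev_zero j1)
  moreover have "length (\<one> # replicate N \<zero>) = Suc N" "set (\<one> # replicate N \<zero>) \<subseteq> carrier R" by auto
  ultimately have "a \<in> T (Suc N)" using a(1) Q unfolding T_def by blast
  then obtain cs where cs: "length cs = N" "set cs \<subseteq> carrier R" "j a = ev cs \<otimes>\<^bsub>K.L\<^esub> j y"
    unfolding stop unfolding T_def by blast
  have jy: "j y \<noteq> \<zero>\<^bsub>K.L\<^esub>"
  proof
    assume "j y = \<zero>\<^bsub>K.L\<^esub>"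
    then obtain u where "u \<in> nonzerodivisors R" "u \<otimes> y = \<zero>"
      using K.frac_zero_iff[OF cR K.S_one] unfolding j_frac by blast
    then show False using y cR by (simp add: nonzerodivisors_domain integral_iff)
  qed
  have evc: "ev cs \<in> carrier K.L" by (rule ev_closed[OF cs(2)])
  have zN: "z [^]\<^bsub>K.L\<^esub> N = ev cs"
    using KD.m_rcancel[OF jy jc[OF cR], of "z [^]\<^bsub>K.L\<^esub> N" "ev cs"] a(2) cs(3) zc evc by simp
  have "ev (\<one> # map ((\<otimes>) (\<ominus> \<one>)) cs) = z [^]\<^bsub>K.L\<^esub> N \<oplus>\<^bsub>K.L\<^esub> j (\<ominus> \<one>) \<otimes>\<^bsub>K.L\<^esub> ev cs"
    using cs zc evc by (simp add: ev_Cons ev_mult j1)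
  also have "\<dots> = (j \<one> \<oplus>\<^bsub>K.L\<^esub> j (\<ominus> \<one>)) \<otimes>\<^bsub>K.L\<^esub> ev cs"
    using evc jc[of "\<ominus> \<one>"] by (simp add: zN j1 KD.l_distr)
  also have "\<dots> = \<zero>\<^bsub>K.L\<^esub>"
    using evc by (simp add: ja[symmetric] r_neg j0)
  finally have root: "KD.eval (map j (\<one> # map ((\<otimes>) (\<ominus> \<one>)) cs)) z = \<zero>\<^bsub>K.L\<^esub>"
    unfolding ev_def .
  show ?thesis
    unfolding integral_over_base_def total_frac_def
  proof (intro exI conjI)
    show "map j (\<one> # map ((\<otimes>) (\<ominus> \<one>)) cs) \<noteq> []" by simp
    show "set (map j (\<one> # map ((\<otimes>) (\<ominus> \<one>)) cs)) \<subseteq> to_frac R ` carrier R"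
      using cs(2) by (auto simp: j_def)
    show "hd (map j (\<one> # map ((\<otimes>) (\<ominus> \<one>)) cs)) = \<one>\<^bsub>K.L\<^esub>" by (simp add: j1)
    show "KD.eval (map j (\<one> # map ((\<otimes>) (\<ominus> \<one>)) cs)) (K.frac x y) = \<zero>\<^bsub>K.L\<^esub>"
      using root unfolding z_def .
  qed
qed

context noetherian_domain
begin

text \<open>Let \<open>Q = (yR : x)\<close> and \<open>f = x/y\<close>, so that \<open>Qf \<subseteq> R\<close>. If \<open>Qf \<subseteq> Q\<close>, then \<open>f\<close> is integral over \<open>R\<close>, hence
  \<open>f \<in> R\<close> and \<open>1 \<in> Q\<close>, which is absurd. So \<open>w = \<pi>f\<close> lies outside \<open>Q\<close> for some \<open>\<pi> \<in> Q\<close>, and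
  \<open>wq = \<pi> (qf)\<close> for every \<open>q \<in> Q\<close>.\<close>

lemma prime_colon_uniformizer:
  assumes normal: "normal_domain R" and y: "y \<in> carrier R" "y \<noteq> \<zero>" and x: "x \<in> carrier R"
    and prime: "primeideal {r \<in> carrier R. r \<otimes> x \<in> PIdl y} R"
  shows "\<exists>\<pi>. uniformizer R {r \<in> carrier R. r \<otimes> x \<in> PIdl y} \<pi>"
proof -
  define Q where "Q = {r \<in> carrier R. r \<otimes> x \<in> PIdl y}"
  have memQ: "r \<in> Q \<longleftrightarrow> r \<in> carrier R \<and> (\<exists>w\<in>carrier R. r \<otimes> x = y \<otimes> w)" for r
    unfolding Q_def mem_cgenideal_iff using y m_comm by auto
  interpret Q: primeideal Q R unfolding Q_def by (rule prime)
  interpret K: fractions R "nonzerodivisors R" by (rule fractions_nonzerodivisors)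
  have yQ: "y \<in> Q" unfolding memQ using y x by blast
  have "\<exists>\<pi>\<in>Q. \<exists>w\<in>carrier R - Q. \<pi> \<otimes> x = y \<otimes> w"
  proof (rule ccontr)
    assume no: "\<not> (\<exists>\<pi>\<in>Q. \<exists>w\<in>carrier R - Q. \<pi> \<otimes> x = y \<otimes> w)"
    have "\<exists>w\<in>Q. q \<otimes> x = y \<otimes> w" if q: "q \<in> Q" for q
    proof -
      obtain w where w: "w \<in> carrier R" "q \<otimes> x = y \<otimes> w"
        using q[unfolded memQ] by blast
      then have "w \<in> Q" using no q by (metis DiffI)
      then show ?thesis using w(2) by blast
    qed
    then have "integral_over_base R (K.frac x y)"
      by (rule stable_fraction_integral[OF yQ y(2) Q.a_subset x])
    moreover have "K.frac x y \<in> carrier (total_frac R)"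
      unfolding total_frac_def using x y by (intro K.frac_closed) (auto simp: nonzerodivisors_domain)
    ultimately obtain r where r: "r \<in> carrier R" "K.frac x y = K.frac r \<one>"
      using normal unfolding normal_domain_def to_frac_def by blast
    then have "\<one> \<otimes> x = y \<otimes> r"
      using x y K.frac_eq_domain[OF domain_axioms, of x y r \<one>] by (simp add: nonzerodivisors_domain)
    then have "\<one> \<in> Q" using r(1) unfolding memQ by blast
    then show False using Q.one_imp_carrier Q.I_notcarr by blast
  qed
  then obtain \<pi> w where \<pi>: "\<pi> \<in> Q" "w \<in> carrier R - Q" "\<pi> \<otimes> x = y \<otimes> w" by blast
  have c: "\<pi> \<in> carrier R" "w \<in> carrier R" "w \<noteq> \<zero>" using \<pi> Q.Icarr Q.zero_closed by auto
  have "\<pi> \<noteq> \<zero>"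
  proof
    assume "\<pi> = \<zero>"
    then have "y \<otimes> w = \<zero>" using \<pi>(3) x by simp
    then show False using c y by (simp add: integral_iff)
  qed
  moreover have "\<exists>w'\<in>carrier R - Q. \<exists>b\<in>carrier R. w' \<otimes> q = \<pi> \<otimes> b" if q: "q \<in> Q" for q
  proof -
    obtain b where b: "q \<in> carrier R" "b \<in> carrier R" "q \<otimes> x = y \<otimes> b"
      using q[unfolded memQ] by blast
    have "y \<otimes> (w \<otimes> q) = q \<otimes> (y \<otimes> w)" using y b c by (simp add: m_ac)
    also have "\<dots> = \<pi> \<otimes> (q \<otimes> x)" unfolding \<pi>(3)[symmetric] using c(1) b(1) x by (rule_tac m_lcomm)
    also have "\<dots> = y \<otimes> (\<pi> \<otimes> b)" unfolding b(3) using y(1) b(2) c(1) by (rule_tac m_lcomm)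
    finally have "w \<otimes> q = \<pi> \<otimes> b"
      using m_lcancel[OF y(2) y(1), of "w \<otimes> q" "\<pi> \<otimes> b"] b c by simp
    then show ?thesis using \<pi>(2) b(2) by blast
  qed
  ultimately have "uniformizer R Q \<pi>" using \<pi>(1) unfolding uniformizer_def by blast
  then show ?thesis unfolding Q_def by blast
qed

lemma colon_colon:
  assumes "x \<in> carrier R" "z \<in> carrier R"
  shows "{r \<in> carrier R. r \<otimes> z \<in> {r \<in> carrier R. r \<otimes> x \<in> J}} = {r \<in> carrier R. r \<otimes> (z \<otimes> x) \<in> J}"
  using assms by (auto simp: m_assoc)

text \<open>Choose a nonzero \<open>y \<in> Q\<close>. An associated prime of \<open>yR\<close> inside \<open>Q\<close> contains \<open>y\<close>, so it is \<open>Q\<close>.\<close>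

lemma height_one_valuation_prime:
  assumes normal: "normal_domain R" and Q: "height_one R Q"
  shows "\<exists>\<pi>. valuation_prime R Q \<pi>"
proof -
  interpret Q: primeideal Q R using Q by (simp add: height_one_def)
  interpret F: fractions R "carrier R - Q" by (rule fractions_prime_complement) (rule Q.primeideal)
  obtain y where y: "y \<in> Q" "y \<noteq> \<zero>" using Q Q.zero_closed unfolding height_one_def by blast
  have yc: "y \<in> carrier R" using y Q.Icarr by blast
  have "PIdl y \<subseteq> Q" using y(1) by (intro cgenideal_minimal) (rule Q.is_ideal)
  then have "PIdl y \<inter> (carrier R - Q) = {}" by blast
  then obtain z where z: "z \<in> carrier R" "primeideal {r \<in> carrier R. r \<otimes> z \<in> PIdl y} R"
    "{r \<in> carrier R. r \<otimes> z \<in> PIdl y} \<inter> (carrier R - Q) = {}"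
    by (rule F.associated_prime[OF noetherian_ring_axioms cgenideal_ideal[OF yc]])
  have "z \<otimes> y \<in> PIdl y" using z(1) unfolding mem_cgenideal_iff by blast
  then have "y \<in> {r \<in> carrier R. r \<otimes> z \<in> PIdl y}" using m_comm[OF yc z(1)] yc by simp
  then have "{r \<in> carrier R. r \<otimes> z \<in> PIdl y} \<noteq> {\<zero>}" using y(2) by blast
  then have eq: "{r \<in> carrier R. r \<otimes> z \<in> PIdl y} = Q"
    using Q z(2,3) unfolding height_one_def by blast
  then obtain \<pi> where "uniformizer R Q \<pi>"
    using prime_colon_uniformizer[OF normal yc y(2) z(1,2)] by auto
  then show ?thesis using valuation_primeI Q.primeideal by blast
qed

text \<open>A normal noetherian domain is the intersection of its localizations at height one primes. If
  \<open>x/y\<close> were not in \<open>R\<close>, there would be an associated prime \<open>Q = (yR : zx)\<close>. It has height one by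
  \<open>prime_colon_uniformizer\<close>, so \<open>zx\<close> has at least the order of \<open>y\<close> at \<open>Q\<close>; hence an element outside
  \<open>Q\<close> multiplies \<open>zx\<close> into \<open>yR\<close>, contrary to the definition of \<open>Q\<close>.\<close>

lemma divides_if_order_le:
  assumes normal: "normal_domain R" and y: "y \<in> carrier R" "y \<noteq> \<zero>" and x: "x \<in> carrier R" "x \<noteq> \<zero>"
    and le: "\<And>Q. height_one R Q \<Longrightarrow> order_along R Q y \<le> order_along R Q x"
  shows "x \<in> PIdl y"
proof (rule ccontr)
  assume not: "x \<notin> PIdl y"
  interpret F: fractions R "{\<one>}" by unfold_locales auto
  define J where "J = {r \<in> carrier R. r \<otimes> x \<in> PIdl y}"
  have J: "ideal J R" unfolding J_def by (rule ideal_colon[OF cgenideal_ideal[OF y(1)] x(1)])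
  have "J \<inter> {\<one>} = {}" using not x by (simp add: J_def)
  then obtain z where z: "z \<in> carrier R" "primeideal {r \<in> carrier R. r \<otimes> z \<in> J} R"
    "{r \<in> carrier R. r \<otimes> z \<in> J} \<inter> {\<one>} = {}"
    by (rule F.associated_prime[OF noetherian_ring_axioms J])
  define Q where "Q = {r \<in> carrier R. r \<otimes> (z \<otimes> x) \<in> PIdl y}"
  have Qeq: "{r \<in> carrier R. r \<otimes> z \<in> J} = Q"
    unfolding J_def Q_def by (rule colon_colon[OF x(1) z(1)])
  have zx: "z \<otimes> x \<in> carrier R" using z x by simp
  have Qp: "primeideal Q R" using z(2) unfolding Qeq .
  then obtain \<pi> where u: "uniformizer R Q \<pi>"
    using prime_colon_uniformizer[OF normal y zx] unfolding Q_def by blast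
  interpret V: valuation_prime R Q \<pi> by (rule valuation_primeI[OF Qp u])
  have one: "\<one> \<notin> Q" using V.one_compl by simp
  have zx0: "z \<otimes> x \<noteq> \<zero>"
  proof
    assume "z \<otimes> x = \<zero>"
    then have "\<one> \<otimes> (z \<otimes> x) = \<zero> \<otimes> y" using y by simp
    then have "\<one> \<in> Q" unfolding Q_def mem_cgenideal_iff using zero_closed one_closed by blast
    then show False using one by simp
  qed
  then have z0: "z \<noteq> \<zero>" using x by auto
  have "V.ord y \<le> V.ord (z \<otimes> x)"
    using le[OF V.height_one] V.ord_mult[OF z(1) z0 x] by simp
  then obtain k where k: "V.ord (z \<otimes> x) = k + V.ord y" by (metis le_iff_add add.commute)
  obtain s t where s: "s \<in> carrier R - Q" "t \<in> carrier R - Q" "s \<otimes> y = t \<otimes> \<pi> [^] V.ord y"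
    using V.order_unit_mult[OF y] .
  obtain u v where u: "u \<in> carrier R - Q" "v \<in> carrier R - Q"
    "u \<otimes> (z \<otimes> x) = v \<otimes> \<pi> [^] V.ord (z \<otimes> x)"
    using V.order_unit_mult[OF zx zx0] .
  have c: "s \<in> carrier R" "t \<in> carrier R" "u \<in> carrier R" "v \<in> carrier R" using s u by auto
  have "(u \<otimes> t) \<otimes> (z \<otimes> x) = t \<otimes> (u \<otimes> (z \<otimes> x))" using c zx by (simp add: m_ac)
  also have "\<dots> = (v \<otimes> \<pi> [^] k) \<otimes> (t \<otimes> \<pi> [^] V.ord y)"
    unfolding u(3) k using c by (simp add: nat_pow_mult[symmetric] m_ac)
  also have "\<dots> = (v \<otimes> \<pi> [^] k \<otimes> s) \<otimes> y"
    unfolding s(3)[symmetric] using c y(1) by (simp add: m_assoc)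
  finally have "(u \<otimes> t) \<otimes> (z \<otimes> x) \<in> PIdl y"
    unfolding mem_cgenideal_iff using c by (intro bexI[where x = "v \<otimes> \<pi> [^] k \<otimes> s"]) auto
  then have "u \<otimes> t \<in> Q" unfolding Q_def using c by simp
  then show False using V.compl_mult[OF u(1) s(2)] by simp
qed

end

section \<open>Orders under localization\<close>

lemma (in fractions) has_order_localization:
  assumes "x \<in> carrier R" "u \<in> S" "\<pi> \<in> carrier R" "primeideal Q R" "Q \<inter> S = {}"
    "has_order R Q \<pi> x n"
  shows "has_order L (ext_ideal Q) (frac \<pi> \<one>) (frac x u) n"
proof -
  interpret Q: primeideal Q R by fact
  interpret LR: cring L by (rule cring_localization)
  obtain s t where s: "s \<in> carrier R - Q" "t \<in> carrier R - Q" "s \<otimes> x = t \<otimes> \<pi> [^] n"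
    using assms(6) unfolding has_order_def by blast
  have c: "s \<in> carrier R" "t \<in> carrier R" "u \<in> carrier R" using s assms(2) by auto
  have pow: "frac \<pi> \<one> [^]\<^bsub>L\<^esub> n = frac (\<pi> [^] n) \<one>"
    by (induction n) (use S_one assms(3) in \<open>simp_all add: one_frac mult_frac\<close>)
  have "frac (s \<otimes> u) \<one> \<otimes>\<^bsub>L\<^esub> frac x u = frac (s \<otimes> x) \<one>"
    using c assms(1,2) S_one by (simp add: mult_frac) (intro frac_eqI, auto simp: m_ac)
  also have "\<dots> = frac t \<one> \<otimes>\<^bsub>L\<^esub> frac \<pi> \<one> [^]\<^bsub>L\<^esub> n"
    unfolding s(3) pow using c assms(3) S_one by (simp add: mult_frac)
  finally have eq: "frac (s \<otimes> u) \<one> \<otimes>\<^bsub>L\<^esub> frac x u = frac t \<one> \<otimes>\<^bsub>L\<^esub> frac \<pi> \<one> [^]\<^bsub>L\<^esub> n" .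
  have "s \<otimes> u \<notin> Q" using Q.I_prime[of s u] s assms(2,5) c by auto
  then have "frac (s \<otimes> u) \<one> \<in> carrier L - ext_ideal Q"
    using mem_ext_prime[OF assms(4,5) _ S_one, of "s \<otimes> u"] c S_one by auto
  moreover have "frac t \<one> \<in> carrier L - ext_ideal Q"
    using mem_ext_prime[OF assms(4,5) _ S_one, of t] s c S_one by auto
  ultimately show ?thesis using eq unfolding has_order_def by blast
qed

text \<open>A uniformizer of \<open>Q\<close> remains a uniformizer in \<open>S\<^sup>-\<^sup>1 R\<close>. In this way orders on \<open>S\<^sup>-\<^sup>1 R\<close> are obtained
  from those on \<open>R\<close>.\<close>

lemma (in fractions) valuation_prime_localization:
  assumes V: "valuation_prime R Q \<pi>" and disj: "Q \<inter> S = {}"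
  shows "valuation_prime L (ext_ideal Q) (frac \<pi> \<one>)"
proof -
  interpret V: valuation_prime R Q \<pi> by fact
  have prime: "primeideal Q R" by (rule V.primeideal)
  have Q0: "\<zero> \<notin> S" using disj primeideal_zero_mem[OF prime] by blast
  interpret LD: domain L by (rule domain_localization[OF V.domain_axioms Q0])
  interpret E: primeideal "ext_ideal Q" L by (rule primeideal_ext[OF prime disj])
  show ?thesis
  proof unfold_locales
    have "frac \<pi> \<one> \<in> ext_ideal Q" using V.\<pi>_mem S_one unfolding ext_ideal_def by blast
    moreover have "frac \<pi> \<one> \<noteq> \<zero>\<^bsub>L\<^esub>"
      using V.\<pi>_nonzero Q0 S_one frac_eq_domain[OF V.domain_axioms Q0, of \<pi> \<one> \<zero> \<one>]
      by (simp add: zero_frac)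
    moreover have "\<exists>w\<in>carrier L - ext_ideal Q. \<exists>b\<in>carrier L. w \<otimes>\<^bsub>L\<^esub> U = frac \<pi> \<one> \<otimes>\<^bsub>L\<^esub> b"
      if U: "U \<in> ext_ideal Q" for U
    proof -
      obtain q s where q: "q \<in> Q" "s \<in> S" "U = frac q s" using U unfolding ext_ideal_def by blast
      then obtain w b where w: "w \<in> carrier R - Q" "b \<in> carrier R" "w \<otimes> q = \<pi> \<otimes> b"
        using V.uniformizer unfolding uniformizer_def by blast
      have c: "w \<in> carrier R" "q \<in> carrier R" using w q V.Icarr by auto
      have "frac w \<one> \<otimes>\<^bsub>L\<^esub> U = frac \<pi> \<one> \<otimes>\<^bsub>L\<^esub> frac b s"
        using w(2,3) q c S_one by (simp add: mult_frac)
      moreover have "frac w \<one> \<in> carrier L - ext_ideal Q"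
        using mem_ext_prime[OF prime disj _ S_one, of w] w c S_one by auto
      moreover have "frac b s \<in> carrier L" using w(2) q(2) by simp
      ultimately show ?thesis by blast
    qed
    ultimately show "uniformizer L (ext_ideal Q) (frac \<pi> \<one>)"
      unfolding uniformizer_def by blast
  next
    fix U assume U: "U \<in> carrier L" "U \<noteq> \<zero>\<^bsub>L\<^esub>"
    obtain x u where x: "x \<in> carrier R" "u \<in> S" "U = frac x u" using U(1) by (rule frac_cases)
    have "x \<noteq> \<zero>"
    proof
      assume "x = \<zero>"
      then have "\<one> \<otimes> x = \<zero>" by simp
      then show False using U(2) x S_one frac_zero_iff[OF x(1,2)] by blast
    qed
    then obtain n where "has_order R Q \<pi> x n" using V.order_exists[OF x(1)] by blast
    then show "\<exists>n. has_order L (ext_ideal Q) (frac \<pi> \<one>) U n"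
      using has_order_localization[OF x(1,2) V.\<pi>_carr prime disj] x(3) by blast
  qed
qed

lemma (in fractions) order_localization:
  assumes V: "valuation_prime R Q \<pi>" and disj: "Q \<inter> S = {}" and x: "x \<in> carrier R" "x \<noteq> \<zero>"
  shows "order_along L (ext_ideal Q) (frac x \<one>) = order_along R Q x"
proof -
  interpret V: valuation_prime R Q \<pi> by fact
  have prime: "primeideal Q R" by (rule V.primeideal)
  have Q0: "\<zero> \<notin> S" using disj primeideal_zero_mem[OF prime] by blast
  interpret E: valuation_prime L "ext_ideal Q" "frac \<pi> \<one>"
    by (rule valuation_prime_localization[OF V disj])
  obtain n where n: "has_order R Q \<pi> x n" using V.order_exists[OF x] by blast
  have "frac x \<one> \<noteq> \<zero>\<^bsub>L\<^esub>"
    using x S_one frac_eq_domain[OF V.domain_axioms Q0, of x \<one> \<zero> \<one>] by (simp add: zero_frac)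
  then have "E.ord (frac x \<one>) = n"
    using has_order_localization[OF x(1) S_one V.\<pi>_carr prime disj n] x S_one
    by (intro E.order_eq) auto
  then show ?thesis using V.order_eq[OF x n] by simp
qed

section \<open>Modules of sections\<close>

lemma sections_module_simps [simp]:
  "carrier (sections_module A D) = sections A D"
  "ring.zero (sections_module A D) = \<zero>\<^bsub>total_frac A\<^esub>"
  "ring.add (sections_module A D) = ring.add (total_frac A)"
  "r \<odot>\<^bsub>sections_module A D\<^esub> g = to_frac A r \<otimes>\<^bsub>total_frac A\<^esub> g"
  by (simp_all add: sections_module_def)

lemma (in cring) cring_total_frac: "cring (total_frac R)"
  unfolding total_frac_def by (rule fractions.cring_localization) (rule fractions_nonzerodivisors)

lemma (in cring) to_frac_hom: "to_frac R \<in> ring_hom R (total_frac R)"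
  using fractions.base_hom[OF fractions_nonzerodivisors]
  by (simp add: to_frac_def[abs_def] total_frac_def)

definition frac_submodule :: "('a, 'b) ring_scheme \<Rightarrow> ('a \<times> 'a) set set \<Rightarrow> bool" where
  "frac_submodule A M \<longleftrightarrow> M \<subseteq> carrier (total_frac A) \<and> \<zero>\<^bsub>total_frac A\<^esub> \<in> M \<and>
     (\<forall>g\<in>M. \<forall>g'\<in>M. g \<oplus>\<^bsub>total_frac A\<^esub> g' \<in> M) \<and>
     (\<forall>r\<in>carrier A. \<forall>g\<in>M. to_frac A r \<otimes>\<^bsub>total_frac A\<^esub> g \<in> M)"

lemma (in cring) module_sections:
  assumes "frac_submodule R (sections R D)"
  shows "module R (sections_module R D)"
proof -
  interpret K: cring "total_frac R" by (rule cring_total_frac)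
  note hom = ring_hom_closed[OF to_frac_hom] ring_hom_add[OF to_frac_hom]
    ring_hom_mult[OF to_frac_hom] ring_hom_one[OF to_frac_hom]
  have sub: "g \<in> carrier (total_frac R)" if "g \<in> sections R D" for g
    using that assms by (auto simp: frac_submodule_def)
  have zero: "\<zero>\<^bsub>total_frac R\<^esub> \<in> sections R D"
    using assms by (auto simp: frac_submodule_def)
  have add: "g \<oplus>\<^bsub>total_frac R\<^esub> g' \<in> sections R D" if "g \<in> sections R D" "g' \<in> sections R D" for g g'
    using that assms by (auto simp: frac_submodule_def)
  have smult: "to_frac R r \<otimes>\<^bsub>total_frac R\<^esub> g \<in> sections R D"
    if "r \<in> carrier R" "g \<in> sections R D" for r g
    using that assms by (auto simp: frac_submodule_def)
  show ?thesis
  proof (rule moduleI)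
    show "cring R" by (rule is_cring)
    show "abelian_group (sections_module R D)"
    proof (rule abelian_groupI)
      fix g assume "g \<in> carrier (sections_module R D)"
      then have g: "g \<in> sections R D" "g \<in> carrier (total_frac R)" using sub by simp_all
      have "to_frac R (\<ominus> \<one>) \<otimes>\<^bsub>total_frac R\<^esub> g \<oplus>\<^bsub>total_frac R\<^esub> g
          = (to_frac R (\<ominus> \<one>) \<oplus>\<^bsub>total_frac R\<^esub> to_frac R \<one>) \<otimes>\<^bsub>total_frac R\<^esub> g"
        using g hom(1) by (simp add: K.l_distr hom(4))
      also have "to_frac R (\<ominus> \<one>) \<oplus>\<^bsub>total_frac R\<^esub> to_frac R \<one> = to_frac R \<zero>"
        using hom(2)[of "\<ominus> \<one>" \<one>] by (simp add: l_neg)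
      also have "\<dots> = \<zero>\<^bsub>total_frac R\<^esub>"
        by (rule ring_hom_zero[OF to_frac_hom ring_axioms K.ring_axioms])
      finally have "to_frac R (\<ominus> \<one>) \<otimes>\<^bsub>total_frac R\<^esub> g \<oplus>\<^bsub>total_frac R\<^esub> g = \<zero>\<^bsub>total_frac R\<^esub>"
        using g by simp
      then show "\<exists>g'\<in>carrier (sections_module R D).
          g' \<oplus>\<^bsub>sections_module R D\<^esub> g = \<zero>\<^bsub>sections_module R D\<^esub>"
        using smult[OF _ g(1), of "\<ominus> \<one>"] by auto
    qed (auto simp: add zero sub K.a_ac)
  qed (auto simp: smult hom sub K.l_distr K.r_distr K.m_assoc)
qed

lemma (in fractions) frac_nat_pow:
  assumes "x \<in> carrier R"
  shows "frac x \<one> [^]\<^bsub>L\<^esub> (n::nat) = frac (x [^] n) \<one>"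
proof -
  interpret L: cring L by (rule cring_localization)
  show ?thesis by (induction n) (use assms S_one in \<open>simp_all add: one_frac mult_frac\<close>)
qed

lemma (in fractions) add_pow_localization:
  fixes n :: nat
  shows "[n] \<cdot>\<^bsub>L\<^esub> \<one>\<^bsub>L\<^esub> = frac ([n] \<cdot> \<one>) \<one>"
proof -
  interpret L: cring L by (rule cring_localization)
  show ?thesis
    by (induction n) (use S_one in \<open>simp_all add: one_frac zero_frac frac_add_same\<close>)
qed

text \<open>It suffices to compare the modules of sections before the pushforward: if \<open>s g' = h(g)\<close> there, then
  \<open>s\<^sup>q g' = h(s\<^bsup>q-1\<^esup> g)\<close> with \<open>q = p\<^sup>e\<close>, and multiplication by \<open>s\<^sup>q\<close> is the action of \<open>s\<close> on the pushforward.\<close>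

lemma (in fractions) localized_module_sections:
  assumes p: "Factorial_Ring.prime (p::nat)" and char: "[p] \<cdot> \<one> = \<zero>"
    and M: "frac_submodule R (sections R D)" and M': "frac_submodule L (sections L D')"
    and sub: "\<And>g. g \<in> sections R D \<Longrightarrow> total_frac_map g \<in> sections L D'"
    and surj: "\<And>g'. g' \<in> sections L D' \<Longrightarrow>
      \<exists>s\<in>S. \<exists>g\<in>sections R D. to_frac L (frac s \<one>) \<otimes>\<^bsub>total_frac L\<^esub> g' = total_frac_map g"
  shows "localized_module R S (frob_push R p e (sections_module R D))
    (frob_push L p e (sections_module L D')) total_frac_map"
proof -
  let ?N = "frob_push R p e (sections_module R D)" and ?N' = "frob_push L p e (sections_module L D')"
  interpret L: cring L by (rule cring_localization)
  interpret K: cring "total_frac R" by (rule cring_total_frac)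
  interpret KL: cring "total_frac L" by (rule L.cring_total_frac)
  have charL: "[p] \<cdot>\<^bsub>L\<^esub> \<one>\<^bsub>L\<^esub> = \<zero>\<^bsub>L\<^esub>"
    unfolding add_pow_localization char zero_frac ..
  interpret N: module R ?N
    by (rule module_frob_push[OF module_sections[OF M] p char])
  interpret N': module L ?N'
    by (rule module_frob_push[OF L.module_sections[OF M'] p charL])
  note tfc = ring_hom_closed[OF to_frac_hom] and tfLc = ring_hom_closed[OF L.to_frac_hom]
  have subK: "g \<in> carrier (total_frac R)" if "g \<in> sections R D" for g
    using that M unfolding frac_submodule_def by blast
  have subKL: "g \<in> carrier (total_frac L)" if "g \<in> sections L D'" for g
    using that M' unfolding frac_submodule_def by blast
  have smultR: "to_frac R r \<otimes>\<^bsub>total_frac R\<^esub> g \<in> sections R D"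
    if "r \<in> carrier R" "g \<in> sections R D" for r g
    using that M unfolding frac_submodule_def by blast
  have tf_smult: "total_frac_map (to_frac R r \<otimes>\<^bsub>total_frac R\<^esub> g)
      = to_frac L (frac r \<one>) \<otimes>\<^bsub>total_frac L\<^esub> total_frac_map g" if "r \<in> carrier R" "g \<in> sections R D" for r g
    using that tfc subK by (simp add: ring_hom_mult[OF total_frac_map_hom] total_frac_map_to_frac)
  show ?thesis
  proof (rule localized_module.intro[OF fractions_axioms N.module_axioms N'.module_axioms],
      rule localized_module_axioms.intro)
    show "total_frac_map g \<in> carrier (?N')"
      if "g \<in> carrier (?N)" for g
      using that sub by simp
    show "total_frac_map (g \<oplus>\<^bsub>?N\<^esub> g')
        = total_frac_map g \<oplus>\<^bsub>?N'\<^esub> total_frac_map g'"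
      if "g \<in> carrier (?N)"
        "g' \<in> carrier (?N)" for g g'
      using that subK by (simp add: ring_hom_add[OF total_frac_map_hom])
    show "total_frac_map (r \<odot>\<^bsub>?N\<^esub> g)
        = frac r \<one> \<odot>\<^bsub>?N'\<^esub> total_frac_map g"
      if "r \<in> carrier R" "g \<in> carrier (?N)" for r g
      using that by (simp add: tf_smult frac_nat_pow)
    show "\<exists>s\<in>S. \<exists>g\<in>carrier (?N).
        frac s \<one> \<odot>\<^bsub>?N'\<^esub> g' = total_frac_map g"
      if "g' \<in> carrier (?N')" for g'
    proof -
      have g': "g' \<in> sections L D'" using that by simp
      then obtain s g where s: "s \<in> S" "g \<in> sections R D"
        "to_frac L (frac s \<one>) \<otimes>\<^bsub>total_frac L\<^esub> g' = total_frac_map g"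
        using surj by blast
      have "0 < p ^ e" using p by (simp add: prime_gt_0_nat)
      then obtain m where m: "p ^ e = Suc m" by (metis Suc_pred)
      have sm: "s [^] m \<in> carrier R" using s by simp
      have "frac (s [^] (p ^ e)) \<one> = frac (s [^] m) \<one> \<otimes>\<^bsub>L\<^esub> frac s \<one>"
        unfolding m using s S_one by (simp add: mult_frac)
      then have "to_frac L (frac (s [^] (p ^ e)) \<one>) \<otimes>\<^bsub>total_frac L\<^esub> g'
          = to_frac L (frac (s [^] m) \<one>) \<otimes>\<^bsub>total_frac L\<^esub> (to_frac L (frac s \<one>) \<otimes>\<^bsub>total_frac L\<^esub> g')"
        using sm s(1) S_one subKL[OF g'] tfLc by (simp add: ring_hom_mult[OF L.to_frac_hom] KL.m_assoc)
      also have "\<dots> = total_frac_map (to_frac R (s [^] m) \<otimes>\<^bsub>total_frac R\<^esub> g)"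
        unfolding s(3) using sm s(2) by (simp add: tf_smult)
      finally have "frac s \<one> \<odot>\<^bsub>?N'\<^esub> g'
          = total_frac_map (to_frac R (s [^] m) \<otimes>\<^bsub>total_frac R\<^esub> g)"
        using s(1) by (simp add: frac_nat_pow)
      moreover have "to_frac R (s [^] m) \<otimes>\<^bsub>total_frac R\<^esub> g \<in> carrier (?N)"
        using smultR[OF sm s(2)] by simp
      ultimately show ?thesis using s(1) by blast
    qed
    show "\<exists>s\<in>S. s \<odot>\<^bsub>?N\<^esub> g
        = s \<odot>\<^bsub>?N\<^esub> g'"
      if "g \<in> carrier (?N)"
        "g' \<in> carrier (?N)" "total_frac_map g = total_frac_map g'" for g g'
    proof -
      note hyps = that
      have g: "g \<in> carrier (total_frac R)" "g' \<in> carrier (total_frac R)" using that subK by simp_all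
      obtain s where s: "s \<in> S" "to_frac R s \<otimes>\<^bsub>total_frac R\<^esub> g = to_frac R s \<otimes>\<^bsub>total_frac R\<^esub> g'"
        using g hyps(3) by (rule total_frac_map_eqD)
      have "0 < p ^ e" using p by (simp add: prime_gt_0_nat)
      then obtain m where m: "p ^ e = Suc m" by (metis Suc_pred)
      have sc: "s \<in> carrier R" "s [^] m \<in> carrier R" using s by simp_all
      have "to_frac R (s [^] (p ^ e)) \<otimes>\<^bsub>total_frac R\<^esub> k
          = to_frac R (s [^] m) \<otimes>\<^bsub>total_frac R\<^esub> (to_frac R s \<otimes>\<^bsub>total_frac R\<^esub> k)"
        if "k \<in> carrier (total_frac R)" for k
        unfolding m using sc that tfc by (simp add: ring_hom_mult[OF to_frac_hom] K.m_assoc)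
      then have "to_frac R (s [^] (p ^ e)) \<otimes>\<^bsub>total_frac R\<^esub> g = to_frac R (s [^] (p ^ e)) \<otimes>\<^bsub>total_frac R\<^esub> g'"
        using g s(2) by simp
      then show ?thesis using s(1) by auto
    qed
  qed
qed

subsection \<open>The zero divisor\<close>

lemma sections_zero: "sections A (\<lambda>_. 0) = to_frac A ` carrier A"
  by (simp add: sections_def)

lemma (in cring) frac_submodule_sections_zero: "frac_submodule R (sections R (\<lambda>_. 0))"
proof -
  interpret K: cring "total_frac R" by (rule cring_total_frac)
  have "\<zero>\<^bsub>total_frac R\<^esub> = to_frac R \<zero>"
    by (rule ring_hom_zero[OF to_frac_hom ring_axioms K.ring_axioms, symmetric])
  then show ?thesis
    unfolding frac_submodule_def sections_zero
    by (auto simp: ring_hom_closed[OF to_frac_hom] ring_hom_add[OF to_frac_hom, symmetric]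
        ring_hom_mult[OF to_frac_hom, symmetric])
qed

lemma (in cring) finitely_generated_sections_zero: "finitely_generated R (sections_module R (\<lambda>_. 0))"
proof -
  have "generates R (sections_module R (\<lambda>_. 0)) {to_frac R \<one>}"
  proof (rule generatesI)
    show "{to_frac R \<one>} \<subseteq> carrier (sections_module R (\<lambda>_. 0))" by (auto simp: sections_zero)
    fix T
    assume one: "{to_frac R \<one>} \<subseteq> T"
      and smult: "\<And>r x. \<lbrakk>r \<in> carrier R; x \<in> T\<rbrakk> \<Longrightarrow> r \<odot>\<^bsub>sections_module R (\<lambda>_. 0)\<^esub> x \<in> T"
    show "carrier (sections_module R (\<lambda>_. 0)) \<subseteq> T"
    proof
      fix g assume "g \<in> carrier (sections_module R (\<lambda>_. 0))"
      then obtain r where r: "r \<in> carrier R" "g = to_frac R r" by (auto simp: sections_zero)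
      have "to_frac R r \<otimes>\<^bsub>total_frac R\<^esub> to_frac R \<one> \<in> T" using smult[OF r(1), of "to_frac R \<one>"] one by simp
      then show "g \<in> T" using r by (simp add: ring_hom_mult[OF to_frac_hom, symmetric])
    qed
  qed
  then show ?thesis unfolding finitely_generated_def by blast
qed

lemma (in fractions) localized_module_sections_zero:
  assumes p: "Factorial_Ring.prime (p::nat)" and char: "[p] \<cdot> \<one> = \<zero>"
  shows "localized_module R S (frob_push R p e (sections_module R (\<lambda>_. 0)))
    (frob_push L p e (sections_module L (\<lambda>_. 0))) total_frac_map"
proof (rule localized_module_sections[OF p char])
  interpret L: cring L by (rule cring_localization)
  show "frac_submodule R (sections R (\<lambda>_. 0))" by (rule frac_submodule_sections_zero)
  show "frac_submodule L (sections L (\<lambda>_. 0))" by (rule L.frac_submodule_sections_zero)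
  show "total_frac_map g \<in> sections L (\<lambda>_. 0)" if "g \<in> sections R (\<lambda>_. 0)" for g
    using that S_one by (auto simp: sections_zero total_frac_map_to_frac)
  show "\<exists>s\<in>S. \<exists>g\<in>sections R (\<lambda>_. 0). to_frac L (frac s \<one>) \<otimes>\<^bsub>total_frac L\<^esub> g' = total_frac_map g"
    if g': "g' \<in> sections L (\<lambda>_. 0)" for g'
  proof -
    obtain U where U: "U \<in> carrier L" "g' = to_frac L U" using g' by (auto simp: sections_zero)
    obtain x s where x: "x \<in> carrier R" "s \<in> S" "U = frac x s" using U(1) by (rule frac_cases)
    have "to_frac L (frac s \<one>) \<otimes>\<^bsub>total_frac L\<^esub> g' = total_frac_map (to_frac R x)"
      using x S_one U by (simp add: total_frac_map_to_frac ring_hom_mult[OF L.to_frac_hom, symmetric] frac_clear)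
    then show ?thesis using x by (auto simp: sections_zero)
  qed
qed

section \<open>Sections over a normal noetherian domain\<close>

text \<open>Says that at each \<open>Q \<in> T\<close> the pole of \<open>x/y\<close> has order at most \<open>D Q\<close>.\<close>

definition pole_bounded ::
  "('a, 'b) ring_scheme \<Rightarrow> 'a set set \<Rightarrow> ('a set \<Rightarrow> int) \<Rightarrow> 'a \<Rightarrow> 'a \<Rightarrow> bool" where
  "pole_bounded R T D x y \<longleftrightarrow> x = \<zero>\<^bsub>R\<^esub> \<or>
     (\<forall>Q\<in>T. int (order_along R Q y) \<le> int (order_along R Q x) + D Q)"

definition pole_bounded_fracs ::
  "('a, 'b) ring_scheme \<Rightarrow> 'a set set \<Rightarrow> ('a set \<Rightarrow> int) \<Rightarrow> ('a \<times> 'a) set set" where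
  "pole_bounded_fracs R T D = {loc_frac R (nonzerodivisors R) x y | x y.
     x \<in> carrier R \<and> y \<in> carrier R \<and> y \<noteq> \<zero>\<^bsub>R\<^esub> \<and> pole_bounded R T D x y}"

locale normal_noetherian = noetherian_domain R for R (structure) +
  assumes normal: "normal_domain R"
begin

abbreviation ord :: "'a set \<Rightarrow> 'a \<Rightarrow> nat" where
  "ord \<equiv> order_along R"

lemma zero_not_nonzerodivisor: "\<zero> \<notin> nonzerodivisors R"
  by (simp add: nonzerodivisors_domain)

lemma ord_mult:
  assumes "height_one R Q" "x \<in> carrier R" "x \<noteq> \<zero>" "y \<in> carrier R" "y \<noteq> \<zero>"
  shows "ord Q (x \<otimes> y) = ord Q x + ord Q y"
proof -
  obtain \<pi> where "valuation_prime R Q \<pi>"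
    using height_one_valuation_prime[OF normal assms(1)] by blast
  then show ?thesis by (rule valuation_prime.ord_mult) fact+
qed

lemma ord_add:
  assumes "height_one R Q" "x \<in> carrier R" "x \<noteq> \<zero>" "y \<in> carrier R" "y \<noteq> \<zero>"
    "x \<oplus> y \<noteq> \<zero>" "n \<le> ord Q x" "n \<le> ord Q y"
  shows "n \<le> ord Q (x \<oplus> y)"
proof -
  obtain \<pi> where "valuation_prime R Q \<pi>"
    using height_one_valuation_prime[OF normal assms(1)] by blast
  then show ?thesis by (rule valuation_prime.ord_add) fact+
qed

lemma ord_pos_iff:
  assumes "height_one R Q" "x \<in> carrier R" "x \<noteq> \<zero>"
  shows "0 < ord Q x \<longleftrightarrow> x \<in> Q"
proof -
  obtain \<pi> where "valuation_prime R Q \<pi>"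
    using height_one_valuation_prime[OF normal assms(1)] by blast
  then show ?thesis by (rule valuation_prime.ord_pos_iff) fact+
qed

lemma ord_eq_0:
  assumes "height_one R Q" "x \<in> carrier R" "x \<notin> Q"
  shows "ord Q x = 0"
proof -
  have "\<zero> \<in> Q" using assms(1) primeideal_zero_mem unfolding height_one_def by blast
  then have "x \<noteq> \<zero>" using assms(3) by blast
  then show ?thesis using ord_pos_iff[OF assms(1,2)] assms(3) by blast
qed

lemma ord_one: "height_one R Q \<Longrightarrow> ord Q \<one> = 0"
  using ord_mult[of Q \<one> \<one>] by simp

lemma pole_bounded_add:
  assumes T: "T \<subseteq> {Q. height_one R Q}"
    and x: "x \<in> carrier R" "pole_bounded R T D x y" and x': "x' \<in> carrier R" "pole_bounded R T D x' y"
  shows "pole_bounded R T D (x \<oplus> x') y"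
proof (cases "x = \<zero> \<or> x' = \<zero> \<or> x \<oplus> x' = \<zero>")
  case True
  then show ?thesis using x x' by (auto simp: pole_bounded_def)
next
  case False
  have "int (ord Q y) \<le> int (ord Q (x \<oplus> x')) + D Q" if Q: "Q \<in> T" for Q
  proof -
    have h: "height_one R Q" using T Q by blast
    have "int (ord Q y) \<le> int (ord Q x) + D Q" "int (ord Q y) \<le> int (ord Q x') + D Q"
      using x(2) x'(2) Q False by (auto simp: pole_bounded_def)
    then have "nat (int (ord Q y) - D Q) \<le> ord Q x" "nat (int (ord Q y) - D Q) \<le> ord Q x'"
      by linarith+
    then have "nat (int (ord Q y) - D Q) \<le> ord Q (x \<oplus> x')"
      using ord_add[OF h x(1) _ x'(1)] False by blast
    then show ?thesis by linarith
  qed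
  then show ?thesis by (simp add: pole_bounded_def)
qed

lemma pole_bounded_mult:
  assumes T: "T \<subseteq> {Q. height_one R Q}" and x: "x \<in> carrier R" "pole_bounded R T D x y"
    and r: "r \<in> carrier R"
  shows "pole_bounded R T D (r \<otimes> x) y"
proof (cases "x = \<zero> \<or> r = \<zero>")
  case True
  then show ?thesis using x r by (auto simp: pole_bounded_def)
next
  case False
  have "int (ord Q y) \<le> int (ord Q (r \<otimes> x)) + D Q" if Q: "Q \<in> T" for Q
  proof -
    have h: "height_one R Q" using T Q by blast
    have "int (ord Q y) \<le> int (ord Q x) + D Q"
      using x(2) Q False by (auto simp: pole_bounded_def)
    then show ?thesis using ord_mult[OF h r _ x(1)] False by simp
  qed
  then show ?thesis by (simp add: pole_bounded_def)
qed

lemma pole_bounded_cancel: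
  assumes T: "T \<subseteq> {Q. height_one R Q}" and x: "x \<in> carrier R" and y: "y \<in> carrier R" "y \<noteq> \<zero>"
    and c: "c \<in> carrier R" "c \<noteq> \<zero>"
  shows "pole_bounded R T D (c \<otimes> x) (c \<otimes> y) \<longleftrightarrow> pole_bounded R T D x y"
proof (cases "x = \<zero>")
  case True
  then show ?thesis using c by (simp add: pole_bounded_def)
next
  case False
  have "c \<otimes> x \<noteq> \<zero>" using False c x by (simp add: integral_iff)
  moreover have "ord Q (c \<otimes> x) = ord Q c + ord Q x" "ord Q (c \<otimes> y) = ord Q c + ord Q y" if "Q \<in> T" for Q
    using that T ord_mult[of Q c x] ord_mult[of Q c y] c x y False by auto
  ultimately show ?thesis using False by (auto simp: pole_bounded_def)
qed

lemma mem_pole_bounded_fracs: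
  assumes T: "T \<subseteq> {Q. height_one R Q}" and x: "x \<in> carrier R" and y: "y \<in> carrier R" "y \<noteq> \<zero>"
  shows "loc_frac R (nonzerodivisors R) x y \<in> pole_bounded_fracs R T D \<longleftrightarrow> pole_bounded R T D x y"
proof
  interpret K: fractions R "nonzerodivisors R" by (rule fractions_nonzerodivisors)
  assume "K.frac x y \<in> pole_bounded_fracs R T D"
  then obtain x' y' where x': "K.frac x y = K.frac x' y'" "x' \<in> carrier R" "y' \<in> carrier R" "y' \<noteq> \<zero>"
    "pole_bounded R T D x' y'"
    unfolding pole_bounded_fracs_def by blast
  have "y' \<otimes> x = y \<otimes> x'"
    using x'(1-4) x y K.frac_eq_domain[OF domain_axioms zero_not_nonzerodivisor, of x y x' y']
    by (simp add: nonzerodivisors_domain)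
  moreover have "pole_bounded R T D (y \<otimes> x') (y \<otimes> y')"
    using pole_bounded_cancel[OF T x'(2-4) y] x'(5) by simp
  ultimately have "pole_bounded R T D (y' \<otimes> x) (y' \<otimes> y)"
    using y x' m_comm[of y y'] by simp
  then show "pole_bounded R T D x y"
    using pole_bounded_cancel[OF T x y x'(3,4)] by simp
qed (use x y in \<open>auto simp: pole_bounded_fracs_def\<close>)

lemma total_frac_casesD:
  assumes "g \<in> carrier (total_frac R)"
  obtains x y where "x \<in> carrier R" "y \<in> carrier R" "y \<noteq> \<zero>" "g = loc_frac R (nonzerodivisors R) x y"
  using assms
proof (rule total_frac_cases)
  fix x y assume *: "x \<in> carrier R" "y \<in> nonzerodivisors R" "g = loc_frac R (nonzerodivisors R) x y"
  then show ?thesis using that[of x y] by (simp add: nonzerodivisors_domain)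
qed

lemma frac_submodule_pole_bounded:
  assumes T: "T \<subseteq> {Q. height_one R Q}"
  shows "frac_submodule R (pole_bounded_fracs R T D)"
proof -
  interpret K: fractions R "nonzerodivisors R" by (rule fractions_nonzerodivisors)
  have nzd: "y \<in> nonzerodivisors R \<longleftrightarrow> y \<in> carrier R \<and> y \<noteq> \<zero>" for y
    by (simp add: nonzerodivisors_domain)
  have closed: "g \<in> carrier (total_frac R)" if "g \<in> pole_bounded_fracs R T D" for g
    using that unfolding pole_bounded_fracs_def total_frac_def by (auto simp: nzd)
  have zero: "\<zero>\<^bsub>total_frac R\<^esub> \<in> pole_bounded_fracs R T D"
    unfolding total_frac_def K.zero_frac
    using mem_pole_bounded_fracs[OF T, of \<zero> \<one>] by (simp add: pole_bounded_def)
  have add: "g \<oplus>\<^bsub>total_frac R\<^esub> g' \<in> pole_bounded_fracs R T D"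
    if g: "g \<in> pole_bounded_fracs R T D" and g': "g' \<in> pole_bounded_fracs R T D" for g g'
  proof -
    obtain x y where x: "g = K.frac x y" "x \<in> carrier R" "y \<in> carrier R" "y \<noteq> \<zero>" "pole_bounded R T D x y"
      using g unfolding pole_bounded_fracs_def by blast
    obtain x' y' where x': "g' = K.frac x' y'" "x' \<in> carrier R" "y' \<in> carrier R" "y' \<noteq> \<zero>"
      "pole_bounded R T D x' y'"
      using g' unfolding pole_bounded_fracs_def by blast
    have eq: "g \<oplus>\<^bsub>total_frac R\<^esub> g' = K.frac (y' \<otimes> x \<oplus> y \<otimes> x') (y \<otimes> y')"
      unfolding total_frac_def x(1) x'(1) using x x' by (intro K.add_frac) (simp_all add: nzd)
    have "pole_bounded R T D (y' \<otimes> x) (y' \<otimes> y)"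
      using pole_bounded_cancel[OF T x(2-4) x'(3,4)] x(5) by simp
    moreover have "pole_bounded R T D (y \<otimes> x') (y \<otimes> y')"
      using pole_bounded_cancel[OF T x'(2-4) x(3,4)] x'(5) by simp
    ultimately have "pole_bounded R T D (y' \<otimes> x \<oplus> y \<otimes> x') (y \<otimes> y')"
      using x x' m_comm[of y y'] by (intro pole_bounded_add[OF T]) simp_all
    moreover have "y \<otimes> y' \<noteq> \<zero>" using x x' by (simp add: integral_iff)
    ultimately show ?thesis
      unfolding eq using x x' by (subst mem_pole_bounded_fracs[OF T]) simp_all
  qed
  have smult: "to_frac R r \<otimes>\<^bsub>total_frac R\<^esub> g \<in> pole_bounded_fracs R T D"
    if r: "r \<in> carrier R" and g: "g \<in> pole_bounded_fracs R T D" for r g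
  proof -
    obtain x y where x: "g = K.frac x y" "x \<in> carrier R" "y \<in> carrier R" "y \<noteq> \<zero>" "pole_bounded R T D x y"
      using g unfolding pole_bounded_fracs_def by blast
    have eq: "to_frac R r \<otimes>\<^bsub>total_frac R\<^esub> g = K.frac (r \<otimes> x) y"
      unfolding total_frac_def to_frac_def x(1) using x r by (simp add: K.mult_frac nzd)
    have "pole_bounded R T D (r \<otimes> x) y" by (rule pole_bounded_mult[OF T x(2,5) r])
    then show ?thesis unfolding eq using x r by (subst mem_pole_bounded_fracs[OF T]) simp_all
  qed
  show ?thesis
    unfolding frac_submodule_def using closed zero add smult by blast
qed

lemma divisible_iff_pole_bounded:
  assumes x: "x \<in> carrier R" and y: "y \<in> carrier R" "y \<noteq> \<zero>"
  shows "pole_bounded R {Q. height_one R Q} (\<lambda>_. 0) x y \<longleftrightarrow> x \<in> PIdl y"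
proof
  assume b: "pole_bounded R {Q. height_one R Q} (\<lambda>_. 0) x y"
  show "x \<in> PIdl y"
  proof (cases "x = \<zero>")
    case True
    have "\<zero> = \<zero> \<otimes> y" using y by simp
    then show ?thesis unfolding True mem_cgenideal_iff using zero_closed by blast
  next
    case False
    show ?thesis
      by (rule divides_if_order_le[OF normal y x False]) (use b False in \<open>auto simp: pole_bounded_def\<close>)
  qed
next
  assume "x \<in> PIdl y"
  then obtain r where r: "r \<in> carrier R" "x = r \<otimes> y" unfolding mem_cgenideal_iff by blast
  then show "pole_bounded R {Q. height_one R Q} (\<lambda>_. 0) x y"
    using pole_bounded_mult[of "{Q. height_one R Q}" y "\<lambda>_. 0" y r] y by (simp add: pole_bounded_def)
qed

text \<open>The two cases in the definition of \<open>sections\<close> agree by \<open>divides_if_order_le\<close>.\<close>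

lemma sections_eq: "sections R D = pole_bounded_fracs R {Q. height_one R Q} D"
proof -
  interpret K: fractions R "nonzerodivisors R" by (rule fractions_nonzerodivisors)
  have nzd: "y \<in> nonzerodivisors R \<longleftrightarrow> y \<in> carrier R \<and> y \<noteq> \<zero>" for y
    by (simp add: nonzerodivisors_domain)
  have "K.frac x y \<in> sections R D \<longleftrightarrow> pole_bounded R {Q. height_one R Q} D x y"
    if x: "x \<in> carrier R" and y: "y \<in> carrier R" "y \<noteq> \<zero>" for x y
  proof (cases "D = (\<lambda>_. 0)")
    case True
    have "K.frac x y = K.frac r \<one> \<longleftrightarrow> x = r \<otimes> y" if "r \<in> carrier R" for r
      using K.frac_eq_domain[OF domain_axioms zero_not_nonzerodivisor, of x y r \<one>] that x y m_comm[of r y]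
      by (simp add: nzd)
    then have "K.frac x y \<in> sections R D \<longleftrightarrow> x \<in> PIdl y"
      unfolding True sections_zero mem_cgenideal_iff to_frac_def by auto
    then show ?thesis using divisible_iff_pole_bounded[OF x y] True by simp
  next
    case False
    have zero: "K.frac x y = \<zero>\<^bsub>total_frac R\<^esub> \<longleftrightarrow> x = \<zero>"
      using K.frac_eq_domain[OF domain_axioms zero_not_nonzerodivisor, of x y \<zero> \<one>] x y
      unfolding total_frac_def K.zero_frac by (simp add: nzd)
    have val: "divisor_valuation R Q (K.frac x y) = int (ord Q x) - int (ord Q y)"
      if "height_one R Q" "x \<noteq> \<zero>" for Q
    proof -
      obtain \<pi> where "valuation_prime R Q \<pi>"
        using height_one_valuation_prime[OF normal \<open>height_one R Q\<close>] by blast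
      then show ?thesis by (rule valuation_prime.divisor_valuation_eq[OF _ x that(2) y])
    qed
    have closed: "K.frac x y \<in> carrier (total_frac R)"
      unfolding total_frac_def using x y by (simp add: nzd)
    have "K.frac x y \<in> sections R D \<longleftrightarrow> x = \<zero> \<or>
        (\<forall>Q\<in>{Q. height_one R Q}. 0 \<le> divisor_valuation R Q (K.frac x y) + D Q)"
      using False closed zero by (auto simp: sections_def mem_prime_divisors_iff)
    also have "\<dots> \<longleftrightarrow> pole_bounded R {Q. height_one R Q} D x y"
      unfolding pole_bounded_def using val by (cases "x = \<zero>") auto
    finally show ?thesis .
  qed
  then have iff: "K.frac x y \<in> sections R D \<longleftrightarrow> K.frac x y \<in> pole_bounded_fracs R {Q. height_one R Q} D"
    if "x \<in> carrier R" "y \<in> carrier R" "y \<noteq> \<zero>" for x y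
    using that by (simp add: mem_pole_bounded_fracs)
  have sub: "sections R D \<subseteq> carrier (total_frac R)"
    unfolding sections_def using ring_hom_closed[OF to_frac_hom] by auto
  have sub': "pole_bounded_fracs R {Q. height_one R Q} D \<subseteq> carrier (total_frac R)"
    using frac_submodule_pole_bounded[of "{Q. height_one R Q}" D] unfolding frac_submodule_def by blast
  have "g \<in> sections R D \<longleftrightarrow> g \<in> pole_bounded_fracs R {Q. height_one R Q} D"
    if "g \<in> sections R D \<or> g \<in> pole_bounded_fracs R {Q. height_one R Q} D" for g
  proof -
    have "g \<in> carrier (total_frac R)" using that sub sub' by blast
    then obtain x y where "x \<in> carrier R" "y \<in> carrier R" "y \<noteq> \<zero>" "g = K.frac x y"
      by (rule total_frac_casesD)
    then show ?thesis using iff[of x y] by simp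
  qed
  then show ?thesis by blast
qed

lemma frac_submodule_sections: "frac_submodule R (sections R D)"
  unfolding sections_eq by (rule frac_submodule_pole_bounded) simp

lemma common_pole_bound:
  assumes "finite F" "F \<subseteq> {Q. height_one R Q}" "\<And>Q. 0 \<le> D Q"
  shows "\<exists>c\<in>carrier R. c \<noteq> \<zero> \<and> (\<forall>Q\<in>F. D Q \<le> int (ord Q c))"
  using assms(1,2)
proof (induction F)
  case empty
  then show ?case using one_closed one_not_zero by blast
next
  case (insert Q F)
  then obtain c where c: "c \<in> carrier R" "c \<noteq> \<zero>" "\<forall>Q\<in>F. D Q \<le> int (ord Q c)" by auto
  have h: "height_one R Q" using insert.prems by blast
  then interpret Q: primeideal Q R by (simp add: height_one_def)
  obtain q where q: "q \<in> Q" "q \<noteq> \<zero>" using h Q.zero_closed unfolding height_one_def by blast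
  have qc: "q \<in> carrier R" using q Q.Icarr by blast
  have pow: "q [^] n \<noteq> \<zero> \<and> n \<le> ord Q (q [^] n)" for n :: nat
  proof (induction n)
    case (Suc n)
    have "1 \<le> ord Q q" using ord_pos_iff[OF h qc q(2)] q(1) by simp
    then show ?case using Suc q qc ord_mult[OF h, of "q [^] n" q] by (simp add: integral_iff)
  qed simp
  obtain n where n: "D Q = int n" using assms(3)[of Q] nonneg_int_cases by metis
  define d where "d = q [^] n"
  have d: "d \<in> carrier R" "d \<noteq> \<zero>" "D Q \<le> int (ord Q d)"
    using pow[of n] qc by (simp_all add: d_def n)
  have "D Q' \<le> int (ord Q' (c \<otimes> d))" if Q': "Q' \<in> insert Q F" for Q'
  proof -
    have "height_one R Q'" using Q' insert.prems by blast
    then have "ord Q' (c \<otimes> d) = ord Q' c + ord Q' d" using ord_mult c d by blast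
    then show ?thesis using Q' c(3) d(3) by auto
  qed
  moreover have "c \<otimes> d \<in> carrier R" "c \<otimes> d \<noteq> \<zero>" using c d by (auto simp: integral_iff)
  ultimately show ?case by blast
qed

text \<open>If \<open>c\<close> vanishes to order at least \<open>D Q\<close> at every \<open>Q\<close>, then \<open>R(D) \<subseteq> (1/c)R\<close>, and the numerators form an
  ideal of \<open>R\<close>.\<close>

lemma finitely_generated_sections:
  assumes fin: "finite {Q. D Q \<noteq> 0}" "{Q. D Q \<noteq> 0} \<subseteq> {Q. height_one R Q}" and D: "\<And>Q. 0 \<le> D Q"
  shows "finitely_generated R (sections_module R D)"
proof -
  interpret K: fractions R "nonzerodivisors R" by (rule fractions_nonzerodivisors)
  interpret KR: cring "total_frac R" by (rule cring_total_frac)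
  have nzd: "y \<in> nonzerodivisors R \<longleftrightarrow> y \<in> carrier R \<and> y \<noteq> \<zero>" for y
    by (simp add: nonzerodivisors_domain)
  let ?H = "{Q. height_one R Q}"
  obtain c where c: "c \<in> carrier R" "c \<noteq> \<zero>" "\<forall>Q\<in>{Q. D Q \<noteq> 0}. D Q \<le> int (ord Q c)"
    using common_pole_bound[where D = D, OF fin D] by (elim bexE conjE)
  have cD: "D Q \<le> int (ord Q c)" for Q
    using c(3) by (cases "D Q = 0") auto
  define I where "I = {r \<in> carrier R. pole_bounded R ?H D r c}"
  have "ideal I R"
  proof (rule idealI_mult_closed)
    show "I \<noteq> {}" using zero_closed unfolding I_def pole_bounded_def by blast
    show "x \<oplus> y \<in> I" if "x \<in> I" "y \<in> I" for x y
      using that pole_bounded_add[of ?H x D c y] by (auto simp: I_def)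
    show "r \<otimes> x \<in> I" if "r \<in> carrier R" "x \<in> I" for r x
      using that pole_bounded_mult[of ?H x D c r] by (auto simp: I_def)
  qed (auto simp: I_def)
  then obtain A where A: "A \<subseteq> carrier R" "finite A" "I = Idl A" using finetely_gen by blast
  have AI: "A \<subseteq> I" unfolding A(3) by (rule genideal_self[OF A(1)])
  have frac_mem: "K.frac a c \<in> sections R D \<longleftrightarrow> a \<in> I" if "a \<in> carrier R" for a
    unfolding sections_eq I_def using mem_pole_bounded_fracs[of ?H a c D] that c by simp
  have "generates R (sections_module R D) ((\<lambda>a. K.frac a c) ` A)"
  proof (rule generatesI)
    show "(\<lambda>a. K.frac a c) ` A \<subseteq> carrier (sections_module R D)"
      using frac_mem A(1) AI by auto
    fix T
    assume T: "(\<lambda>a. K.frac a c) ` A \<subseteq> T" "\<zero>\<^bsub>sections_module R D\<^esub> \<in> T"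
      and add: "\<And>x y. \<lbrakk>x \<in> T; y \<in> T\<rbrakk> \<Longrightarrow> x \<oplus>\<^bsub>sections_module R D\<^esub> y \<in> T"
      and smult: "\<And>r x. \<lbrakk>r \<in> carrier R; x \<in> T\<rbrakk> \<Longrightarrow> r \<odot>\<^bsub>sections_module R D\<^esub> x \<in> T"
    define J where "J = {r \<in> carrier R. K.frac r c \<in> T}"
    have frac_smult: "K.frac (r \<otimes> x) c = r \<odot>\<^bsub>sections_module R D\<^esub> K.frac x c"
      if "r \<in> carrier R" "x \<in> carrier R" for r x
      unfolding sections_module_simps total_frac_def to_frac_def using that c by (simp add: K.mult_frac nzd)
    have "ideal J R"
    proof (rule idealI_mult_closed)
      have "K.frac \<zero> c = \<zero>\<^bsub>total_frac R\<^esub>"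
        unfolding total_frac_def K.zero_frac using c by (intro K.frac_eqI) (simp_all add: nzd)
      then have "K.frac \<zero> c \<in> T" using T(2) by simp
      then show "J \<noteq> {}" using zero_closed unfolding J_def by blast
      show "x \<oplus> y \<in> J" if "x \<in> J" "y \<in> J" for x y
      proof -
        have "K.frac (x \<oplus> y) c = K.frac x c \<oplus>\<^bsub>sections_module R D\<^esub> K.frac y c"
          unfolding sections_module_simps total_frac_def
          using that c by (subst K.frac_add_same) (simp_all add: nzd J_def)
        then show ?thesis using add[of "K.frac x c" "K.frac y c"] that by (simp add: J_def)
      qed
      show "r \<otimes> x \<in> J" if "r \<in> carrier R" "x \<in> J" for r x
        using that smult[of r "K.frac x c"] frac_smult[of r x] by (simp add: J_def)
    qed (auto simp: J_def)
    moreover have "A \<subseteq> J" using A(1) T(1) by (auto simp: J_def)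
    ultimately have IJ: "I \<subseteq> J" unfolding A(3) by (rule genideal_minimal)
    show "carrier (sections_module R D) \<subseteq> T"
    proof
      fix g assume "g \<in> carrier (sections_module R D)"
      then obtain x y where x: "g = K.frac x y" "x \<in> carrier R" "y \<in> carrier R" "y \<noteq> \<zero>"
        "pole_bounded R ?H D x y"
        unfolding sections_module_simps sections_eq pole_bounded_fracs_def by blast
      have "pole_bounded R ?H (\<lambda>_. 0) (c \<otimes> x) y"
      proof (cases "x = \<zero>")
        case True
        then show ?thesis using c by (simp add: pole_bounded_def)
      next
        case False
        have "int (ord Q y) \<le> int (ord Q (c \<otimes> x))" if Q: "height_one R Q" for Q
        proof -
          have "int (ord Q y) \<le> int (ord Q x) + D Q" using x(5) Q False by (simp add: pole_bounded_def)
          then show ?thesis using ord_mult[OF Q c(1,2) x(2) False] cD[of Q] by simp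
        qed
        then show ?thesis by (simp add: pole_bounded_def)
      qed
      then obtain r where r: "r \<in> carrier R" "c \<otimes> x = r \<otimes> y"
        using divisible_iff_pole_bounded[of "c \<otimes> x" y] c x unfolding mem_cgenideal_iff by auto
      have "g = K.frac r c"
        unfolding x(1) using x r c m_comm[of r y] by (intro K.frac_eqI) (simp_all add: nzd)
      moreover have "g \<in> sections R D" using \<open>g \<in> carrier (sections_module R D)\<close> by simp
      ultimately have "r \<in> I" using frac_mem[OF r(1)] by simp
      then show "g \<in> T" using IJ \<open>g = K.frac r c\<close> by (auto simp: J_def)
    qed
  qed
  then show ?thesis unfolding finitely_generated_def using A(2) by blast
qed

end

section \<open>Localization of sections\<close>

locale normal_localization = normal_noetherian R + fractions R S for R (structure) and S +
  assumes zero_notin: "\<zero> \<notin> S"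
begin

text \<open>The extensions of these primes are the height one primes of \<open>S\<^sup>-\<^sup>1 R\<close>.\<close>

definition surviving_primes :: "'a set set" where
  "surviving_primes = {Q. height_one R Q \<and> Q \<inter> S = {}}"

lemma surviving_height_one: "surviving_primes \<subseteq> {Q. height_one R Q}"
  by (auto simp: surviving_primes_def)

text \<open>Let \<open>g = x/y\<close> and \<open>J = {r. rg \<in> R(D)}\<close>. If \<open>J\<close> avoids \<open>S\<close>, there is a prime \<open>P = (J : z)\<close> that avoids \<open>S\<close>.
  Since \<open>zg\<close> is not a section, its pole at some \<open>Q\<close> of height one exceeds \<open>D Q\<close>. Every \<open>r \<in> P\<close> makes
  \<open>rzg\<close> a section, so \<open>r\<close> vanishes at \<open>Q\<close>; this shows \<open>P \<subseteq> Q\<close>, hence \<open>P = Q\<close>. So \<open>Q\<close> avoids \<open>S\<close>, but there the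
  poles of \<open>g\<close> are bounded by assumption.\<close>

lemma clear_poles:
  assumes x: "x \<in> carrier R" and y: "y \<in> carrier R" "y \<noteq> \<zero>" and D: "\<And>Q. 0 \<le> D Q"
    and b: "pole_bounded R surviving_primes D x y"
  shows "\<exists>s\<in>S. pole_bounded R {Q. height_one R Q} D (s \<otimes> x) y"
proof (cases "x = \<zero>")
  case True
  then show ?thesis using S_one by (auto simp: pole_bounded_def intro!: bexI[of _ \<one>])
next
  case x0: False
  let ?H = "{Q. height_one R Q}"
  define J where "J = {r \<in> carrier R. pole_bounded R ?H D (r \<otimes> x) y}"
  have J: "ideal J R"
  proof (rule idealI_mult_closed)
    have "\<zero> \<otimes> x = \<zero>" using x by simp
    then show "J \<noteq> {}" using zero_closed unfolding J_def pole_bounded_def by blast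
    show "a \<oplus> a' \<in> J" if "a \<in> J" "a' \<in> J" for a a'
      using that x pole_bounded_add[of ?H "a \<otimes> x" D y "a' \<otimes> x"] by (auto simp: J_def l_distr)
    show "r \<otimes> a \<in> J" if "r \<in> carrier R" "a \<in> J" for r a
      using that x pole_bounded_mult[of ?H "a \<otimes> x" D y r] by (auto simp: J_def m_assoc)
  qed (auto simp: J_def)
  have "J \<inter> S \<noteq> {}"
  proof
    assume "J \<inter> S = {}"
    then obtain z where z: "z \<in> carrier R" "primeideal {r \<in> carrier R. r \<otimes> z \<in> J} R"
      "{r \<in> carrier R. r \<otimes> z \<in> J} \<inter> S = {}"
      by (rule associated_prime[OF noetherian_ring_axioms J])
    define P where "P = {r \<in> carrier R. r \<otimes> z \<in> J}"
    have memP: "r \<in> P \<longleftrightarrow> r \<in> carrier R \<and> r \<otimes> z \<in> J" for r unfolding P_def by simp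
    have memJ: "r \<in> J \<longleftrightarrow> r \<in> carrier R \<and> pole_bounded R ?H D (r \<otimes> x) y" for r
      unfolding J_def by simp
    have primeP: "primeideal P R" unfolding P_def by (rule z(2))
    have oneP: "\<one> \<notin> P"
      using primeP ideal.one_imp_carrier[of P R] unfolding primeideal_def primeideal_axioms_def by blast
    have "z \<notin> J"
    proof
      assume "z \<in> J"
      then have "\<one> \<in> P" using z(1) by (simp add: memP)
      then show False using oneP by blast
    qed
    then have nb: "\<not> pole_bounded R ?H D (z \<otimes> x) y" using z(1) by (simp add: memJ)
    then have zx0: "z \<otimes> x \<noteq> \<zero>" by (auto simp: pole_bounded_def)
    then have z0: "z \<noteq> \<zero>" using x by auto
    have zx: "z \<otimes> x \<in> carrier R" using z x by simp
    obtain Q where Q: "height_one R Q" "\<not> int (ord Q y) \<le> int (ord Q (z \<otimes> x)) + D Q"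
      using nb unfolding pole_bounded_def by blast
    have "P \<subseteq> Q"
    proof
      fix r assume "r \<in> P"
      then have r: "r \<in> carrier R" "pole_bounded R ?H D (r \<otimes> z \<otimes> x) y"
        by (simp_all add: memP memJ)
      show "r \<in> Q"
      proof (cases "r = \<zero>")
        case True
        then show ?thesis using Q(1) primeideal_zero_mem[of Q R] by (simp add: height_one_def)
      next
        case False
        have eq: "r \<otimes> z \<otimes> x = r \<otimes> (z \<otimes> x)" using r z x by (simp add: m_assoc)
        have "r \<otimes> (z \<otimes> x) \<noteq> \<zero>" using False zx0 r zx by (simp add: integral_iff)
        then have "int (ord Q y) \<le> int (ord Q (r \<otimes> (z \<otimes> x))) + D Q"
          using r(2) Q(1) unfolding eq pole_bounded_def by auto
        also have "ord Q (r \<otimes> (z \<otimes> x)) = ord Q r + ord Q (z \<otimes> x)"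
          by (rule ord_mult[OF Q(1) r(1) False zx zx0])
        finally have "0 < ord Q r" using Q(2) by linarith
        then show ?thesis using ord_pos_iff[OF Q(1) r(1) False] by blast
      qed
    qed
    moreover have "P \<noteq> {\<zero>}"
    proof -
      have "pole_bounded R ?H D (z \<otimes> x \<otimes> y) y"
        unfolding pole_bounded_def using ord_mult[OF _ zx zx0 y] D by simp
      moreover have "z \<otimes> x \<otimes> y = y \<otimes> z \<otimes> x" using z x y by (simp add: m_ac)
      ultimately have "y \<in> P" using y(1) z(1) by (simp add: memP memJ)
      then show ?thesis using y by blast
    qed
    ultimately have PQ: "P = Q" using Q(1) primeP unfolding height_one_def by blast
    have "Q \<in> surviving_primes" using Q(1) z(3) PQ unfolding surviving_primes_def P_def by blast
    then have "int (ord Q y) \<le> int (ord Q x) + D Q" using b x0 by (auto simp: pole_bounded_def)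
    then show False using Q(2) ord_mult[OF Q(1) z(1) z0 x x0] by simp
  qed
  then show ?thesis by (auto simp: J_def)
qed

lemma height_one_localization_iff:
  "height_one L Q' \<longleftrightarrow> (\<exists>Q\<in>surviving_primes. Q' = ext_ideal Q)"
proof
  interpret LD: domain L by (rule domain_localization[OF domain_axioms zero_notin])
  {
    assume h: "height_one L Q'"
    then have Q': "primeideal Q' L" by (simp add: height_one_def)
    define Q where "Q = contraction Q'"
    have Qp: "primeideal Q R" unfolding Q_def by (rule primeideal_contraction[OF Q'])
    have disj: "Q \<inter> S = {}" unfolding Q_def by (rule contraction_disjoint[OF Q'])
    have ext: "ext_ideal Q = Q'"
      unfolding Q_def using Q' by (intro ext_contraction) (simp add: primeideal_def)
    have "height_one R Q"
      unfolding height_one_def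
    proof (intro conjI allI impI)
      show "primeideal Q R" by (rule Qp)
      show "Q \<noteq> {\<zero>}"
      proof
        assume "Q = {\<zero>}"
        then have "Q' \<subseteq> {\<zero>\<^bsub>L\<^esub>}"
          unfolding ext[symmetric] ext_ideal_def using frac_zero_iff[OF zero_closed] S_one by auto
        then show False using h primeideal_zero_mem[OF Q'] unfolding height_one_def by blast
      qed
      fix Q1 assume Q1: "primeideal Q1 R \<and> Q1 \<subseteq> Q"
      then have d1: "Q1 \<inter> S = {}" using disj by blast
      have "ext_ideal Q1 \<subseteq> Q'" unfolding ext[symmetric] ext_ideal_def using Q1 by blast
      then have "ext_ideal Q1 = {\<zero>\<^bsub>L\<^esub>} \<or> ext_ideal Q1 = Q'"
        using h primeideal_ext[OF conjunct1[OF Q1] d1] unfolding height_one_def by blast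
      then show "Q1 = {\<zero>} \<or> Q1 = Q"
      proof
        assume "ext_ideal Q1 = Q'"
        then show ?thesis
          using contraction_ext[OF conjunct1[OF Q1] d1] unfolding Q_def by simp
      next
        assume e: "ext_ideal Q1 = {\<zero>\<^bsub>L\<^esub>}"
        have "x = \<zero>" if "x \<in> Q1" for x
        proof -
          have xc: "x \<in> carrier R"
            using that Q1 ideal.Icarr[of Q1 R x] by (simp add: primeideal_def)
          have "frac x \<one> \<in> ext_ideal Q1" unfolding ext_ideal_def using that S_one by blast
          then have "frac x \<one> = frac \<zero> \<one>" unfolding e zero_frac by simp
          then show ?thesis
            using frac_eq_domain[OF domain_axioms zero_notin xc S_one zero_closed S_one] xc by simp
        qed
        then have "Q1 = {\<zero>}" using primeideal_zero_mem[OF conjunct1[OF Q1]] by blast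
        then show ?thesis ..
      qed
    qed
    then show "\<exists>Q\<in>surviving_primes. Q' = ext_ideal Q"
      using disj ext unfolding surviving_primes_def by blast
  }
  {
    assume "\<exists>Q\<in>surviving_primes. Q' = ext_ideal Q"
    then obtain Q where Q: "height_one R Q" "Q \<inter> S = {}" "Q' = ext_ideal Q"
      unfolding surviving_primes_def by blast
    obtain \<pi> where "valuation_prime R Q \<pi>" using height_one_valuation_prime[OF normal Q(1)] by blast
    then have "valuation_prime L (ext_ideal Q) (frac \<pi> \<one>)"
      by (rule valuation_prime_localization) (rule Q(2))
    then show "height_one L Q'" unfolding Q(3) by (rule valuation_prime.height_one)
  }
qed

lemma total_frac_localization_cases:
  assumes "g \<in> carrier (total_frac L)"
  obtains x y where "x \<in> carrier R" "y \<in> carrier R" "y \<noteq> \<zero>"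
    "g = total_frac_map (loc_frac R (nonzerodivisors R) x y)"
proof -
  interpret LD: domain L by (rule domain_localization[OF domain_axioms zero_notin])
  interpret M: fractions L "nonzerodivisors L" by (rule LD.fractions_nonzerodivisors)
  obtain U V where U: "U \<in> carrier L" "V \<in> nonzerodivisors L" "g = M.frac U V"
    using assms by (rule LD.total_frac_cases)
  have V: "V \<in> carrier L" "V \<noteq> \<zero>\<^bsub>L\<^esub>" using U(2) by (simp_all add: LD.nonzerodivisors_domain)
  obtain x s where x: "x \<in> carrier R" "s \<in> S" "U = frac x s" using U(1) by (rule frac_cases)
  obtain y t where y: "y \<in> carrier R" "t \<in> S" "V = frac y t" using V(1) by (rule frac_cases)
  have "y \<noteq> \<zero>"
  proof
    assume "y = \<zero>"
    then have "\<one> \<otimes> y = \<zero>" by simp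
    then show False using V(2) y S_one frac_zero_iff[OF y(1,2)] by blast
  qed
  moreover have "s \<noteq> \<zero>" using x(2) zero_notin by blast
  ultimately have sy: "s \<otimes> y \<in> carrier R" "s \<otimes> y \<noteq> \<zero>" using x y by (simp_all add: integral_iff)
  then have nz: "s \<otimes> y \<in> nonzerodivisors R" by (simp add: nonzerodivisors_domain)
  have "g = M.frac (frac (t \<otimes> x) \<one>) (frac (s \<otimes> y) \<one>)"
    unfolding U(3)
  proof (rule M.frac_eqI)
    show "frac (s \<otimes> y) \<one> \<otimes>\<^bsub>L\<^esub> U = V \<otimes>\<^bsub>L\<^esub> frac (t \<otimes> x) \<one>"
      unfolding x(3) y(3) using x y S_one
      by (simp add: mult_frac) (intro frac_eqI, auto simp: m_ac)
  qed (use U x y S_one nonzerodivisor_base[OF nz] in auto)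
  also have "\<dots> = total_frac_map (loc_frac R (nonzerodivisors R) (t \<otimes> x) (s \<otimes> y))"
    using x y by (intro total_frac_map_frac[symmetric] nz) simp
  finally show ?thesis using that[of "t \<otimes> x" "s \<otimes> y"] sy x y by simp
qed

end

text \<open>The divisor \<open>D'\<close> is the restriction of the effective divisor \<open>D\<close> to \<open>Spec S\<^sup>-\<^sup>1 R\<close>.\<close>

locale divisor_localization = normal_localization R S for R (structure) and S +
  fixes D :: "'a set \<Rightarrow> int" and D' :: "('a \<times> 'a) set set \<Rightarrow> int"
  assumes D_nonneg: "0 \<le> D Q"
    and D'_ext: "Q \<in> surviving_primes \<Longrightarrow> D' (ext_ideal Q) = D Q"
    and D'_off: "\<not> height_one L Q' \<Longrightarrow> D' Q' = 0"
begin

lemma pole_bounded_surviving_mult: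
  assumes s: "s \<in> S" and x: "x \<in> carrier R" "y \<in> carrier R" "y \<noteq> \<zero>"
  shows "pole_bounded R surviving_primes E (s \<otimes> x) y \<longleftrightarrow> pole_bounded R surviving_primes E x y"
proof (cases "x = \<zero>")
  case True
  then show ?thesis using s by (simp add: pole_bounded_def)
next
  case False
  have s0: "s \<noteq> \<zero>" using s zero_notin by blast
  have "ord Q (s \<otimes> x) = ord Q x" if "Q \<in> surviving_primes" for Q
  proof -
    have Q: "height_one R Q" "s \<notin> Q" using that s unfolding surviving_primes_def by blast+
    show ?thesis
      using ord_mult[OF Q(1) S_carr[OF s] s0 x(1) False] ord_eq_0[OF Q(1) S_carr[OF s] Q(2)] by simp
  qed
  moreover have "s \<otimes> x \<noteq> \<zero>" using False s0 x s by (simp add: integral_iff)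
  ultimately show ?thesis using False by (simp add: pole_bounded_def)
qed

text \<open>If \<open>D' = 0\<close>, the sections are the elements of \<open>S\<^sup>-\<^sup>1 R\<close>, and a fraction without poles at the surviving
  primes is one of them: by \<open>clear_poles\<close> for the zero divisor, some multiple by an element of \<open>S\<close> has
  no poles at all. If \<open>D' \<noteq> 0\<close>, membership is tested by orders, which are the same on \<open>R\<close> and
  \<open>S\<^sup>-\<^sup>1 R\<close>.\<close>

lemma mem_sections_localization:
  assumes x: "x \<in> carrier R" and y: "y \<in> carrier R" "y \<noteq> \<zero>"
  shows "total_frac_map (loc_frac R (nonzerodivisors R) x y) \<in> sections L D'
    \<longleftrightarrow> pole_bounded R surviving_primes D x y"
proof -
  interpret LD: domain L by (rule domain_localization[OF domain_axioms zero_notin])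
  interpret M: fractions L "nonzerodivisors L" by (rule LD.fractions_nonzerodivisors)
  have ynz: "y \<in> nonzerodivisors R" using y by (simp add: nonzerodivisors_domain)
  have zM: "\<zero>\<^bsub>L\<^esub> \<notin> nonzerodivisors L" by (simp add: LD.nonzerodivisors_domain)
  have base: "frac x \<one> \<in> carrier L" "frac y \<one> \<in> carrier L" "frac y \<one> \<in> nonzerodivisors L"
    using x y S_one nonzerodivisor_base[OF ynz] by simp_all
  have nonzero: "frac a \<one> = \<zero>\<^bsub>L\<^esub> \<longleftrightarrow> a = \<zero>" if "a \<in> carrier R" for a
    using frac_eq_domain[OF domain_axioms zero_notin that S_one zero_closed S_one] that
    by (simp add: zero_frac)
  show ?thesis
  proof (cases "D' = (\<lambda>_. 0)")
    case True
    have D0: "D Q = 0" if "Q \<in> surviving_primes" for Q using D'_ext[OF that] True by simp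
    then have bD: "pole_bounded R surviving_primes D x y \<longleftrightarrow> pole_bounded R surviving_primes (\<lambda>_. 0) x y"
      unfolding pole_bounded_def by simp
    have "M.frac (frac x \<one>) (frac y \<one>) = to_frac L (frac r s) \<longleftrightarrow> s \<otimes> x = r \<otimes> y"
      if r: "r \<in> carrier R" "s \<in> S" for r s
    proof -
      have "M.frac (frac x \<one>) (frac y \<one>) = to_frac L (frac r s)
          \<longleftrightarrow> \<one>\<^bsub>L\<^esub> \<otimes>\<^bsub>L\<^esub> frac x \<one> = frac y \<one> \<otimes>\<^bsub>L\<^esub> frac r s"
        unfolding to_frac_def
        using M.frac_eq_domain[OF LD.domain_axioms zM base(1,3) frac_closed[OF r] M.S_one] .
      also have "\<dots> \<longleftrightarrow> frac x \<one> = frac (y \<otimes> r) s"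
        using base r y S_one by (simp add: mult_frac)
      also have "\<dots> \<longleftrightarrow> s \<otimes> x = r \<otimes> y"
        using frac_eq_domain[OF domain_axioms zero_notin x S_one, of "y \<otimes> r" s] r y m_comm[of y r] by simp
      finally show ?thesis .
    qed
    then have "M.frac (frac x \<one>) (frac y \<one>) \<in> sections L D' \<longleftrightarrow> (\<exists>s\<in>S. s \<otimes> x \<in> PIdl y)"
      unfolding True sections_zero mem_cgenideal_iff using frac_cases frac_closed
      by (smt (verit, best) imageE imageI)
    also have "\<dots> \<longleftrightarrow> (\<exists>s\<in>S. pole_bounded R {Q. height_one R Q} (\<lambda>_. 0) (s \<otimes> x) y)"
      using divisible_iff_pole_bounded[OF m_closed[OF S_carr x] y] by blast
    also have "\<dots> \<longleftrightarrow> pole_bounded R surviving_primes (\<lambda>_. 0) x y"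
    proof
      assume "pole_bounded R surviving_primes (\<lambda>_. 0) x y"
      then show "\<exists>s\<in>S. pole_bounded R {Q. height_one R Q} (\<lambda>_. 0) (s \<otimes> x) y"
        by (intro clear_poles[OF x y]) simp
    next
      assume "\<exists>s\<in>S. pole_bounded R {Q. height_one R Q} (\<lambda>_. 0) (s \<otimes> x) y"
      then obtain s where s: "s \<in> S" "pole_bounded R {Q. height_one R Q} (\<lambda>_. 0) (s \<otimes> x) y" by blast
      then have "pole_bounded R surviving_primes (\<lambda>_. 0) (s \<otimes> x) y"
        using surviving_height_one unfolding pole_bounded_def by blast
      then show "pole_bounded R surviving_primes (\<lambda>_. 0) x y"
        using pole_bounded_surviving_mult[OF s(1) x y] by blast
    qed
    finally show ?thesis unfolding bD total_frac_map_frac[OF x ynz] .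
  next
    case False
    have zero: "M.frac (frac x \<one>) (frac y \<one>) = \<zero>\<^bsub>total_frac L\<^esub> \<longleftrightarrow> x = \<zero>"
      using M.frac_eq_domain[OF LD.domain_axioms zM base(1,3) LD.zero_closed M.S_one] base nonzero[OF x]
      unfolding total_frac_def M.zero_frac by simp
    have closed: "M.frac (frac x \<one>) (frac y \<one>) \<in> carrier (total_frac L)"
      unfolding total_frac_def using base by simp
    have val: "divisor_valuation L (ext_ideal Q) (M.frac (frac x \<one>) (frac y \<one>)) = int (ord Q x) - int (ord Q y)"
      if Q: "Q \<in> surviving_primes" and x0: "x \<noteq> \<zero>" for Q
    proof -
      have h: "height_one R Q" and disj: "Q \<inter> S = {}" using Q by (simp_all add: surviving_primes_def)
      obtain \<pi> where V: "valuation_prime R Q \<pi>" using height_one_valuation_prime[OF normal h] by blast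
      have "divisor_valuation L (ext_ideal Q) (M.frac (frac x \<one>) (frac y \<one>))
          = int (order_along L (ext_ideal Q) (frac x \<one>)) - int (order_along L (ext_ideal Q) (frac y \<one>))"
        using nonzero[OF x] nonzero[OF y(1)] x0 y base
        by (intro valuation_prime.divisor_valuation_eq[OF valuation_prime_localization[OF V disj]]) simp_all
      then show ?thesis
        using order_localization[OF V disj x x0] order_localization[OF V disj y] by simp
    qed
    have "M.frac (frac x \<one>) (frac y \<one>) \<in> sections L D' \<longleftrightarrow> x = \<zero> \<or>
        (\<forall>Q'. height_one L Q' \<longrightarrow> 0 \<le> divisor_valuation L Q' (M.frac (frac x \<one>) (frac y \<one>)) + D' Q')"
      using False closed zero by (simp add: sections_def LD.mem_prime_divisors_iff Ball_def)
    also have "\<dots> \<longleftrightarrow> pole_bounded R surviving_primes D x y"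
      unfolding pole_bounded_def height_one_localization_iff using val D'_ext by (cases "x = \<zero>") auto
    finally show ?thesis unfolding total_frac_map_frac[OF x ynz] .
  qed
qed

lemma sections_localization_eq:
  "sections L D' = total_frac_map ` pole_bounded_fracs R surviving_primes D"
proof
  interpret LD: domain L by (rule domain_localization[OF domain_axioms zero_notin])
  show "sections L D' \<subseteq> total_frac_map ` pole_bounded_fracs R surviving_primes D"
  proof
    fix g assume g: "g \<in> sections L D'"
    then have "g \<in> carrier (total_frac L)"
      using ring_hom_closed[OF LD.to_frac_hom] by (auto simp: sections_def split: if_splits)
    then obtain x y where x: "x \<in> carrier R" "y \<in> carrier R" "y \<noteq> \<zero>"
      "g = total_frac_map (loc_frac R (nonzerodivisors R) x y)"
      by (rule total_frac_localization_cases)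
    then have "pole_bounded R surviving_primes D x y"
      using mem_sections_localization[OF x(1-3)] g by simp
    then show "g \<in> total_frac_map ` pole_bounded_fracs R surviving_primes D"
      unfolding x(4) using mem_pole_bounded_fracs[OF surviving_height_one x(1-3)] by blast
  qed
  show "total_frac_map ` pole_bounded_fracs R surviving_primes D \<subseteq> sections L D'"
    using mem_sections_localization unfolding pole_bounded_fracs_def by blast
qed

lemma frac_submodule_sections_localization: "frac_submodule L (sections L D')"
proof -
  interpret LD: domain L by (rule domain_localization[OF domain_axioms zero_notin])
  interpret K: fractions R "nonzerodivisors R" by (rule fractions_nonzerodivisors)
  interpret KR: cring "total_frac R" by (rule cring_total_frac)
  interpret KL: cring "total_frac L" by (rule LD.cring_total_frac)
  let ?N = "pole_bounded_fracs R surviving_primes D"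
  have sN: "frac_submodule R ?N" by (rule frac_submodule_pole_bounded[OF surviving_height_one])
  have sub: "a \<in> carrier (total_frac R)" if "a \<in> ?N" for a
    using that sN unfolding frac_submodule_def by blast
  have zero: "\<zero>\<^bsub>total_frac L\<^esub> \<in> sections L D'"
  proof -
    have "total_frac_map \<zero>\<^bsub>total_frac R\<^esub> = \<zero>\<^bsub>total_frac L\<^esub>"
      by (rule ring_hom_zero[OF total_frac_map_hom KR.ring_axioms KL.ring_axioms])
    moreover have "\<zero>\<^bsub>total_frac R\<^esub> \<in> ?N" using sN unfolding frac_submodule_def by blast
    ultimately show ?thesis unfolding sections_localization_eq by (metis imageI)
  qed
  have add: "g \<oplus>\<^bsub>total_frac L\<^esub> g' \<in> sections L D'" if g: "g \<in> sections L D'" "g' \<in> sections L D'" for g g'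
  proof -
    obtain a b where a: "a \<in> ?N" "g = total_frac_map a" and b: "b \<in> ?N" "g' = total_frac_map b"
      using g unfolding sections_localization_eq by blast
    have "a \<oplus>\<^bsub>total_frac R\<^esub> b \<in> ?N" using sN a b unfolding frac_submodule_def by blast
    moreover have "g \<oplus>\<^bsub>total_frac L\<^esub> g' = total_frac_map (a \<oplus>\<^bsub>total_frac R\<^esub> b)"
      using ring_hom_add[OF total_frac_map_hom sub[OF a(1)] sub[OF b(1)]] a(2) b(2) by simp
    ultimately show ?thesis unfolding sections_localization_eq by blast
  qed
  have smult: "to_frac L U \<otimes>\<^bsub>total_frac L\<^esub> g \<in> sections L D'" if U: "U \<in> carrier L" and g: "g \<in> sections L D'" for U g
  proof -
    interpret M: fractions L "nonzerodivisors L" by (rule LD.fractions_nonzerodivisors)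
    obtain r s where r: "r \<in> carrier R" "s \<in> S" "U = frac r s" using U by (rule frac_cases)
    obtain x y where x: "x \<in> carrier R" "y \<in> carrier R" "y \<noteq> \<zero>" "pole_bounded R surviving_primes D x y"
      "g = total_frac_map (K.frac x y)"
      using g unfolding sections_localization_eq pole_bounded_fracs_def by blast
    have s0: "s \<noteq> \<zero>" using r(2) zero_notin by blast
    have sy: "s \<otimes> y \<in> carrier R" "s \<otimes> y \<noteq> \<zero>" using x r s0 by (simp_all add: integral_iff)
    have nz: "y \<in> nonzerodivisors R" "s \<otimes> y \<in> nonzerodivisors R"
      using x sy by (simp_all add: nonzerodivisors_domain)
    note nzL = nz[THEN nonzerodivisor_base]
    have "to_frac L U \<otimes>\<^bsub>total_frac L\<^esub> g = M.frac (U \<otimes>\<^bsub>L\<^esub> frac x \<one>) (frac y \<one>)"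
      unfolding x(5) total_frac_map_frac[OF x(1) nz(1)] to_frac_def total_frac_def
      using U x S_one nzL by (simp add: M.mult_frac M.S_one)
    also have "\<dots> = M.frac (frac (r \<otimes> x) \<one>) (frac (s \<otimes> y) \<one>)"
    proof (rule M.frac_eqI)
      show "frac (s \<otimes> y) \<one> \<otimes>\<^bsub>L\<^esub> (U \<otimes>\<^bsub>L\<^esub> frac x \<one>) = frac y \<one> \<otimes>\<^bsub>L\<^esub> frac (r \<otimes> x) \<one>"
        unfolding r(3) using r x S_one S_mult
        by (simp add: mult_frac) (intro frac_eqI, auto simp: m_ac)
    qed (use U r x S_one nzL in simp_all)
    also have "\<dots> = total_frac_map (K.frac (r \<otimes> x) (s \<otimes> y))"
      using r x by (intro total_frac_map_frac[symmetric] nz) simp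
    finally have eq: "to_frac L U \<otimes>\<^bsub>total_frac L\<^esub> g = total_frac_map (K.frac (r \<otimes> x) (s \<otimes> y))" .
    have rx: "r \<otimes> x \<in> carrier R" using r x by simp
    have "pole_bounded R surviving_primes D (r \<otimes> x) y"
      by (rule pole_bounded_mult[OF surviving_height_one x(1,4) r(1)])
    then have "pole_bounded R surviving_primes D (s \<otimes> (r \<otimes> x)) (s \<otimes> y)"
      using pole_bounded_cancel[OF surviving_height_one rx x(2,3) S_carr[OF r(2)] s0] by blast
    then have "pole_bounded R surviving_primes D (r \<otimes> x) (s \<otimes> y)"
      using pole_bounded_surviving_mult[OF r(2) rx sy] by blast
    then show ?thesis unfolding eq using mem_sections_localization[OF rx sy] by blast
  qed
  have "sections L D' \<subseteq> carrier (total_frac L)"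
    unfolding sections_localization_eq using ring_hom_closed[OF total_frac_map_hom sub] by blast
  then show ?thesis unfolding frac_submodule_def using zero add smult by blast
qed

lemma localized_module_divisor:
  assumes p: "Factorial_Ring.prime (p::nat)" and char: "[p] \<cdot> \<one> = \<zero>"
  shows "localized_module R S (frob_push R p e (sections_module R D))
    (frob_push L p e (sections_module L D')) total_frac_map"
proof (rule localized_module_sections[OF p char])
  interpret LD: domain L by (rule domain_localization[OF domain_axioms zero_notin])
  interpret K: fractions R "nonzerodivisors R" by (rule fractions_nonzerodivisors)
  show "frac_submodule R (sections R D)" by (rule frac_submodule_sections)
  show "frac_submodule L (sections L D')" by (rule frac_submodule_sections_localization)
  show "total_frac_map g \<in> sections L D'" if g: "g \<in> sections R D" for g
  proof -
    obtain x y where x: "x \<in> carrier R" "y \<in> carrier R" "y \<noteq> \<zero>" "g = K.frac x y"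
      "pole_bounded R {Q. height_one R Q} D x y"
      using g unfolding sections_eq pole_bounded_fracs_def by blast
    have "pole_bounded R surviving_primes D x y"
      using x(5) surviving_height_one unfolding pole_bounded_def by blast
    then show ?thesis unfolding x(4) using mem_sections_localization[OF x(1-3)] by blast
  qed
  show "\<exists>s\<in>S. \<exists>g\<in>sections R D. to_frac L (frac s \<one>) \<otimes>\<^bsub>total_frac L\<^esub> g' = total_frac_map g"
    if g': "g' \<in> sections L D'" for g'
  proof -
    obtain x y where x: "x \<in> carrier R" "y \<in> carrier R" "y \<noteq> \<zero>" "g' = total_frac_map (K.frac x y)"
      "pole_bounded R surviving_primes D x y"
      using g' unfolding sections_localization_eq pole_bounded_fracs_def by blast
    obtain s where s: "s \<in> S" "pole_bounded R {Q. height_one R Q} D (s \<otimes> x) y"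
      using clear_poles[OF x(1-3) D_nonneg x(5)] by blast
    have nz: "y \<in> nonzerodivisors R" using x by (simp add: nonzerodivisors_domain)
    have Kc: "K.frac x y \<in> carrier (total_frac R)" unfolding total_frac_def using x nz by simp
    have "to_frac L (frac s \<one>) \<otimes>\<^bsub>total_frac L\<^esub> g' = total_frac_map (to_frac R s \<otimes>\<^bsub>total_frac R\<^esub> K.frac x y)"
      unfolding x(4) total_frac_map_to_frac[OF S_carr[OF s(1)], symmetric]
      by (rule ring_hom_mult[OF total_frac_map_hom ring_hom_closed[OF to_frac_hom S_carr[OF s(1)]] Kc, symmetric])
    also have "to_frac R s \<otimes>\<^bsub>total_frac R\<^esub> K.frac x y = K.frac (s \<otimes> x) y"
      unfolding total_frac_def to_frac_def using x s nz K.S_one by (simp add: K.mult_frac)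
    finally have "to_frac L (frac s \<one>) \<otimes>\<^bsub>total_frac L\<^esub> g' = total_frac_map (K.frac (s \<otimes> x) y)" .
    moreover have "K.frac (s \<otimes> x) y \<in> sections R D"
      unfolding sections_eq using s x mem_pole_bounded_fracs[of "{Q. height_one R Q}" "s \<otimes> x" y D] by simp
    ultimately show ?thesis using s(1) by blast
  qed
qed

end

section \<open>Centers of sharp F-purity and compatible primes\<close>

text \<open>The module in the definition of centers is the localization at \<open>P\<close> of the finitely generated
  module in the definition of compatible ideals.\<close>

lemma frob_sections_localization:
  fixes R (structure)
  assumes triple: "is_triple p R \<Delta> \<aa>" and P: "primeideal P R"
  obtains h where "localized_module R (carrier R - P) (frob_sections R p e \<Delta>)
      (frob_sections (local_ring_at R P) p e (restrict_divisor R P \<Delta>)) h"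
    "finitely_generated R (frob_sections R p e \<Delta>)"
    "\<And>x. x \<in> carrier R \<Longrightarrow> to_frac R x \<in> carrier (frob_sections R p e \<Delta>)"
    "\<And>x. x \<in> carrier R \<Longrightarrow> h (to_frac R x) = to_frac (local_ring_at R P) (to_local R P x)"
proof -
  interpret cring R using triple by (simp add: is_triple_def)
  interpret F: fractions R "carrier R - P" by (rule fractions_prime_complement[OF P])
  have p: "Factorial_Ring.prime p" and fF: "F_finite R p" and noeth: "noetherian_ring R"
    using triple by (simp_all add: is_triple_def)
  have char: "[p] \<cdot> \<one> = \<zero>"
    using triple by (simp add: is_triple_def has_characteristic_def)
  have h_to_frac: "F.total_frac_map (to_frac R x) = to_frac (local_ring_at R P) (to_local R P x)"
    if "x \<in> carrier R" for x
    using F.total_frac_map_to_frac[OF that] by (simp add: local_ring_at_def to_local_def)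
  show thesis
  proof (cases "\<Delta> = (\<lambda>_. 0)")
    case True
    have D: "frob_sections R p e \<Delta> = frob_push R p e (sections_module R (\<lambda>_. 0))"
      and D': "frob_sections (local_ring_at R P) p e (restrict_divisor R P \<Delta>)
        = frob_push F.L p e (sections_module F.L (\<lambda>_. 0))"
      by (simp_all add: frob_sections_def ceil_divisor_def restrict_divisor_def True local_ring_at_def)
    show thesis
    proof (rule that[of F.total_frac_map])
      show "localized_module R (carrier R - P) (frob_sections R p e \<Delta>)
          (frob_sections (local_ring_at R P) p e (restrict_divisor R P \<Delta>)) F.total_frac_map"
        unfolding D D' by (rule F.localized_module_sections_zero[OF p char])
      show "finitely_generated R (frob_sections R p e \<Delta>)"
        unfolding D by (rule finitely_generated_frob_push[OF module_sections[OF frac_submodule_sections_zero]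
            p char fF finitely_generated_sections_zero])
      show "to_frac R x \<in> carrier (frob_sections R p e \<Delta>)" if "x \<in> carrier R" for x
        unfolding D using that by (simp add: sections_zero)
    qed (rule h_to_frac)
  next
    case False
    then have normal: "normal_domain R" using triple by (simp add: is_triple_def)
    interpret domain R using normal by (simp add: normal_domain_def)
    interpret noetherian_domain R
      by (rule noetherian_domain.intro[OF noeth domain_axioms])
    define D where "D = ceil_divisor (\<lambda>Q. real (p ^ e - 1) * \<Delta> Q)"
    define D' where "D' = ceil_divisor (\<lambda>Q. real (p ^ e - 1) * restrict_divisor R P \<Delta> Q)"
    have eff: "finite {Q. \<Delta> Q \<noteq> 0}" "{Q. \<Delta> Q \<noteq> 0} \<subseteq> prime_divisors R" "\<And>Q. 0 \<le> \<Delta> Q"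
      using triple by (simp_all add: is_triple_def effective_divisor_def)
    have zero: "\<zero> \<notin> carrier R - P" using primeideal_zero_mem[OF P] by simp
    interpret NL: normal_localization R "carrier R - P"
      by unfold_locales (use normal zero in auto)
    interpret LD: domain F.L by (rule F.domain_localization[OF domain_axioms zero])
    have D_nonneg: "0 \<le> D Q" for Q
    proof -
      have "0 \<le> real (p ^ e - 1) * \<Delta> Q" using eff(3) by simp
      then show ?thesis unfolding D_def ceil_divisor_def by linarith
    qed
    interpret DL: divisor_localization R "carrier R - P" D D'
    proof unfold_locales
      show "0 \<le> D Q" for Q by (rule D_nonneg)
      show "D' (F.ext_ideal Q) = D Q" if Q: "Q \<in> NL.surviving_primes" for Q
      proof -
        have "F.ext_ideal Q \<in> prime_divisors (local_ring_at R P)"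
          unfolding local_ring_at_def LD.mem_prime_divisors_iff NL.height_one_localization_iff
          using Q by blast
        moreover have "{x \<in> carrier R. to_local R P x \<in> F.ext_ideal Q} = Q"
          using F.contraction_ext[of Q] Q
          unfolding F.contraction_def to_local_def NL.surviving_primes_def height_one_def by simp
        ultimately show ?thesis
          by (simp add: D_def D'_def ceil_divisor_def restrict_divisor_def)
      qed
      show "D' Q' = 0" if "\<not> height_one F.L Q'" for Q'
        using that unfolding D'_def ceil_divisor_def restrict_divisor_def local_ring_at_def
          LD.mem_prime_divisors_iff by simp
    qed
    have eq: "frob_sections R p e \<Delta> = frob_push R p e (sections_module R D)"
      and eq': "frob_sections (local_ring_at R P) p e (restrict_divisor R P \<Delta>)
        = frob_push F.L p e (sections_module F.L D')"
      by (simp_all add: frob_sections_def D_def D'_def local_ring_at_def)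
    have supp: "{Q. D Q \<noteq> 0} \<subseteq> {Q. \<Delta> Q \<noteq> 0}"
      by (auto simp: D_def ceil_divisor_def)
    have "finitely_generated R (sections_module R D)"
    proof (rule NL.finitely_generated_sections)
      show "finite {Q. D Q \<noteq> 0}" by (rule finite_subset[OF supp eff(1)])
      show "{Q. D Q \<noteq> 0} \<subseteq> {Q. height_one R Q}"
        using supp eff(2) mem_prime_divisors_iff by blast
    qed (rule D_nonneg)
    then have fg: "finitely_generated R (frob_push R p e (sections_module R D))"
      by (rule finitely_generated_frob_push[OF module_sections[OF NL.frac_submodule_sections] p char fF])
    show thesis
    proof (rule that[of F.total_frac_map])
      show "localized_module R (carrier R - P) (frob_sections R p e \<Delta>)
          (frob_sections (local_ring_at R P) p e (restrict_divisor R P \<Delta>)) F.total_frac_map"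
        unfolding eq eq' by (rule DL.localized_module_divisor[OF p char])
      show "finitely_generated R (frob_sections R p e \<Delta>)" unfolding eq by (rule fg)
      show "to_frac R x \<in> carrier (frob_sections R p e \<Delta>)" if x: "x \<in> carrier R" for x
      proof -
        have "pole_bounded R {Q. height_one R Q} D x \<one>"
          unfolding pole_bounded_def using NL.ord_one D_nonneg by simp
        then show ?thesis
          unfolding eq to_frac_def frob_push_simps sections_module_simps NL.sections_eq
          using NL.mem_pole_bounded_fracs[of "{Q. height_one R Q}" x "\<one>" D] x by simp
      qed
    qed (rule h_to_frac)
  qed
qed

text \<open>If \<open>\<phi>(ax) = c \<notin> P\<close> with \<open>x \<in> P\<close>, then \<open>c\<^sup>-\<^sup>1\<close> times the localization of \<open>\<phi>\<close> splits \<open>1 \<mapsto> (x/1)a\<close>.\<close>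

lemma center_imp_compatible:
  fixes R (structure)
  assumes triple: "is_triple p R \<Delta> \<aa>" and center: "center_of_sharp_F_purity p R \<Delta> \<aa> P"
  shows "uniformly_compatible p R \<Delta> \<aa> P"
proof -
  interpret cring R using triple by (simp add: is_triple_def)
  have P: "primeideal P R" using center by (simp add: center_of_sharp_F_purity_def)
  interpret P: primeideal P R by (rule P)
  interpret F: fractions R "carrier R - P" by (rule fractions_prime_complement[OF P])
  interpret L: cring F.L by (rule F.cring_localization)
  have mem: "\<phi> (to_frac R (a \<otimes> x)) \<in> P"
    if e: "0 < e" and a: "a \<in> \<aa> (p ^ e - 1)"
      and \<phi>: "\<phi> \<in> module_hom R (frob_sections R p e \<Delta>) (ring_as_module R)" and x: "x \<in> P" for e a \<phi> x
  proof (rule ccontr)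
    define N' where "N' = frob_sections F.L p e (restrict_divisor R P \<Delta>)"
    obtain h where loc: "localized_module R (carrier R - P) (frob_sections R p e \<Delta>) N' h"
      and tf: "\<And>x. x \<in> carrier R \<Longrightarrow> to_frac R x \<in> carrier (frob_sections R p e \<Delta>)"
      and h: "\<And>x. x \<in> carrier R \<Longrightarrow> h (to_frac R x) = to_frac F.L (F.frac x \<one>)"
      using frob_sections_localization[OF triple P, of e]
      unfolding N'_def local_ring_at_def to_local_def by metis
    interpret M: localized_module R "carrier R - P" "frob_sections R p e \<Delta>" N' h by (rule loc)
    have "ideal (\<aa> (p ^ e - 1)) R" using triple by (simp add: is_triple_def graded_system_def)
    then have ac: "a \<in> carrier R" using a by (rule ideal.Icarr)
    have xc: "x \<in> carrier R" using x by (rule P.Icarr)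
    define c where "c = \<phi> (to_frac R (a \<otimes> x))"
    assume "\<phi> (to_frac R (a \<otimes> x)) \<notin> P"
    moreover have "c \<in> carrier R"
      using \<phi> tf[OF m_closed[OF ac xc]] by (auto simp: module_hom_def c_def)
    ultimately have c: "c \<in> carrier R - P" by (simp add: c_def)
    obtain \<theta> where \<theta>: "\<theta> \<in> module_hom F.L N' (ring_as_module F.L)"
      and \<theta>h: "\<And>n. n \<in> carrier (frob_sections R p e \<Delta>) \<Longrightarrow> \<theta> (h n) = F.frac (\<phi> n) \<one>"
      using M.localize_hom[OF \<phi>] by blast
    define \<theta>' where "\<theta>' n = F.frac \<one> c \<otimes>\<^bsub>F.L\<^esub> \<theta> n" for n
    have inv: "F.frac \<one> c \<in> carrier F.L" using c by simp
    have \<theta>c: "\<theta> n \<in> carrier F.L" if "n \<in> carrier N'" for n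
      using \<theta> that by (auto simp: module_hom_def)
    have \<theta>': "\<theta>' \<in> module_hom F.L N' (ring_as_module F.L)"
      using \<theta> inv \<theta>c by (auto simp: module_hom_def \<theta>'_def L.r_distr L.m_lcomm)
    define g where "g = F.frac x \<one> \<otimes>\<^bsub>F.L\<^esub> F.frac a \<one>"
    have g: "g = F.frac (a \<otimes> x) \<one>"
      using ac xc F.S_one m_comm[of x a] by (simp add: g_def F.mult_frac)
    have hg: "h (to_frac R (a \<otimes> x)) = to_frac F.L g"
      unfolding g by (rule h[OF m_closed[OF ac xc]])
    have gN: "to_frac F.L g \<in> carrier N'"
      using M.h_closed[OF tf[OF m_closed[OF ac xc]]] unfolding hg .
    have "\<theta> (to_frac F.L g) = F.frac c \<one>"
      using \<theta>h[OF tf[OF m_closed[OF ac xc]]] unfolding hg c_def .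
    then have one: "\<theta>' (to_frac F.L g) = \<one>\<^bsub>F.L\<^esub>"
      using c F.S_one F.frac_self[OF c] by (simp add: \<theta>'_def F.mult_frac)
    have "\<theta>' (frob_map F.L p e (restrict_divisor R P \<Delta>) g r) = r" if r: "r \<in> carrier F.L" for r
    proof -
      have "\<theta>' (r \<odot>\<^bsub>N'\<^esub> to_frac F.L g) = r \<otimes>\<^bsub>F.L\<^esub> \<theta>' (to_frac F.L g)"
        using \<theta>' r gN by (auto simp: module_hom_def)
      then show ?thesis using one r by (simp add: frob_map_def N'_def)
    qed
    then have "map_splits F.L (ring_as_module F.L) N' (frob_map F.L p e (restrict_divisor R P \<Delta>) g)"
      unfolding map_splits_def using \<theta>' by auto
    moreover have "F.frac x \<one> \<in> local_max_ideal R P"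
      using F.genideal_base_image[OF P.is_ideal] x F.S_one
      by (auto simp: local_max_ideal_def local_ring_at_def to_local_def[abs_def] F.ext_ideal_def)
    ultimately show False
      using center e a unfolding center_of_sharp_F_purity_def Let_def local_ring_at_def to_local_def
        g_def N'_def by blast
  qed
  then show ?thesis
    unfolding uniformly_compatible_def using P.is_ideal by (auto simp: image_subset_iff)
qed

text \<open>A splitting for \<open>f = x/s\<close> is evaluated at the scalar \<open>s\<close>: its argument becomes \<open>a (s\<^bsup>q-1\<^esup> x)\<close>, which comes
  from \<open>R\<close>, and its value is \<open>s \<notin> P\<close>. Descent to \<open>R\<close> gives a map with a value outside \<open>P\<close> although
  \<open>s\<^bsup>q-1\<^esup> x \<in> P\<close>.\<close>

lemma compatible_imp_center:
  fixes R (structure)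
  assumes triple: "is_triple p R \<Delta> \<aa>" and P: "primeideal P R"
    and compat: "uniformly_compatible p R \<Delta> \<aa> P"
  shows "center_of_sharp_F_purity p R \<Delta> \<aa> P"
proof -
  interpret cring R using triple by (simp add: is_triple_def)
  interpret P: primeideal P R by (rule P)
  interpret F: fractions R "carrier R - P" by (rule fractions_prime_complement[OF P])
  interpret L: cring F.L by (rule F.cring_localization)
  interpret KL: cring "total_frac F.L" by (rule L.cring_total_frac)
  have p: "Factorial_Ring.prime p" and noeth: "noetherian_ring R"
    using triple by (simp_all add: is_triple_def)
  have False
    if f: "f \<in> local_max_ideal R P" and e: "0 < e" and a: "a \<in> \<aa> (p ^ e - 1)"
      and splits: "map_splits F.L (ring_as_module F.L) (frob_sections F.L p e (restrict_divisor R P \<Delta>))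
        (frob_map F.L p e (restrict_divisor R P \<Delta>) (f \<otimes>\<^bsub>F.L\<^esub> F.frac a \<one>))" for f e a
  proof -
    define N' where "N' = frob_sections F.L p e (restrict_divisor R P \<Delta>)"
    obtain h where loc: "localized_module R (carrier R - P) (frob_sections R p e \<Delta>) N' h"
      and fg: "finitely_generated R (frob_sections R p e \<Delta>)"
      and tf: "\<And>x. x \<in> carrier R \<Longrightarrow> to_frac R x \<in> carrier (frob_sections R p e \<Delta>)"
      and h: "\<And>x. x \<in> carrier R \<Longrightarrow> h (to_frac R x) = to_frac F.L (F.frac x \<one>)"
      using frob_sections_localization[OF triple P, of e]
      unfolding N'_def local_ring_at_def to_local_def by metis
    interpret M: localized_module R "carrier R - P" "frob_sections R p e \<Delta>" N' h by (rule loc)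
    have "ideal (\<aa> (p ^ e - 1)) R" using triple by (simp add: is_triple_def graded_system_def)
    then have ac: "a \<in> carrier R" using a by (rule ideal.Icarr)
    have "f \<in> F.ext_ideal P"
      using f F.genideal_base_image[OF P.is_ideal]
      by (simp add: local_max_ideal_def local_ring_at_def to_local_def[abs_def])
    then obtain x s where x: "x \<in> P" "s \<in> carrier R - P" "f = F.frac x s"
      unfolding F.ext_ideal_def by blast
    have xc: "x \<in> carrier R" and sc: "s \<in> carrier R" using x P.Icarr by auto
    obtain \<theta> where \<theta>: "\<theta> \<in> module_hom F.L N' (ring_as_module F.L)"
      and split: "\<And>r. r \<in> carrier F.L \<Longrightarrow> \<theta> (r \<odot>\<^bsub>N'\<^esub> to_frac F.L (f \<otimes>\<^bsub>F.L\<^esub> F.frac a \<one>)) = r"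
      using splits unfolding map_splits_def frob_map_def N'_def by auto
    have "0 < p ^ e" using p by (simp add: prime_gt_0_nat)
    then obtain m where m: "p ^ e = Suc m" by (metis Suc_pred)
    define y where "y = s [^] m \<otimes> x"
    have y: "y \<in> P" unfolding y_def using x(1) sc by (intro P.I_l_closed) simp_all
    have yc: "y \<in> carrier R" using y by (rule P.Icarr)
    have ay: "a \<otimes> y \<in> carrier R" using ac yc by simp
    have fc: "f \<otimes>\<^bsub>F.L\<^esub> F.frac a \<one> \<in> carrier F.L"
      using x xc ac F.S_one by simp
    have s1: "F.frac s \<one> \<in> carrier F.L" using sc F.S_one by simp
    define k where "k = s [^] m"
    have kc: "k \<in> carrier R" unfolding k_def using sc by simp
    have frac_xa: "f \<otimes>\<^bsub>F.L\<^esub> F.frac a \<one> = F.frac (x \<otimes> a) s"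
      unfolding x(3) using F.mult_frac[OF xc x(2) ac F.S_one] sc by simp
    have "F.frac (k \<otimes> s) \<one> \<otimes>\<^bsub>F.L\<^esub> F.frac (x \<otimes> a) s
        = F.frac ((k \<otimes> s) \<otimes> (x \<otimes> a)) (\<one> \<otimes> s)"
      using kc sc xc ac x(2) F.S_one by (intro F.mult_frac) simp_all
    also have "\<dots> = F.frac (a \<otimes> y) \<one>"
    proof (rule F.frac_eqI)
      show "\<one> \<otimes> ((k \<otimes> s) \<otimes> (x \<otimes> a)) = (\<one> \<otimes> s) \<otimes> (a \<otimes> y)"
        unfolding y_def k_def[symmetric] using kc sc xc ac by (simp add: m_ac)
    qed (use kc sc xc ac ay x(2) F.S_one in simp_all)
    finally have "F.frac s \<one> [^]\<^bsub>F.L\<^esub> (p ^ e) \<otimes>\<^bsub>F.L\<^esub> (f \<otimes>\<^bsub>F.L\<^esub> F.frac a \<one>)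
        = F.frac (a \<otimes> y) \<one>"
      unfolding m F.frac_nat_pow[OF sc] frac_xa nat_pow_Suc k_def .
    then have eq: "F.frac s \<one> \<odot>\<^bsub>N'\<^esub> to_frac F.L (f \<otimes>\<^bsub>F.L\<^esub> F.frac a \<one>)
        = h (to_frac R (a \<otimes> y))"
      unfolding h[OF ay] N'_def frob_sections_def frob_push_simps sections_module_simps
      using ring_hom_mult[OF L.to_frac_hom L.nat_pow_closed[OF s1] fc, of "p ^ e"] by simp
    obtain \<phi> w where \<phi>: "\<phi> \<in> module_hom R (frob_sections R p e \<Delta>) (ring_as_module R)"
      and w: "w \<in> carrier R - P"
      and \<phi>\<theta>: "\<And>n. n \<in> carrier (frob_sections R p e \<Delta>) \<Longrightarrow>
        F.frac (\<phi> n) \<one> = F.frac w \<one> \<otimes>\<^bsub>F.L\<^esub> \<theta> (h n)"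
      using M.descend_hom[OF noeth fg \<theta>] by blast
    define n where "n = to_frac R (a \<otimes> y)"
    have nN: "n \<in> carrier (frob_sections R p e \<Delta>)" unfolding n_def by (rule tf[OF ay])
    have \<phi>n: "\<phi> n \<in> P"
      using compat e a \<phi> y unfolding uniformly_compatible_def n_def by blast
    have \<phi>nc: "\<phi> n \<in> carrier R" using \<phi>n by (rule P.Icarr)
    have "\<theta> (h n) = F.frac s \<one>" using split[OF s1] unfolding eq n_def .
    then have "F.frac (\<phi> n) \<one> = F.frac (w \<otimes> s) \<one>"
      using \<phi>\<theta>[OF nN] w sc F.S_one by (simp add: F.mult_frac)
    then obtain u where u: "u \<in> carrier R - P" "u \<otimes> \<phi> n = u \<otimes> (w \<otimes> s)"
      using \<phi>nc w sc F.S_one by (auto simp: F.frac_eq_iff)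
    have "u \<otimes> \<phi> n \<in> P" using u(1) \<phi>n by (intro P.I_l_closed) simp_all
    then show False using F.S_mult[OF u(1) F.S_mult[OF w x(2)]] u(2) by simp
  qed
  then show ?thesis
    using P unfolding center_of_sharp_F_purity_def Let_def local_ring_at_def to_local_def by blast
qed

theorem proposition4p7:
  fixes p :: nat
    and R :: "('a, 'b) ring_scheme"
    and \<Delta> :: "'a set \<Rightarrow> real"
    and \<aa> :: "nat \<Rightarrow> 'a set"
  assumes "is_triple p R \<Delta> \<aa>"
  shows "{P. center_of_sharp_F_purity p R \<Delta> \<aa> P} =
         {P. primeideal P R \<and> uniformly_compatible p R \<Delta> \<aa> P}"
  using center_imp_compatible[OF assms] compatible_imp_center[OF assms]
  unfolding center_of_sharp_F_purity_def by blast

end
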